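(* Let $p,q$ be positive integers, let $X$ in $\mathbb R^p$ and $Y$ in $\mathbb R^q$ be random vectors, and for each $n$ let $(\mathbf X,\mathbf Y)=\{(X_k,Y_k):k=1,\dots,n\}$ be a random sample from the joint distribution of $(X,Y)$ and $\mathcal V_n^2=\mathcal V_n^2(\mathbf X,\mathbf Y)$. Let $\zeta(\cdot)$ denote a complex-valued zero-mean Gaussian random process with covariance function $$R(u,u_0)=\big(f_X(t-t_0)-f_X(t)\overline{f_X(t_0)}\big)\big(f_Y(s-s_0)-f_Y(s)\overline{f_Y(s_0)}\big),$$ where $u=(t,s)$, $u_0=(t_0,s_0)\in\mathbb R^p\times\mathbb R^q$. If $X$ and $Y$ are independent and $E(|X|_p+|Y|_q)<\infty$, then $n\mathcal V_n^2$ converges in distribution to $\|\zeta(t,s)\|^2$ as $n\to\infty$.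
   Context: $|\cdot|_d$ is the Euclidean norm on $\mathbb R^d$; $f_X,f_Y$ are the characteristic functions of $X,Y$; the bar denotes complex conjugation. Empirical distance covariance: put $a_{kl}=|X_k-X_l|_p$, $\bar a_{k\cdot}=\frac1n\sum_{l=1}^n a_{kl}$, $\bar a_{\cdot l}=\frac1n\sum_{k=1}^n a_{kl}$, $\bar a_{\cdot\cdot}=\frac1{n^2}\sum_{k,l=1}^n a_{kl}$, $A_{kl}=a_{kl}-\bar a_{k\cdot}-\bar a_{\cdot l}+\bar a_{\cdot\cdot}$; similarly $b_{kl}=|Y_k-Y_l|_q$ and $B_{kl}=b_{kl}-\bar b_{k\cdot}-\bar b_{\cdot l}+\bar b_{\cdot\cdot}$, for $k,l=1,\dots,n$. Then $\mathcal V_n^2(\mathbf X,\mathbf Y)=\frac1{n^2}\sum_{k,l=1}^n A_{kl}B_{kl}$. Norm: for a complex function $\gamma$ on $\mathbb R^p\times\mathbb R^q$, $$\|\gamma(t,s)\|^2=\int_{\mathbb R^{p+q}}\frac{|\gamma(t,s)|^2}{c_pc_q|t|_p^{1+p}|s|_q^{1+q}}\,dt\,ds,\qquad c_d=\frac{\pi^{(1+d)/2}}{\Gamma((1+d)/2)}.$$ The covariance function of the zero-mean process $\zeta$ is $E[\zeta(u)\overline{\zeta(u_0)}]$, and $\zeta(t,s)=\zeta(u)$ for $u=(t,s)$.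
   Formalization: The process ζ is also assumed jointly measurable and to satisfy ζ(−u) = conj ζ(u) almost surely for each u; R alone does not fix its law, and for Bernoulli X, Y a circularly symmetric Gaussian ζ with covariance R gives a wrong limit. *)

theory Defs
  imports "HOL-Probability.Probability"
begin

text \<open>Characteristic function of a random vector (the library constant \<open>char\<close> only covers
  distributions on the real line).\<close>

definition charfun :: "'w measure \<Rightarrow> ('w \<Rightarrow> 'a::euclidean_space) \<Rightarrow> 'a \<Rightarrow> complex" where
  "charfun M X t = (CLINT \<omega>|M. iexp (t \<bullet> X \<omega>))"

text \<open>The library predicate \<open>indep_var\<close> requires both variables to take values in the same type,
  so independence is stated for the generated \<open>\<sigma>\<close>-algebras, as in \<open>indep_var_eq\<close>.\<close>

definition indep_random_vectors ::
    "'w measure \<Rightarrow> ('w \<Rightarrow> 'a::euclidean_space) \<Rightarrow> ('w \<Rightarrow> 'b::euclidean_space) \<Rightarrow> bool" where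
  "indep_random_vectors M X Y \<longleftrightarrow>
     X \<in> borel_measurable M \<and> Y \<in> borel_measurable M \<and>
     prob_space.indep_set M {X -` A \<inter> space M | A. A \<in> sets borel}
                            {Y -` B \<inter> space M | B. B \<in> sets borel}"

definition random_sample ::
    "'w measure \<Rightarrow> ('w \<Rightarrow> 'a::euclidean_space) \<Rightarrow> ('w \<Rightarrow> 'b::euclidean_space) \<Rightarrow>
     nat \<Rightarrow> (nat \<Rightarrow> 'w \<Rightarrow> 'a) \<Rightarrow> (nat \<Rightarrow> 'w \<Rightarrow> 'b) \<Rightarrow> bool" where
  "random_sample M X Y n Xs Ys \<longleftrightarrow>
     prob_space.indep_vars M (\<lambda>_. borel) (\<lambda>k \<omega>. (Xs k \<omega>, Ys k \<omega>)) {1..n} \<and>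
     (\<forall>k\<in>{1..n}. distr M borel (\<lambda>\<omega>. (Xs k \<omega>, Ys k \<omega>)) = distr M borel (\<lambda>\<omega>. (X \<omega>, Y \<omega>)))"

definition dist_matrix :: "(nat \<Rightarrow> 'a::euclidean_space) \<Rightarrow> nat \<Rightarrow> nat \<Rightarrow> real" where
  "dist_matrix x k l = norm (x k - x l)"

definition double_centered :: "nat \<Rightarrow> (nat \<Rightarrow> nat \<Rightarrow> real) \<Rightarrow> nat \<Rightarrow> nat \<Rightarrow> real" where
  "double_centered n a k l =
     a k l - (\<Sum>j=1..n. a k j) / real n - (\<Sum>i=1..n. a i l) / real n
       + (\<Sum>i=1..n. \<Sum>j=1..n. a i j) / (real n)\<^sup>2"

text \<open>The squared empirical distance covariance of the points \<open>(x k, y k)\<close>, \<open>k = 1, \<dots>, n\<close>.\<close>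

definition dcov_sq ::
    "nat \<Rightarrow> (nat \<Rightarrow> 'a::euclidean_space) \<Rightarrow> (nat \<Rightarrow> 'b::euclidean_space) \<Rightarrow> real" where
  "dcov_sq n x y =
     (\<Sum>k=1..n. \<Sum>l=1..n.
        double_centered n (dist_matrix x) k l * double_centered n (dist_matrix y) k l) / (real n)\<^sup>2"

definition c_const :: "nat \<Rightarrow> real" where
  "c_const d = pi powr ((1 + real d) / 2) / Gamma ((1 + real d) / 2)"

text \<open>The squared weighted \<open>L\<^sup>2\<close> norm. As a Bochner integral it is \<open>0\<close> if the integral
  diverges; the random functions it is applied to below have almost surely finite norm.\<close>

definition weighted_norm_sq :: "((real^'p) \<times> (real^'q) \<Rightarrow> complex) \<Rightarrow> real" where
  "weighted_norm_sq \<gamma> =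
     (LINT (t, s)|lborel.
        (cmod (\<gamma> (t, s)))\<^sup>2 /
          (c_const CARD('p) * c_const CARD('q) * norm t ^ (1 + CARD('p)) * norm s ^ (1 + CARD('q))))"

text \<open>Univariate normal law, with point masses as the case of zero variance.\<close>

definition gaussian_rv :: "'w measure \<Rightarrow> ('w \<Rightarrow> real) \<Rightarrow> bool" where
  "gaussian_rv M Z \<longleftrightarrow>
     Z \<in> borel_measurable M \<and>
     ((\<exists>\<mu>. distr M borel Z = return borel \<mu>) \<or>
      (\<exists>\<mu> \<sigma>. \<sigma> > 0 \<and> distributed M lborel Z (normal_density \<mu> \<sigma>)))"

text \<open>Gaussianity of a complex process means joint Gaussianity of all real and imaginary parts.\<close>

definition complex_gaussian_process :: "'w measure \<Rightarrow> ('u \<Rightarrow> 'w \<Rightarrow> complex) \<Rightarrow> bool" where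
  "complex_gaussian_process M \<zeta> \<longleftrightarrow>
     prob_space M \<and>
     (\<forall>U a b. finite U \<longrightarrow>
        gaussian_rv M (\<lambda>\<omega>. \<Sum>u\<in>U. a u * Re (\<zeta> u \<omega>) + b u * Im (\<zeta> u \<omega>)))"

definition zero_mean_process :: "'w measure \<Rightarrow> ('u \<Rightarrow> 'w \<Rightarrow> complex) \<Rightarrow> bool" where
  "zero_mean_process M \<zeta> \<longleftrightarrow> (\<forall>u. (CLINT \<omega>|M. \<zeta> u \<omega>) = 0)"

definition has_covariance_function ::
    "'w measure \<Rightarrow> ('u \<Rightarrow> 'w \<Rightarrow> complex) \<Rightarrow> ('u \<Rightarrow> 'u \<Rightarrow> complex) \<Rightarrow> bool" where
  "has_covariance_function M \<zeta> R \<longleftrightarrow>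
     (\<forall>u u0. (CLINT \<omega>|M. \<zeta> u \<omega> * cnj (\<zeta> u0 \<omega>)) = R u u0)"

text \<open>The covariance function alone does not determine the law of a complex Gaussian process: one also
  needs \<open>E[\<zeta>(u) \<zeta>(u0)]\<close>. The limit process inherits \<open>\<zeta>(-u) = cnj (\<zeta>(u))\<close> from the empirical
  process \<open>\<surd>n (f\<^sup>n\<^bsub>X,Y\<^esub>(t, s) - f\<^sup>n\<^bsub>X\<^esub>(t) f\<^sup>n\<^bsub>Y\<^esub>(s))\<close>; this fixes
  \<open>E[\<zeta>(u) \<zeta>(u0)] = R(u, -u0)\<close>. Without it the limit law of the theorem may be wrong, for
  example for a circularly symmetric process with covariance function \<open>R\<close>.\<close>

definition hermitian_process :: "'w measure \<Rightarrow> ('u::uminus \<Rightarrow> 'w \<Rightarrow> complex) \<Rightarrow> bool" where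
  "hermitian_process M \<zeta> \<longleftrightarrow> (\<forall>u. AE \<omega> in M. \<zeta> (- u) \<omega> = cnj (\<zeta> u \<omega>))"

text \<open>Joint measurability makes the norm of a sample path a random variable.\<close>

definition jointly_measurable_process ::
    "'w measure \<Rightarrow> ('u::topological_space \<Rightarrow> 'w \<Rightarrow> complex) \<Rightarrow> bool" where
  "jointly_measurable_process M \<zeta> \<longleftrightarrow>
     (\<lambda>(\<omega>, u). \<zeta> u \<omega>) \<in> borel_measurable (M \<Otimes>\<^sub>M borel)"

definition limit_cov ::
    "'w measure \<Rightarrow> ('w \<Rightarrow> 'a::euclidean_space) \<Rightarrow> ('w \<Rightarrow> 'b::euclidean_space) \<Rightarrow>
     'a \<times> 'b \<Rightarrow> 'a \<times> 'b \<Rightarrow> complex" where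
  "limit_cov M X Y = (\<lambda>(t, s) (t0, s0).
     (charfun M X (t - t0) - charfun M X t * cnj (charfun M X t0)) *
     (charfun M Y (s - s0) - charfun M Y s * cnj (charfun M Y s0)))"

end

theory Submission imports Defs begin

text \<open>Let \<open>\<zeta>\<^sub>n = \<surd>n (f\<^sup>n\<^bsub>X,Y\<^esub> - f\<^sup>n\<^bsub>X\<^esub> f\<^sup>n\<^bsub>Y\<^esub>)\<close> be the empirical process formed from the
empirical characteristic functions, let \<open>\<mu>\<close> be the measure with the singular weight of the norm as its
density, and write \<open>R\<close> for the limiting covariance.

\<^item> The statistic is a norm: \<open>n \<V>\<^sub>n\<^sup>2 = \<integral> \<bar>\<zeta>\<^sub>n\<bar>\<^sup>2 d\<mu>\<close> (\<open>dcov_sq_eq_integral\<close>). Behind this is the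
  identity \<open>\<integral> (1 - cos (t \<bullet> x)) / (c\<^sub>d \<bar>t\<bar>\<^bsup>1+d\<^esup>) dt = \<bar>x\<bar>\<close>, obtained by writing the weight as a mixture of
  Gaussian densities (\<open>nn_integral_one_minus_cos_kernel\<close>); it also gives \<open>\<integral> R(u,u) d\<mu>(u) < \<infinity>\<close>.

\<^item> Under independence \<open>\<zeta>\<^sub>n\<close> is a normalised sum \<open>\<xi>\<^sub>n\<close> of independent centered products
  \<open>(exp(i t \<bullet> X\<^sub>k) - f\<^sub>X(t)) (exp(i s \<bullet> Y\<^sub>k) - f\<^sub>Y(s))\<close> minus a remainder with second moment \<open>R(u,u)/n\<close>, which
  vanishes in the norm (\<open>dcov_sq_approximation\<close>).

\<^item> The processes \<open>\<xi>\<^sub>n\<close> and \<open>\<zeta>\<close> have the same covariance \<open>R\<close>. Second moments alone bound the expected error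
  made when \<open>\<integral> \<bar>\<gamma>\<bar>\<^sup>2 d\<mu>\<close> is replaced by a suitable finite sum \<open>\<Sum> m\<^sub>v \<bar>\<gamma>(v)\<bar>\<^sup>2\<close>, so one finite sum serves
  for \<open>\<zeta>\<close> and for all \<open>n\<close> at the same time (\<open>discretization_error\<close>, \<open>discretization_exists\<close>). This
  takes the place of tightness in a function space.

\<^item> For a finite sum only real linear functionals of the process matter: their characteristic functions
  converge to Gaussian ones by the central limit theorem (\<open>product_process_char_tendsto\<close>), and
  \<open>exp(-\<lambda> w\<^sup>2)\<close> is an average of \<open>exp(i \<surd>(2 \<lambda>) g w)\<close> over a standard normal \<open>g\<close>. Hence the Laplace
  transforms of the finite sums converge (\<open>exp_quadratic_form_converges\<close>).

\<^item> Consequently the Laplace transforms of \<open>n \<V>\<^sub>n\<^sup>2\<close> converge to those of the norm of \<open>\<zeta>\<close> at the natural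
  numbers; with \<open>z = exp(-x)\<close> these are the moments of laws on \<open>[0, 1]\<close>, and Weierstrass'
  approximation theorem turns their convergence into weak convergence
  (\<open>weak_conv_of_Laplace_transforms\<close>).\<close>

section \<open>Laplace transforms and weak convergence\<close>

lemma tendsto_by_approximation:
  fixes x :: "nat \<Rightarrow> 'a::real_normed_vector"
  assumes "\<And>e. e > 0 \<Longrightarrow> \<exists>y l. y \<longlonglongrightarrow> l \<and> (\<forall>\<^sub>F n in sequentially. norm (x n - y n) \<le> e) \<and> norm (a - l) \<le> e"
  shows "x \<longlonglongrightarrow> a"
proof (rule metric_LIMSEQ_I)
  fix r :: real assume "r > 0"
  then have "r / 4 > 0" by simp
  from assms[OF this] obtain y l where yl: "y \<longlonglongrightarrow> l" "\<forall>\<^sub>F n in sequentially. norm (x n - y n) \<le> r / 4"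
    "norm (a - l) \<le> r / 4" by blast
  have "\<forall>\<^sub>F n in sequentially. dist (y n) l < r / 4"
    using yl(1) \<open>r / 4 > 0\<close> by (rule tendstoD)
  with yl(2) have "\<forall>\<^sub>F n in sequentially. dist (x n) a < r"
  proof eventually_elim
    case (elim n)
    have "dist (x n) a \<le> dist (x n) (y n) + dist (y n) l + dist l a"
      using dist_triangle[of "x n" a "y n"] dist_triangle[of "y n" a l] by linarith
    with elim yl(3) \<open>r > 0\<close> show ?case by (simp add: dist_norm norm_minus_commute)
  qed
  then show "\<exists>no. \<forall>n\<ge>no. dist (x n) a < r" by (simp add: eventually_sequentially)
qed

text \<open>For nonnegative variables \<open>z = exp (- x)\<close> maps the real line to \<open>[0, 1]\<close>, and the Laplace transform at
\<open>k\<close> becomes the \<open>k\<close>-th moment of \<open>z\<close>. A continuous step function of \<open>x\<close> vanishes for large \<open>x\<close>, hence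
is a continuous function of \<open>z\<close> on the closed interval and a uniform limit of polynomials in \<open>z\<close>.\<close>

lemma weak_conv_of_Laplace_transforms:
  fixes T :: "nat \<Rightarrow> 'a \<Rightarrow> real" and T' :: "'b \<Rightarrow> real"
  assumes "prob_space M" "prob_space N"
    and T[measurable]: "\<And>n. T n \<in> borel_measurable M" and T'[measurable]: "T' \<in> borel_measurable N"
    and pos: "\<And>n \<omega>. \<omega> \<in> space M \<Longrightarrow> 0 \<le> T n \<omega>" "\<And>\<omega>. \<omega> \<in> space N \<Longrightarrow> 0 \<le> T' \<omega>"
    and Laplace: "\<And>k::nat. (\<lambda>n. LINT \<omega>|M. exp (- (real k * T n \<omega>))) \<longlonglongrightarrow> (LINT \<omega>|N. exp (- (real k * T' \<omega>)))"
  shows "weak_conv_m (\<lambda>n. distr M borel (T n)) (distr N borel T')"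
proof (rule integral_cts_step_conv_imp_weak_conv)
  interpret M: prob_space M by fact
  interpret N: prob_space N by fact
  show "real_distribution (distr M borel (T n))" for n by simp
  show "real_distribution (distr N borel T')" by simp
  fix x y :: real assume xy: "x < y"
  define h where "h z = (if z \<le> 0 then 0 else cts_step x y (- ln z))" for z
  have cs[measurable]: "cts_step x y \<in> borel_measurable borel"
    using cts_step_uniformly_continuous[OF xy] by (intro borel_measurable_continuous_onI) (rule uniformly_continuous_imp_continuous)
  have h_exp: "h (exp (- t)) = cts_step x y t" for t by (simp add: h_def)
  have conth: "continuous_on {0..1} h"
  proof (rule continuous_on_subset)
    \<comment> \<open>near \<open>z = 0\<close>, that is for \<open>x > y\<close>, the step function vanishes\<close>
    have "continuous_on ({0<..} \<union> {..< exp (- y)}) h"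
    proof (rule continuous_on_open_Un)
      have "continuous_on {0<..} (\<lambda>z::real. cts_step x y (- ln z))"
        by (rule continuous_on_compose2[OF uniformly_continuous_imp_continuous[OF cts_step_uniformly_continuous[OF xy]]])
           (auto intro!: continuous_intros)
      then show "continuous_on {0<..} h"
        by (rule continuous_on_eq) (auto simp: h_def)
      have "h z = 0" if "z < exp (- y)" for z
      proof (cases "z \<le> 0")
        case False
        with that have "ln z < - y" by (metis exp_less_cancel_iff exp_ln not_less)
        then show ?thesis using xy by (simp add: h_def cts_step_def)
      qed (simp add: h_def)
      then show "continuous_on {..< exp (- y)} h"
        using continuous_on_eq[OF continuous_on_const[of _ 0]] by (metis lessThan_iff)
    qed auto
    then show "continuous_on UNIV h"
    proof (rule continuous_on_subset, intro subsetI)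
      fix z :: real
      show "z \<in> {0<..} \<union> {..< exp (- y)}"
        using exp_gt_zero[of "- y"] by (cases "z > 0") (simp_all del: exp_gt_zero)
    qed
  qed auto
  have "(\<lambda>n. LINT \<omega>|M. cts_step x y (T n \<omega>)) \<longlonglongrightarrow> (LINT \<omega>|N. cts_step x y (T' \<omega>))"
  proof (rule tendsto_by_approximation)
    fix e :: real assume e: "e > 0"
    obtain p where p: "real_polynomial_function p" "\<And>z. z \<in> {0..1} \<Longrightarrow> \<bar>h z - p z\<bar> < e"
      using Stone_Weierstrass_real_polynomial_function[OF _ conth e] by (metis compact_Icc)
    obtain a d where pd: "p = (\<lambda>z. \<Sum>i\<le>d. a i * z ^ i)"
      using p(1) real_polynomial_function_iff_sum by metis
    have p_exp: "p (exp (- t)) = (\<Sum>i\<le>d. a i * exp (- (real i * t)))" for t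
      by (simp add: pd exp_of_nat_mult[symmetric])
    have bdd: "integrable Q (\<lambda>\<omega>. exp (- (real i * U \<omega>)))"
      if "prob_space Q" "U \<in> borel_measurable Q" "\<And>\<omega>. \<omega> \<in> space Q \<Longrightarrow> 0 \<le> U \<omega>" for Q :: "'q measure" and U i
    proof -
      interpret prob_space Q by fact
      note [measurable] = that(2)
      show ?thesis by (rule integrable_const_bound[of _ 1]) (auto intro!: AE_I2 mult_nonneg_nonneg that)
    qed
    have close: "norm ((LINT \<omega>|Q. cts_step x y (U \<omega>)) - (\<Sum>i\<le>d. a i * (LINT \<omega>|Q. exp (- (real i * U \<omega>))))) \<le> e"
      if "prob_space Q" "U \<in> borel_measurable Q" "\<And>\<omega>. \<omega> \<in> space Q \<Longrightarrow> 0 \<le> U \<omega>" for Q :: "'q measure" and U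
    proof -
      interpret prob_space Q by fact
      note [measurable] = that(2)
      have i1: "integrable Q (\<lambda>\<omega>. cts_step x y (U \<omega>))"
        using xy by (intro integrable_const_bound[of _ 1]) (auto simp: cts_step_def)
      have i2: "integrable Q (\<lambda>\<omega>. p (exp (- U \<omega>)))"
        unfolding p_exp using bdd[OF that] by auto
      have "(\<Sum>i\<le>d. a i * (LINT \<omega>|Q. exp (- (real i * U \<omega>)))) = (LINT \<omega>|Q. p (exp (- U \<omega>)))"
        unfolding p_exp using bdd[OF that] by (subst Bochner_Integration.integral_sum) auto
      then have "norm ((LINT \<omega>|Q. cts_step x y (U \<omega>)) - (\<Sum>i\<le>d. a i * (LINT \<omega>|Q. exp (- (real i * U \<omega>)))))
         = norm (LINT \<omega>|Q. cts_step x y (U \<omega>) - p (exp (- U \<omega>)))"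
        using i1 i2 by simp
      also have "\<dots> \<le> (LINT \<omega>|Q. e)"
      proof (rule order_trans[OF integral_norm_bound integral_mono])
        show "norm (cts_step x y (U \<omega>) - p (exp (- U \<omega>))) \<le> e" if "\<omega> \<in> space Q" for \<omega>
          using p(2)[of "exp (- U \<omega>)"] \<open>\<And>\<omega>. \<omega> \<in> space Q \<Longrightarrow> 0 \<le> U \<omega>\<close>[OF that] by (simp add: h_exp)
      qed (use i1 i2 in auto)
      also have "\<dots> = e" by (simp add: prob_space)
      finally show ?thesis .
    qed
    show "\<exists>v l. v \<longlonglongrightarrow> l \<and>
       (\<forall>\<^sub>F n in sequentially. norm ((LINT \<omega>|M. cts_step x y (T n \<omega>)) - v n) \<le> e) \<and>
       norm ((LINT \<omega>|N. cts_step x y (T' \<omega>)) - l) \<le> e"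
    proof (intro exI conjI)
      show "(\<lambda>n. \<Sum>i\<le>d. a i * (LINT \<omega>|M. exp (- (real i * T n \<omega>)))) \<longlonglongrightarrow>
            (\<Sum>i\<le>d. a i * (LINT \<omega>|N. exp (- (real i * T' \<omega>))))"
        by (intro tendsto_intros Laplace)
      show "\<forall>\<^sub>F n in sequentially. norm ((LINT \<omega>|M. cts_step x y (T n \<omega>)) -
           (\<Sum>i\<le>d. a i * (LINT \<omega>|M. exp (- (real i * T n \<omega>))))) \<le> e"
        by (intro always_eventually allI close) (auto intro: pos assms)
    qed (intro close; auto intro: pos assms)
  qed
  then show "(\<lambda>n. integral\<^sup>L (distr M borel (T n)) (cts_step x y)) \<longlonglongrightarrow> integral\<^sup>L (distr N borel T') (cts_step x y)"
    by (simp add: integral_distr)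
qed

text \<open>A quantity between a characteristic function (\<open>K\<close> empty) and the Laplace transform of a quadratic form
(\<open>c = 0\<close>, \<open>K = J\<close>); enlarging \<open>K\<close> by one index at a time leads from one to the other.\<close>

definition damped_char :: "'a measure \<Rightarrow> 'j set \<Rightarrow> ('j \<Rightarrow> real) \<Rightarrow> ('j \<Rightarrow> 'a \<Rightarrow> real) \<Rightarrow> ('j \<Rightarrow> real) \<Rightarrow> 'j set \<Rightarrow> complex" where
  "damped_char Q J l U c K =
     (CLINT \<omega>|Q. iexp (\<Sum>j\<in>J. c j * U j \<omega>) * exp (- (\<Sum>j\<in>K. l j * (U j \<omega>)\<^sup>2)))"

text \<open>A Gaussian factor \<open>exp (- l w\<^sup>2)\<close> is the characteristic function of a standard normal \<open>g\<close> at
\<open>\<surd>(2 l) w\<close>. Exchanging the two expectations trades the new quadratic term for a random shift of the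
coefficient \<open>c k\<close>.\<close>

lemma damped_char_insert:
  fixes U :: "'j \<Rightarrow> 'a \<Rightarrow> real"
  assumes Q: "prob_space Q" and U[measurable]: "\<And>j. j \<in> J \<Longrightarrow> U j \<in> borel_measurable Q"
    and J: "finite J" "insert k K \<subseteq> J" "k \<notin> K" and l: "\<And>j. l j \<ge> 0"
  shows "damped_char Q J l U c (insert k K) =
         (CLINT g|std_normal_distribution. damped_char Q J l U (c(k := c k + sqrt (2 * l k) * g)) K)"
    and "(\<lambda>g. damped_char Q J l U (c(k := c k + sqrt (2 * l k) * g)) K) \<in> borel_measurable borel"
    and "norm (damped_char Q J l U c K) \<le> 1"
proof -
  interpret Q: prob_space Q by fact
  interpret G: real_distribution std_normal_distribution by (rule real_dist_normal_dist)
  interpret QG: pair_prob_space Q std_normal_distribution ..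
  have UJ: "U j \<in> borel_measurable Q" if "j \<in> insert k K" for j using that J by (intro U) auto
  have kJ: "k \<in> J" using J by auto
  note [measurable] = UJ U[OF kJ]
  have fK: "finite K" using J finite_subset by auto
  define F where "F = (\<lambda>(\<omega>, g). iexp (\<Sum>j\<in>J. c j * U j \<omega>) * exp (- (\<Sum>j\<in>K. l j * (U j \<omega>)\<^sup>2)) * iexp (sqrt (2 * l k) * U k \<omega> * g))"
  have [measurable]: "F \<in> borel_measurable (Q \<Otimes>\<^sub>M std_normal_distribution)"
    unfolding F_def by measurable
  have bd: "exp (- (\<Sum>j\<in>K. l j * (U j \<omega>)\<^sup>2)) \<le> 1" for \<omega> :: 'a
    using l by (auto intro!: sum_nonneg)
  have nF: "norm (F z) \<le> 1" for z
    using bd by (auto simp: F_def norm_mult split: prod.split)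
  have intF: "integrable (Q \<Otimes>\<^sub>M std_normal_distribution) F"
    by (rule QG.P.integrable_const_bound[of _ 1]) (auto simp: nF)
  have shift: "(\<Sum>j\<in>J. (c(k := c k + sqrt (2 * l k) * g)) j * U j \<omega>) = (\<Sum>j\<in>J. c j * U j \<omega>) + sqrt (2 * l k) * U k \<omega> * g" for g \<omega>
    unfolding sum.remove[OF J(1) kJ] by (simp add: algebra_simps)
  have eqg: "damped_char Q J l U (c(k := c k + sqrt (2 * l k) * g)) K = (CLINT \<omega>|Q. F (\<omega>, g))" for g
    unfolding damped_char_def shift F_def by (simp add: exp_add algebra_simps)
  have "damped_char Q J l U c (insert k K) = (CLINT \<omega>|Q. (CLINT g|std_normal_distribution. F (\<omega>, g)))"
  proof -
    have "(CLINT g|std_normal_distribution. F (\<omega>, g)) =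
       iexp (\<Sum>j\<in>J. c j * U j \<omega>) * exp (- (\<Sum>j\<in>insert k K. l j * (U j \<omega>)\<^sup>2))" for \<omega>
    proof -
      have "(CLINT g|std_normal_distribution. F (\<omega>, g)) = iexp (\<Sum>j\<in>J. c j * U j \<omega>) * exp (- (\<Sum>j\<in>K. l j * (U j \<omega>)\<^sup>2)) *
          char std_normal_distribution (sqrt (2 * l k) * U k \<omega>)"
        unfolding F_def char_def by simp
      also have "char std_normal_distribution (sqrt (2 * l k) * U k \<omega>) = exp (- (l k * (U k \<omega>)\<^sup>2))"
        using l[of k] by (simp add: char_std_normal_distribution power_mult_distrib flip: of_real_power of_real_mult)
      finally show ?thesis
        using J fK by (simp add: exp_add[symmetric] algebra_simps flip: of_real_mult)
    qed
    then show ?thesis by (simp add: damped_char_def)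
  qed
  also have "\<dots> = (CLINT g|std_normal_distribution. (CLINT \<omega>|Q. F (\<omega>, g)))"
    using QG.Fubini_integral[of "\<lambda>\<omega> g. F (\<omega>, g)"] intF by simp
  finally show "damped_char Q J l U c (insert k K) =
         (CLINT g|std_normal_distribution. damped_char Q J l U (c(k := c k + sqrt (2 * l k) * g)) K)"
    by (simp add: eqg)
  have "(\<lambda>g. CLINT \<omega>|Q. F (\<omega>, g)) \<in> borel_measurable std_normal_distribution"
  proof (rule Q.borel_measurable_lebesgue_integral)
    show "(\<lambda>(g, \<omega>). F (\<omega>, g)) \<in> borel_measurable (std_normal_distribution \<Otimes>\<^sub>M Q)"
      by measurable
  qed
  then show "(\<lambda>g. damped_char Q J l U (c(k := c k + sqrt (2 * l k) * g)) K) \<in> borel_measurable borel"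
    by (simp add: eqg)
  have "norm (damped_char Q J l U c K) \<le> (LINT \<omega>|Q. norm (iexp (\<Sum>j\<in>J. c j * U j \<omega>) * exp (- (\<Sum>j\<in>K. l j * (U j \<omega>)\<^sup>2))))"
    unfolding damped_char_def by (rule integral_norm_bound)
  also have "\<dots> \<le> (LINT \<omega>|Q. 1)"
  proof (rule integral_mono)
    show "integrable Q (\<lambda>\<omega>. cmod (iexp (\<Sum>j\<in>J. c j * U j \<omega>) * exp (- (\<Sum>j\<in>K. l j * (U j \<omega>)\<^sup>2))))"
      using bd by (intro Q.integrable_const_bound[of _ 1]) (auto simp: norm_mult)
  qed (use bd in \<open>auto simp: norm_mult\<close>)
  finally show "norm (damped_char Q J l U c K) \<le> 1" by (simp add: Q.prob_space)
qed

text \<open>A substitute for the multivariate continuity theorem and the continuous mapping theorem, restricted to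
the one functional that is needed: the hypothesis is the Cramer-Wold condition, and each induction step
is an application of dominated convergence under a one-dimensional normal law.\<close>

lemma exp_quadratic_form_converges:
  fixes W :: "nat \<Rightarrow> 'j \<Rightarrow> 'a \<Rightarrow> real" and V :: "'j \<Rightarrow> 'b \<Rightarrow> real"
  assumes P: "prob_space P" and Q: "prob_space Q" and J: "finite J"
    and W: "\<And>n j. j \<in> J \<Longrightarrow> W n j \<in> borel_measurable P" and V: "\<And>j. j \<in> J \<Longrightarrow> V j \<in> borel_measurable Q"
    and conv: "\<And>c. (\<lambda>n. CLINT \<omega>|P. iexp (\<Sum>j\<in>J. c j * W n j \<omega>)) \<longlonglongrightarrow> (CLINT \<omega>|Q. iexp (\<Sum>j\<in>J. c j * V j \<omega>))"
    and l: "\<And>j. l j \<ge> 0"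
  shows "(\<lambda>n. LINT \<omega>|P. exp (- (\<Sum>j\<in>J. l j * (W n j \<omega>)\<^sup>2))) \<longlonglongrightarrow> (LINT \<omega>|Q. exp (- (\<Sum>j\<in>J. l j * (V j \<omega>)\<^sup>2)))"
proof -
  have "(\<lambda>n. damped_char P J l (W n) c K) \<longlonglongrightarrow> damped_char Q J l V c K" if "finite K" "K \<subseteq> J" for c K
    using that
  proof (induction K arbitrary: c rule: finite_induct)
    case empty
    then show ?case using conv by (simp add: damped_char_def)
  next
    case (insert k K)
    interpret G: real_distribution std_normal_distribution by (rule real_dist_normal_dist)
    have stepP: "damped_char P J l (W n) c (insert k K) =
         (CLINT g|std_normal_distribution. damped_char P J l (W n) (c(k := c k + sqrt (2 * l k) * g)) K)"
      "(\<lambda>g. damped_char P J l (W n) (c(k := c k + sqrt (2 * l k) * g)) K) \<in> borel_measurable borel"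
      "norm (damped_char P J l (W n) c' K) \<le> 1" for n c'
      by (rule damped_char_insert[OF P _ J insert.prems insert.hyps(2) l]; simp add: W)+
    have stepQ: "damped_char Q J l V c (insert k K) =
         (CLINT g|std_normal_distribution. damped_char Q J l V (c(k := c k + sqrt (2 * l k) * g)) K)"
      "(\<lambda>g. damped_char Q J l V (c(k := c k + sqrt (2 * l k) * g)) K) \<in> borel_measurable borel"
      by (rule damped_char_insert[OF Q _ J insert.prems insert.hyps(2) l]; simp add: V)+
    show ?case
      unfolding stepP(1) stepQ(1)
    proof (rule integral_dominated_convergence[where w = "\<lambda>_. 1"])
      show "AE g in std_normal_distribution. (\<lambda>n. damped_char P J l (W n) (c(k := c k + sqrt (2 * l k) * g)) K)
          \<longlonglongrightarrow> damped_char Q J l V (c(k := c k + sqrt (2 * l k) * g)) K"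
        using insert by auto
    qed (simp_all add: stepP(2,3) stepQ(2))
  qed
  from this[OF J order_refl, of "\<lambda>_. 0"]
  have "(\<lambda>n. CLINT \<omega>|P. complex_of_real (exp (- (\<Sum>j\<in>J. l j * (W n j \<omega>)\<^sup>2)))) \<longlonglongrightarrow>
        (CLINT \<omega>|Q. complex_of_real (exp (- (\<Sum>j\<in>J. l j * (V j \<omega>)\<^sup>2))))"
    by (simp add: damped_char_def)
  then show ?thesis
    by (simp only: integral_complex_of_real tendsto_of_real_iff)
qed

section \<open>The integral representation of the Euclidean norm\<close>

text \<open>The substitution \<open>u = v / \<surd>(2 s)\<close> reduces this to the characteristic function of the standard normal law.\<close>

lemma Gaussian_Fourier_integral_real:
  fixes s y :: real
  assumes s: "s > 0"
  shows "integrable lborel (\<lambda>u::real. iexp (u * y) * exp (- (s * u\<^sup>2)))"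
    and "(CLINT u|lborel. iexp (u * y) * exp (- (s * u\<^sup>2))) = sqrt (pi / s) * exp (- (y\<^sup>2 / (4 * s)))"
proof -
  define c where "c = 1 / sqrt (2 * s)"
  have c: "c > 0" "c\<^sup>2 = 1 / (2 * s)" using s by (auto simp: c_def power_divide)
  define f where "f = (\<lambda>u::real. iexp (u * y) * exp (- (s * u\<^sup>2)))"
  have fc: "f (0 + c * v) = sqrt (2 * pi) *\<^sub>R (std_normal_density v *\<^sub>R iexp (c * y * v))" for v
  proof -
    have "exp (- (s * (c * v)\<^sup>2)) = sqrt (2 * pi) * std_normal_density v"
      using s by (simp add: std_normal_density_def power_mult_distrib c(2))
    then show ?thesis
      by (simp only: f_def scaleR_conv_of_real of_real_mult) (simp add: mult_ac)
  qed
  have i1: "integrable std_normal_distribution (\<lambda>v. iexp (c * y * v))"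
    by (rule prob_space.integrable_iexp) (auto simp: prob_space_normal_density)
  then have i2: "integrable lborel (\<lambda>v. std_normal_density v *\<^sub>R iexp (c * y * v))"
    by (subst (asm) integrable_density) auto
  have "integrable lborel (\<lambda>v. f (0 + c * v))"
    unfolding fc using i2 by (rule integrable_scaleR_right)
  then show "integrable lborel (\<lambda>u::real. iexp (u * y) * exp (- (s * u\<^sup>2)))"
    using lborel_integrable_real_affine_iff[of c f 0] c unfolding f_def by simp
  have "(CLINT v|lborel. std_normal_density v *\<^sub>R iexp (c * y * v)) = char std_normal_distribution (c * y)"
    unfolding char_def by (subst integral_density) (auto simp: mult_ac)
  also have "\<dots> = exp (- (y\<^sup>2 / (4 * s)))"
    by (simp add: char_std_normal_distribution power_mult_distrib c(2) flip: of_real_power of_real_mult of_real_divide)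
  finally have char: "(CLINT v|lborel. std_normal_density v *\<^sub>R iexp (c * y * v)) = exp (- (y\<^sup>2 / (4 * s)))" .
  have "(CLINT u|lborel. f u) = c *\<^sub>R (CLINT v|lborel. f (0 + c * v))"
    using lborel_integral_real_affine[of c f 0] c by simp
  also have "\<dots> = (c * sqrt (2 * pi)) *\<^sub>R complex_of_real (exp (- (y\<^sup>2 / (4 * s))))"
    unfolding fc integral_scaleR_right char by (simp add: mult_ac)
  also have "c * sqrt (2 * pi) = sqrt (pi / s)"
    using s by (simp add: c_def real_sqrt_mult real_sqrt_divide)
  finally show "(CLINT u|lborel. iexp (u * y) * exp (- (s * u\<^sup>2))) = sqrt (pi / s) * exp (- (y\<^sup>2 / (4 * s)))"
    by (simp add: f_def scaleR_conv_of_real)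
qed

lemma Gaussian_Fourier_integral:
  fixes x :: "'a::euclidean_space" and s :: real
  assumes s: "s > 0"
  shows "integrable lborel (\<lambda>t. iexp (t \<bullet> x) * exp (- (s * (norm t)\<^sup>2)))"
    and "(CLINT t|lborel. iexp (t \<bullet> x) * exp (- (s * (norm t)\<^sup>2))) =
         sqrt (pi / s) ^ DIM('a) * exp (- ((norm x)\<^sup>2 / (4 * s)))"
proof -
  interpret P: product_sigma_finite "\<lambda>_::'a. lborel :: real measure" ..
  define g :: "'a \<Rightarrow> real \<Rightarrow> complex" where "g b u = iexp (u * (b \<bullet> x)) * exp (- (s * u\<^sup>2))" for b u
  have g: "integrable lborel (g b)" for b
    unfolding g_def by (rule Gaussian_Fourier_integral_real(1)[OF s])
  have split: "iexp ((\<Sum>b\<in>Basis. f b *\<^sub>R b) \<bullet> x) * exp (- (s * (norm (\<Sum>b\<in>Basis. f b *\<^sub>R b))\<^sup>2)) = (\<Prod>b\<in>Basis. g b (f b))"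
    for f :: "'a \<Rightarrow> real"
  proof -
    have "(norm (\<Sum>b\<in>Basis. f b *\<^sub>R b))\<^sup>2 = (\<Sum>b\<in>Basis. (f b)\<^sup>2)"
      unfolding power2_norm_eq_inner by (subst euclidean_inner) (simp add: power2_eq_square inner_sum_left_Basis)
    then show ?thesis
      by (simp add: g_def inner_sum_left exp_sum sum_distrib_left sum_negf[symmetric] prod.distrib of_real_prod[symmetric] del: of_real_prod of_real_sum)
         (simp add: exp_sum sum_distrib_left)
  qed
  have m: "(\<lambda>t::'a. iexp (t \<bullet> x) * exp (- (s * (norm t)\<^sup>2))) \<in> borel_measurable borel" by measurable
  have sm: "(\<lambda>f. \<Sum>b\<in>Basis. f b *\<^sub>R b) \<in> measurable (Pi\<^sub>M Basis (\<lambda>_::'a. lborel)) borel" by measurable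
  show "integrable lborel (\<lambda>t. iexp (t \<bullet> x) * exp (- (s * (norm t)\<^sup>2)))"
    unfolding lborel_eq[where 'a='a] integrable_distr_eq[OF sm m] split
    by (intro P.product_integrable_prod g) simp
  have "(CLINT t|lborel. iexp (t \<bullet> x) * exp (- (s * (norm t)\<^sup>2))) = (\<Prod>b\<in>Basis. integral\<^sup>L lborel (g b))"
    unfolding lborel_eq[where 'a='a] integral_distr[OF sm m] split
    by (intro P.product_integral_prod g) simp
  also have "\<dots> = (\<Prod>b\<in>Basis. complex_of_real (sqrt (pi / s) * exp (- ((b \<bullet> x)\<^sup>2 / (4 * s)))))"
    unfolding g_def Gaussian_Fourier_integral_real(2)[OF s] by simp
  also have "\<dots> = complex_of_real (sqrt (pi / s) ^ DIM('a) * exp (\<Sum>b\<in>Basis. - ((b \<bullet> x)\<^sup>2 / (4 * s))))"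
    by (simp only: of_real_prod[symmetric] prod.distrib prod_constant exp_sum[OF finite_Basis])
  also have "(\<Sum>b\<in>Basis. - ((b \<bullet> x)\<^sup>2 / (4 * s))) = - ((norm x)\<^sup>2 / (4 * s))"
    unfolding power2_norm_eq_inner euclidean_inner[of x x] 
    by (simp add: sum_negf sum_divide_distrib power2_eq_square inner_commute)
  finally show "(CLINT t|lborel. iexp (t \<bullet> x) * exp (- (s * (norm t)\<^sup>2))) =
         sqrt (pi / s) ^ DIM('a) * exp (- ((norm x)\<^sup>2 / (4 * s)))" by simp
qed

lemma nn_integral_one_minus_cos_Gaussian:
  fixes x :: "'a::euclidean_space" and s :: real
  assumes s: "s > 0"
  shows "(\<integral>\<^sup>+t. ennreal ((1 - cos (t \<bullet> x)) * exp (- (s * (norm t)\<^sup>2))) \<partial>lborel) =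
         ennreal (sqrt (pi / s) ^ DIM('a) * (1 - exp (- ((norm x)\<^sup>2 / (4 * s)))))"
proof -
  note F = Gaussian_Fourier_integral[OF s]
  have Re: "Re (iexp (t \<bullet> z) * exp (- (s * (norm t)\<^sup>2))) = cos (t \<bullet> z) * exp (- (s * (norm t)\<^sup>2))" for t z :: 'a
    by (simp add: cis_conv_exp[symmetric])
  have i: "integrable lborel (\<lambda>t::'a. cos (t \<bullet> z) * exp (- (s * (norm t)\<^sup>2)))"
    and e: "(LINT t|lborel. cos (t \<bullet> z) * exp (- (s * (norm t)\<^sup>2))) = sqrt (pi / s) ^ DIM('a) * exp (- ((norm z)\<^sup>2 / (4 * s)))"
    for z :: 'a
    using integrable_Re[OF F(1)[of z]] integral_Re[OF F(1)[of z]] unfolding Re F(2) by (auto simp flip: of_real_power of_real_mult)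
  from i[of 0] e[of 0] have i0: "integrable lborel (\<lambda>t::'a. exp (- (s * (norm t)\<^sup>2)))"
    and e0: "(LINT t::'a|lborel. exp (- (s * (norm t)\<^sup>2))) = sqrt (pi / s) ^ DIM('a)" by simp_all
  have "has_bochner_integral lborel (\<lambda>t. (1 - cos (t \<bullet> x)) * exp (- (s * (norm t)\<^sup>2)))
       (sqrt (pi / s) ^ DIM('a) - sqrt (pi / s) ^ DIM('a) * exp (- ((norm x)\<^sup>2 / (4 * s))))"
    unfolding left_diff_distrib mult_1_left
    using has_bochner_integral_diff[OF has_bochner_integral_integrable[OF i0] has_bochner_integral_integrable[OF i[of x]]]
    by (simp only: e e0)
  then show ?thesis
    by (subst nn_integral_eq_integral) (auto simp: has_bochner_integral_iff right_diff_distrib)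
qed

text \<open>With \<open>r = \<bar>t\<bar>\<^sup>2\<close> this writes a negative power of \<open>\<bar>t\<bar>\<close> as a mixture of the Gaussian functions
\<open>exp (- s \<bar>t\<bar>\<^sup>2)\<close>.\<close>

lemma nn_integral_Gamma_scaled:
  fixes a r :: real
  assumes a: "a > 0" and r: "r > 0"
  shows "(\<integral>\<^sup>+s. ennreal (indicator {0<..} s * (s powr (a - 1) * exp (- (s * r)))) \<partial>lborel) = ennreal (Gamma a * r powr (- a))"
proof -
  have "ennreal (Gamma a) = (\<integral>\<^sup>+t. ennreal (indicator {0..} t * t powr (a - 1) / exp t) \<partial>lborel)"
    by (rule Gamma_conv_nn_integral_real[OF a])
  also have "\<dots> = ennreal \<bar>r\<bar> * (\<integral>\<^sup>+s. ennreal (indicator {0..} (0 + r * s) * (0 + r * s) powr (a - 1) / exp (0 + r * s)) \<partial>lborel)"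
    using r by (intro nn_integral_real_affine) auto
  also have "\<dots> = (\<integral>\<^sup>+s. ennreal r * ennreal (indicator {0..} (0 + r * s) * (0 + r * s) powr (a - 1) / exp (0 + r * s)) \<partial>lborel)"
    using r by (subst nn_integral_cmult) auto
  also have "\<dots> = (\<integral>\<^sup>+s. ennreal (r powr a) * ennreal (indicator {0<..} s * (s powr (a - 1) * exp (- (s * r)))) \<partial>lborel)"
  proof (intro nn_integral_cong)
    fix s :: real
    show "ennreal r * ennreal (indicator {0..} (0 + r * s) * (0 + r * s) powr (a - 1) / exp (0 + r * s)) =
      ennreal (r powr a) * ennreal (indicator {0<..} s * (s powr (a - 1) * exp (- (s * r))))"
    proof (cases "s > 0")
      case True
      have "r powr a = r * r powr (a - 1)" using r by (simp add: powr_diff)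
      then show ?thesis using r True
        by (simp add: ennreal_mult[symmetric] powr_mult exp_minus divide_inverse mult_ac)
    next
      case False
      then show ?thesis using r by (cases "s = 0") (auto simp: indicator_def zero_le_mult_iff)
    qed
  qed
  also have "\<dots> = ennreal (r powr a) * (\<integral>\<^sup>+s. ennreal (indicator {0<..} s * (s powr (a - 1) * exp (- (s * r)))) \<partial>lborel)" (is "_ = _ * ?I")
    by (rule nn_integral_cmult) auto
  finally have "ennreal (r powr (- a)) * ennreal (Gamma a) = ennreal (r powr (- a)) * (ennreal (r powr a) * ?I)" by simp
  also have "\<dots> = ?I"
    using r by (simp add: mult.assoc[symmetric] ennreal_mult[symmetric] powr_add[symmetric])
  finally show ?thesis using a r Gamma_real_pos[OF a] by (simp add: ennreal_mult[symmetric] mult.commute)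
qed

lemma nn_integral_one_minus_cos_exp:
  fixes r :: real
  assumes r: "r > 0"
  shows "(\<integral>\<^sup>+v. ennreal ((1 - cos v) * exp (- (v * r))) * indicator {0..} v \<partial>lborel) = ennreal (1 / (r * (r\<^sup>2 + 1)))"
proof -
  \<comment> \<open>a primitive of the integrand, found by integrating by parts twice\<close>
  define F where "F v = - exp (- (v * r)) / r + exp (- (v * r)) * (r * cos v - sin v) / (r\<^sup>2 + 1)" for v
  have r2: "r\<^sup>2 + 1 > 0" by (simp add: add_nonneg_pos)
  have d: "(F has_real_derivative (1 - cos v) * exp (- (v * r))) (at v)" for v
  proof -
    have e: "((\<lambda>v. exp (- (v * r))) has_real_derivative exp (- (v * r)) * - r) (at v)"
      by (auto intro!: derivative_eq_intros)
    have g: "((\<lambda>v. r * cos v - sin v) has_real_derivative - (r * sin v) - cos v) (at v)"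
      by (auto intro!: derivative_eq_intros)
    have "(F has_real_derivative - (exp (- (v * r)) * - r) / r +
       (exp (- (v * r)) * - r * (r * cos v - sin v) + (- (r * sin v) - cos v) * exp (- (v * r))) / (r\<^sup>2 + 1)) (at v)"
      unfolding F_def by (intro DERIV_add DERIV_cdivide DERIV_minus DERIV_mult e g)
    also have "- (exp (- (v * r)) * - r) / r = exp (- (v * r))"
      using r by simp
    also have "exp (- (v * r)) * - r * (r * cos v - sin v) + (- (r * sin v) - cos v) * exp (- (v * r)) =
        (r\<^sup>2 + 1) * - (cos v * exp (- (v * r)))"
      by (simp add: algebra_simps power2_eq_square)
    also have "(r\<^sup>2 + 1) * - (cos v * exp (- (v * r))) / (r\<^sup>2 + 1) = - (cos v * exp (- (v * r)))"
      using r2 by (intro nonzero_mult_div_cancel_left) simp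
    finally show ?thesis by (simp add: algebra_simps)
  qed
  have e0: "((\<lambda>v. exp (- (v * r))) \<longlongrightarrow> 0) at_top"
    using r by real_asymp
  have b: "((\<lambda>v. exp (- (v * r)) * (r * cos v - sin v)) \<longlongrightarrow> 0) at_top"
  proof (rule Lim_null_comparison)
    show "\<forall>\<^sub>F v in at_top. norm (exp (- (v * r)) * (r * cos v - sin v)) \<le> exp (- (v * r)) * (r + 1)"
    proof (rule always_eventually, rule allI)
      fix v
      have "\<bar>r * cos v - sin v\<bar> \<le> \<bar>r * cos v\<bar> + \<bar>sin v\<bar>" by (rule abs_triangle_ineq4)
      also have "\<dots> \<le> r * 1 + 1"
        using r by (intro add_mono) (auto simp: abs_mult)
      finally show "norm (exp (- (v * r)) * (r * cos v - sin v)) \<le> exp (- (v * r)) * (r + 1)"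
        by (simp add: abs_mult)
    qed
    show "((\<lambda>v. exp (- (v * r)) * (r + 1)) \<longlongrightarrow> 0) at_top"
      using tendsto_mult_left_zero[OF e0] .
  qed
  have lim: "(F \<longlongrightarrow> 0) at_top"
    unfolding F_def using tendsto_add[OF tendsto_divide[OF tendsto_minus[OF e0] tendsto_const[of r]] tendsto_divide[OF b tendsto_const[of "r\<^sup>2 + 1"]]] r r2
    by simp
  have "(\<integral>\<^sup>+v. ennreal ((1 - cos v) * exp (- (v * r))) * indicator {0..} v \<partial>lborel) = ennreal (0 - F 0)"
    by (rule nn_integral_FTC_atLeast[OF _ d _ lim]) auto
  also have "0 - F 0 = 1 / (r * (r\<^sup>2 + 1))"
    using r r2 by (simp add: F_def field_simps power2_eq_square)
  finally show ?thesis .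
qed


lemma nn_integral_inverse_one_plus_square:
  "(\<integral>\<^sup>+r. ennreal (1 / (r\<^sup>2 + 1)) * indicator {0..} r \<partial>lborel) = ennreal (pi / 2)"
proof -
  have "(\<integral>\<^sup>+r. ennreal (1 / (r\<^sup>2 + 1)) * indicator {0..} r \<partial>lborel) = ennreal (pi / 2 - arctan 0)"
  proof (rule nn_integral_FTC_atLeast)
    show "(arctan has_real_derivative 1 / (r\<^sup>2 + 1)) (at r)" for r
      by (auto intro!: derivative_eq_intros simp: field_simps)
  qed (auto intro: tendsto_arctan_at_top)
  then show ?thesis by simp
qed

text \<open>On the half-line, \<open>1 / v\<^sup>2\<close> is the integral of \<open>r exp (- r v)\<close> over \<open>r > 0\<close>; exchanging the integrals leaves
\<open>1 / (r\<^sup>2 + 1)\<close>, whose primitive is \<open>arctan\<close>. Symmetry and scaling do the rest.\<close>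

lemma nn_integral_one_minus_cos_over_square:
  "(\<integral>\<^sup>+v. ennreal ((1 - cos (v * y)) / v\<^sup>2) \<partial>lborel) = ennreal (pi * \<bar>y\<bar>)"
proof -
  let ?k = "\<lambda>v r::real. ennreal (indicator {0<..} r * (r * exp (- (r * v))))"
  have half: "(\<integral>\<^sup>+v. ennreal ((1 - cos v) / v\<^sup>2) * indicator {0<..} v \<partial>lborel) = ennreal (pi / 2)"
  proof -
    have "(\<integral>\<^sup>+v. ennreal ((1 - cos v) / v\<^sup>2) * indicator {0<..} v \<partial>lborel) =
          (\<integral>\<^sup>+v. (\<integral>\<^sup>+r. ennreal (1 - cos v) * indicator {0<..} v * ?k v r \<partial>lborel) \<partial>lborel)"
    proof (intro nn_integral_cong)
      fix v :: real
      show "ennreal ((1 - cos v) / v\<^sup>2) * indicator {0<..} v =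
          (\<integral>\<^sup>+r. ennreal (1 - cos v) * indicator {0<..} v * ?k v r \<partial>lborel)"
      proof (cases "v > 0")
        case True
        have "(\<integral>\<^sup>+r. ?k v r \<partial>lborel) = (\<integral>\<^sup>+r. ennreal (indicator {0<..} r * (r powr (2 - 1) * exp (- (r * v)))) \<partial>lborel)"
          by (intro nn_integral_cong) (auto simp: indicator_def)
        also have "\<dots> = ennreal (Gamma 2 * v powr (- 2))"
          using True by (intro nn_integral_Gamma_scaled) auto
        also have "Gamma 2 * v powr (- 2) = 1 / v\<^sup>2"
          using True Gamma_fact[of 1, where 'a = real] by (simp add: powr_minus divide_inverse)
        finally show ?thesis
          using True by (subst nn_integral_cmult) (auto simp: ennreal_mult[symmetric])
      qed simp
    qed
    also have "\<dots> = (\<integral>\<^sup>+r. (\<integral>\<^sup>+v. ennreal (1 - cos v) * indicator {0<..} v * ?k v r \<partial>lborel) \<partial>lborel)"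
      by (rule lborel_pair.Fubini') measurable
    also have "\<dots> = (\<integral>\<^sup>+r. ennreal (1 / (r\<^sup>2 + 1)) * indicator {0..} r \<partial>lborel)"
    proof (rule nn_integral_cong_AE, rule AE_mp[OF AE_lborel_singleton[of 0] AE_I2], rule impI)
      fix r :: real assume "r \<noteq> 0"
      show "(\<integral>\<^sup>+v. ennreal (1 - cos v) * indicator {0<..} v * ?k v r \<partial>lborel) = ennreal (1 / (r\<^sup>2 + 1)) * indicator {0..} r"
      proof (cases "r > 0")
        case True
        have "(\<integral>\<^sup>+v. ennreal (1 - cos v) * indicator {0<..} v * ?k v r \<partial>lborel) =
              (\<integral>\<^sup>+v. ennreal r * (ennreal ((1 - cos v) * exp (- (v * r))) * indicator {0..} v) \<partial>lborel)"
          using True by (intro nn_integral_cong) (auto simp: indicator_def ennreal_mult[symmetric] mult_ac)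
        also have "\<dots> = ennreal r * ennreal (1 / (r * (r\<^sup>2 + 1)))"
          by (subst nn_integral_cmult) (simp_all add: nn_integral_one_minus_cos_exp[OF True])
        also have "\<dots> = ennreal (1 / (r\<^sup>2 + 1))"
          using True by (simp add: ennreal_mult[symmetric])
        finally show ?thesis using True by simp
      qed (use \<open>r \<noteq> 0\<close> in simp)
    qed
    finally show ?thesis by (simp add: nn_integral_inverse_one_plus_square)
  qed
  have other_half: "(\<integral>\<^sup>+v. ennreal ((1 - cos v) / v\<^sup>2) * indicator {..<0} v \<partial>lborel) = ennreal (pi / 2)"
    by (subst nn_integral_real_affine[where c = "-1" and t = 0])
       (auto simp: half[symmetric] indicator_def intro!: nn_integral_cong)
  have whole: "(\<integral>\<^sup>+v. ennreal ((1 - cos v) / v\<^sup>2) \<partial>lborel) = ennreal pi"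
  proof -
    have "(\<integral>\<^sup>+v. ennreal ((1 - cos v) / v\<^sup>2) \<partial>lborel) =
      (\<integral>\<^sup>+v. ennreal ((1 - cos v) / v\<^sup>2) * indicator {0<..} v + ennreal ((1 - cos v) / v\<^sup>2) * indicator {..<0} v \<partial>lborel)"
      by (intro nn_integral_cong) (auto simp: indicator_def not_less)
    also have "\<dots> = ennreal (pi / 2) + ennreal (pi / 2)"
      by (subst nn_integral_add) (auto simp: half other_half)
    finally show ?thesis by (simp flip: ennreal_plus)
  qed
  show ?thesis
  proof (cases "y = 0")
    case False
    have "ennreal \<bar>y\<bar> * ennreal pi = ennreal \<bar>y\<bar> * (ennreal \<bar>y\<bar> * (\<integral>\<^sup>+v. ennreal ((1 - cos (0 + y * v)) / (0 + y * v)\<^sup>2) \<partial>lborel))"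
      using False by (subst whole[symmetric], subst nn_integral_real_affine[where c = y and t = 0]) auto
    also have "\<dots> = (\<integral>\<^sup>+v. ennreal \<bar>y\<bar> * (ennreal \<bar>y\<bar> * ennreal ((1 - cos (0 + y * v)) / (0 + y * v)\<^sup>2)) \<partial>lborel)"
      by (simp add: nn_integral_cmult)
    also have "\<dots> = (\<integral>\<^sup>+v. ennreal ((1 - cos (v * y)) / v\<^sup>2) \<partial>lborel)"
    proof (intro nn_integral_cong)
      fix v :: real
      have "\<bar>y\<bar> * (\<bar>y\<bar> * ((1 - cos (0 + y * v)) / (0 + y * v)\<^sup>2)) = y * y * ((1 - cos (v * y)) / (y * v)\<^sup>2)"
        by (simp add: mult.assoc[symmetric] mult.commute)
      also have "\<dots> = (1 - cos (v * y)) / v\<^sup>2"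
        using False by (simp add: power_mult_distrib power2_eq_square)
      finally show "ennreal \<bar>y\<bar> * (ennreal \<bar>y\<bar> * ennreal ((1 - cos (0 + y * v)) / (0 + y * v)\<^sup>2)) =
          ennreal ((1 - cos (v * y)) / v\<^sup>2)"
        by (simp only: ennreal_mult[symmetric] abs_ge_zero mult_nonneg_nonneg divide_nonneg_nonneg
            zero_le_power2 diff_ge_0_iff_ge cos_le_one)
    qed
    finally show ?thesis by (simp add: ennreal_mult[symmetric] mult.commute)
  qed simp
qed

text \<open>Let \<open>a = (1 + d) / 2\<close>. Writing \<open>\<bar>t\<bar>\<^bsup>-(1+d)\<^esup>\<close> as a mixture of the functions \<open>exp (- s \<bar>t\<bar>\<^sup>2)\<close> with weight
\<open>s\<^bsup>a-1\<^esup> / \<Gamma>(a)\<close>, the inner integral over \<open>t\<close> is the \<open>d\<close>-dimensional Gaussian one. Up to the factor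
\<open>(\<surd>\<pi> / \<surd>s)\<^bsup>d-1\<^esup>\<close>, whose dependence on \<open>s\<close> cancels the weight \<open>s\<^bsup>a-1\<^esup>\<close>, it equals the one-dimensional
integral at \<open>\<bar>x\<bar>\<close>. Undoing the mixture in dimension one, where the weight is \<open>1 / v\<^sup>2\<close>, leaves the
integral of \<open>(1 - cos (v \<bar>x\<bar>)) / v\<^sup>2\<close>. All integrands are nonnegative, so Tonelli's theorem
justifies the exchanges.\<close>

lemma nn_integral_one_minus_cos_kernel:
  fixes x :: "'a::euclidean_space"
  shows "(\<integral>\<^sup>+t. ennreal ((1 - cos (t \<bullet> x)) / norm t ^ (1 + DIM('a))) \<partial>lborel) = ennreal (c_const DIM('a) * norm x)"
proof -
  define a where "a = (1 + real DIM('a)) / 2"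
  have a: "a > 0" by (simp add: a_def add_pos_nonneg)
  have Ga: "Gamma a > 0" using a by (rule Gamma_real_pos)
  obtain m where m: "DIM('a) = Suc m" using DIM_positive[where 'a = 'a] gr0_implies_Suc by blast
  let ?I = "\<integral>\<^sup>+t. ennreal ((1 - cos (t \<bullet> x)) / norm t ^ (1 + DIM('a))) \<partial>lborel"
  let ?k = "\<lambda>s. ennreal (indicator {0<..} s * s powr (a - 1))"
  let ?J = "\<lambda>s. \<integral>\<^sup>+v. ennreal ((1 - cos (v \<bullet> norm x)) * exp (- (s * (norm v)\<^sup>2))) \<partial>(lborel :: real measure)"
  have powr_half: "s powr (a - 1) = sqrt s ^ m" if "s > 0" for s
  proof -
    have "a - 1 = 1 / 2 * real m" by (simp add: a_def m field_simps)
    then have "s powr (a - 1) = (s powr (1 / 2)) powr real m" by (simp only: powr_powr)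
    also have "\<dots> = sqrt s ^ m" using that by (simp add: powr_half_sqrt powr_realpow)
    finally show ?thesis .
  qed
  have "ennreal (Gamma a) * ?I = (\<integral>\<^sup>+t. ennreal (Gamma a) * ennreal ((1 - cos (t \<bullet> x)) / norm t ^ (1 + DIM('a))) \<partial>lborel)"
    by (rule nn_integral_cmult[symmetric]) measurable
  also have "\<dots> = (\<integral>\<^sup>+t. (\<integral>\<^sup>+s. ?k s * ennreal ((1 - cos (t \<bullet> x)) * exp (- (s * (norm t)\<^sup>2))) \<partial>lborel) \<partial>lborel)"
  proof (intro nn_integral_cong)
    fix t :: 'a
    show "ennreal (Gamma a) * ennreal ((1 - cos (t \<bullet> x)) / norm t ^ (1 + DIM('a))) =
       (\<integral>\<^sup>+s. ?k s * ennreal ((1 - cos (t \<bullet> x)) * exp (- (s * (norm t)\<^sup>2))) \<partial>lborel)"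
    proof (cases "t = 0")
      case False
      have "(\<integral>\<^sup>+s. ?k s * ennreal ((1 - cos (t \<bullet> x)) * exp (- (s * (norm t)\<^sup>2))) \<partial>lborel) =
            (\<integral>\<^sup>+s. ennreal (1 - cos (t \<bullet> x)) * ennreal (indicator {0<..} s * (s powr (a - 1) * exp (- (s * (norm t)\<^sup>2)))) \<partial>lborel)"
        by (intro nn_integral_cong) (simp add: ennreal_mult[symmetric] mult_ac)
      also have "\<dots> = ennreal (1 - cos (t \<bullet> x)) * ennreal (Gamma a * (norm t)\<^sup>2 powr (- a))"
        using False by (subst nn_integral_cmult) (auto simp: nn_integral_Gamma_scaled[OF a])
      also have "(norm t)\<^sup>2 powr (- a) = 1 / norm t ^ (1 + DIM('a))"
      proof -
        have "(norm t)\<^sup>2 powr (- a) = (norm t powr real 2) powr (- a)"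
          using False by (subst powr_realpow) auto
        also have "\<dots> = norm t powr (- real (1 + DIM('a)))"
        proof -
          have "real 2 * - a = - real (1 + DIM('a))" by (simp add: a_def field_simps)
          then show ?thesis by (simp only: powr_powr)
        qed
        also have "\<dots> = 1 / norm t ^ (1 + DIM('a))"
        proof -
          have "norm t powr real (1 + DIM('a)) = norm t ^ (1 + DIM('a))"
            using False by (intro powr_realpow) simp
          then show ?thesis by (simp only: powr_minus divide_inverse mult_1_left)
        qed
        finally show ?thesis .
      qed
      finally show ?thesis using Ga by (simp add: ennreal_mult[symmetric] mult_ac)
    qed simp
  qed
  also have "\<dots> = (\<integral>\<^sup>+s. (\<integral>\<^sup>+t. ?k s * ennreal ((1 - cos (t \<bullet> x)) * exp (- (s * (norm t)\<^sup>2))) \<partial>lborel) \<partial>lborel)"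
    by (rule pair_sigma_finite.Fubini') (auto intro: pair_sigma_finite.intro sigma_finite_lborel, measurable)
  also have "\<dots> = (\<integral>\<^sup>+s. ennreal (sqrt pi ^ m) * (ennreal (indicator {0<..} s) * ?J s) \<partial>lborel)"
  proof (intro nn_integral_cong)
    fix s :: real
    show "(\<integral>\<^sup>+t. ?k s * ennreal ((1 - cos (t \<bullet> x)) * exp (- (s * (norm t)\<^sup>2))) \<partial>lborel) =
      ennreal (sqrt pi ^ m) * (ennreal (indicator {0<..} s) * ?J s)"
    proof (cases "s > 0")
      case True
      have le1: "exp (- ((norm x)\<^sup>2 / (4 * s))) \<le> 1" using True by simp
      have "(\<integral>\<^sup>+t. ?k s * ennreal ((1 - cos (t \<bullet> x)) * exp (- (s * (norm t)\<^sup>2))) \<partial>lborel) =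
            ennreal (sqrt s ^ m) * ennreal (sqrt (pi / s) ^ DIM('a) * (1 - exp (- ((norm x)\<^sup>2 / (4 * s)))))"
        using True by (subst nn_integral_cmult) (auto simp: nn_integral_one_minus_cos_Gaussian powr_half)
      also have "\<dots> = ennreal (sqrt pi ^ m * (sqrt (pi / s) * (1 - exp (- ((norm x)\<^sup>2 / (4 * s))))))"
        using True le1 by (simp add: ennreal_mult[symmetric] m real_sqrt_divide power_divide)
      also have "\<dots> = ennreal (sqrt pi ^ m) * ?J s"
        using True le1 nn_integral_one_minus_cos_Gaussian[OF True, of "norm x"] by (simp add: ennreal_mult)
      finally show ?thesis using True by simp
    qed simp
  qed
  also have "\<dots> = ennreal (sqrt pi ^ m) * (\<integral>\<^sup>+s. ennreal (indicator {0<..} s) * ?J s \<partial>lborel)"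
    by (rule nn_integral_cmult) measurable
  also have "(\<integral>\<^sup>+s. ennreal (indicator {0<..} s) * ?J s \<partial>lborel) =
     (\<integral>\<^sup>+s. (\<integral>\<^sup>+v. ennreal (indicator {0<..} s) * ennreal ((1 - cos (v * norm x)) * exp (- (s * v\<^sup>2))) \<partial>lborel) \<partial>lborel)"
    by (simp add: nn_integral_cmult)
  also have "\<dots> = (\<integral>\<^sup>+v. (\<integral>\<^sup>+s. ennreal (indicator {0<..} s) * ennreal ((1 - cos (v * norm x)) * exp (- (s * v\<^sup>2))) \<partial>lborel) \<partial>lborel)"
    by (rule lborel_pair.Fubini') measurable
  also have "\<dots> = (\<integral>\<^sup>+v. ennreal ((1 - cos (v * norm x)) / v\<^sup>2) \<partial>lborel)"
  proof (intro nn_integral_cong)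
    fix v :: real
    show "(\<integral>\<^sup>+s. ennreal (indicator {0<..} s) * ennreal ((1 - cos (v * norm x)) * exp (- (s * v\<^sup>2))) \<partial>lborel) =
       ennreal ((1 - cos (v * norm x)) / v\<^sup>2)"
    proof (cases "v = 0")
      case False
      have "(\<integral>\<^sup>+s. ennreal (indicator {0<..} s) * ennreal ((1 - cos (v * norm x)) * exp (- (s * v\<^sup>2))) \<partial>lborel) =
        (\<integral>\<^sup>+s. ennreal (1 - cos (v * norm x)) * ennreal (indicator {0<..} s * (s powr (1 - 1) * exp (- (s * v\<^sup>2)))) \<partial>lborel)"
        by (intro nn_integral_cong) (auto simp: indicator_def ennreal_mult)
      also have "\<dots> = ennreal (1 - cos (v * norm x)) * ennreal (Gamma 1 * v\<^sup>2 powr (- 1))"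
      proof -
        have "(\<integral>\<^sup>+s. ennreal (indicator {0<..} s * (s powr (1 - 1) * exp (- (s * v\<^sup>2)))) \<partial>lborel) = ennreal (Gamma 1 * v\<^sup>2 powr (- 1))"
          using False by (intro nn_integral_Gamma_scaled) auto
        moreover have "(\<lambda>s. ennreal (indicator {0<..} s * (s powr (1 - 1) * exp (- (s * v\<^sup>2))))) \<in> borel_measurable lborel"
          by measurable
        ultimately show ?thesis by (simp only: nn_integral_cmult)
      qed
      also have "\<dots> = ennreal ((1 - cos (v * norm x)) / v\<^sup>2)"
        using False by (simp add: ennreal_mult[symmetric] powr_minus divide_inverse)
      finally show ?thesis .
    qed simp
  qed
  also have "\<dots> = ennreal (pi * norm x)" by (simp add: nn_integral_one_minus_cos_over_square)
  finally have "ennreal (Gamma a) * ?I = ennreal (sqrt pi ^ m * (pi * norm x))" by (simp add: ennreal_mult)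
  then have "ennreal (1 / Gamma a) * (ennreal (Gamma a) * ?I) = ennreal (1 / Gamma a) * ennreal (sqrt pi ^ m * (pi * norm x))"
    by (rule arg_cong)
  also have "\<dots> = ennreal (1 / Gamma a * (sqrt pi ^ m * (pi * norm x)))"
    using Ga by (intro ennreal_mult[symmetric]) auto
  finally have "ennreal (1 / Gamma a) * (ennreal (Gamma a) * ?I) = ennreal (1 / Gamma a * (sqrt pi ^ m * (pi * norm x)))" .
  moreover have "ennreal (1 / Gamma a) * (ennreal (Gamma a) * ?I) = ?I"
    using Ga by (simp add: mult.assoc[symmetric] ennreal_mult[symmetric])
  moreover have "1 / Gamma a * (sqrt pi ^ m * (pi * norm x)) = c_const DIM('a) * norm x"
  proof -
    have "sqrt pi ^ m * pi = pi powr a"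
      using powr_half[of pi] by (simp add: powr_diff divide_eq_eq)
    moreover have "c_const DIM('a) = pi powr a / Gamma a"
      by (simp only: c_const_def a_def)
    moreover have "1 / Gamma a * (sqrt pi ^ m * (pi * norm x)) = sqrt pi ^ m * pi / Gamma a * norm x"
      by simp
    ultimately show ?thesis by (simp only:)
  qed
  ultimately show ?thesis by (simp only:)
qed

section \<open>The distance covariance as a weighted norm\<close>

text \<open>The weight of the norm factorizes, so the norm is taken in \<open>L\<^sup>2\<close> of the product of two such measures. The
measure is infinite but \<open>\<sigma>\<close>-finite.\<close>

definition kernel_measure :: "'a::euclidean_space measure" where
  "kernel_measure = density lborel (\<lambda>t. ennreal (1 / (c_const DIM('a) * norm t ^ (1 + DIM('a)))))"

lemma c_const_pos: "c_const d > 0"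
  by (auto simp: c_const_def intro!: divide_pos_pos Gamma_real_pos add_pos_nonneg)

lemma sets_kernel_measure[simp, measurable_cong]: "sets (kernel_measure :: 'a::euclidean_space measure) = sets borel"
  by (simp add: kernel_measure_def)

lemma space_kernel_measure[simp]: "space (kernel_measure :: 'a::euclidean_space measure) = UNIV"
  by (simp add: kernel_measure_def)

lemma sigma_finite_kernel_measure: "sigma_finite_measure (kernel_measure :: 'a::euclidean_space measure)"
  unfolding kernel_measure_def
  by (subst sigma_finite_measure.sigma_finite_iff_density_finite[OF sigma_finite_lborel]) auto

lemma sets_kernel_measure_pair:
  "sets (kernel_measure \<Otimes>\<^sub>M kernel_measure) = sets (borel :: ('a::euclidean_space \<times> 'b::euclidean_space) measure)"
  unfolding borel_prod[symmetric] by (rule sets_pair_measure_cong) simp_all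

lemma pair_sigma_finite_kernel_measure:
  "pair_sigma_finite (kernel_measure :: 'a::euclidean_space measure) (kernel_measure :: 'b::euclidean_space measure)"
  by (intro pair_sigma_finite.intro sigma_finite_kernel_measure)

lemma nn_integral_kernel_measure:
  assumes [measurable]: "f \<in> borel_measurable borel"
  shows "(\<integral>\<^sup>+t. f t \<partial>(kernel_measure :: 'a::euclidean_space measure)) =
    (\<integral>\<^sup>+t. ennreal (1 / (c_const DIM('a) * norm t ^ (1 + DIM('a)))) * f t \<partial>lborel)"
  unfolding kernel_measure_def by (rule nn_integral_density) auto

lemma nn_integral_kernel_measure_one_minus_cos:
  fixes x :: "'a::euclidean_space"
  shows "(\<integral>\<^sup>+t. ennreal (1 - cos (t \<bullet> x)) \<partial>kernel_measure) = ennreal (norm x)"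
proof -
  have c: "c_const DIM('a) > 0" by (rule c_const_pos)
  have "(\<integral>\<^sup>+t. ennreal (1 - cos (t \<bullet> x)) \<partial>kernel_measure) =
    (\<integral>\<^sup>+t. ennreal (1 / c_const DIM('a)) * ennreal ((1 - cos (t \<bullet> x)) / norm t ^ (1 + DIM('a))) \<partial>lborel)"
    using c by (subst nn_integral_kernel_measure) (auto intro!: nn_integral_cong simp: ennreal_mult[symmetric])
  also have "\<dots> = ennreal (1 / c_const DIM('a)) * ennreal (c_const DIM('a) * norm x)"
    by (subst nn_integral_cmult) (measurable, simp only: nn_integral_one_minus_cos_kernel)
  also have "\<dots> = ennreal (norm x)"
    using c by (simp add: ennreal_mult[symmetric])
  finally show ?thesis .
qed

lemma has_bochner_integral_kernel_measure:
  fixes x :: "'a::euclidean_space"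
  shows "has_bochner_integral kernel_measure (\<lambda>t. 1 - cos (t \<bullet> x)) (norm x)"
  by (rule has_bochner_integral_nn_integral) (auto simp: nn_integral_kernel_measure_one_minus_cos)

lemma nn_integral_kernel_measure_reflect:
  fixes f :: "'a::euclidean_space \<Rightarrow> ennreal"
  assumes [measurable]: "f \<in> borel_measurable borel"
  shows "(\<integral>\<^sup>+t. f (- t) \<partial>kernel_measure) = (\<integral>\<^sup>+t. f t \<partial>kernel_measure)"
proof -
  have "(lborel :: 'a measure) = distr lborel borel (\<lambda>x. 0 + (-1) *\<^sub>R x)"
    using lborel_affine[of "-1" "0::'a"] by (simp add: density_1)
  then have refl: "(\<integral>\<^sup>+t. g t \<partial>lborel) = (\<integral>\<^sup>+t. g (- t) \<partial>lborel)"
    if "g \<in> borel_measurable borel" for g :: "'a \<Rightarrow> ennreal"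
    using that nn_integral_distr[of "\<lambda>x. 0 + (-1) *\<^sub>R x" "lborel :: 'a measure" borel g] by simp
  show ?thesis
    by (subst (1 2) nn_integral_kernel_measure, measurable) (subst (2) refl, auto)
qed

lemma weighted_norm_sq_eq:
  fixes \<gamma> :: "(real^'p) \<times> (real^'q) \<Rightarrow> complex"
  assumes [measurable]: "\<gamma> \<in> borel_measurable borel"
  shows "weighted_norm_sq \<gamma> = (LINT u|(kernel_measure \<Otimes>\<^sub>M kernel_measure). (cmod (\<gamma> u))\<^sup>2)"
proof -
  let ?w = "\<lambda>(t :: real^'p, s :: real^'q). 1 / (c_const CARD('p) * norm t ^ (1 + CARD('p))) * (1 / (c_const CARD('q) * norm s ^ (1 + CARD('q))))"
  have "(kernel_measure \<Otimes>\<^sub>M kernel_measure :: ((real^'p) \<times> (real^'q)) measure) =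
     density (lborel \<Otimes>\<^sub>M lborel) (\<lambda>(t, s). ennreal (1 / (c_const CARD('p) * norm t ^ (1 + CARD('p)))) * ennreal (1 / (c_const CARD('q) * norm s ^ (1 + CARD('q)))))"
    unfolding kernel_measure_def
    by (subst pair_measure_density) (auto intro: sigma_finite_lborel sigma_finite_kernel_measure[unfolded kernel_measure_def, where 'a = "real^'q", simplified])
  also have "\<dots> = density (lborel \<Otimes>\<^sub>M lborel) (\<lambda>u. ennreal (?w u))"
    using c_const_pos by (intro density_cong) (auto simp: ennreal_mult[symmetric] less_imp_le)
  also have "\<dots> = density lborel (\<lambda>u. ennreal (?w u))"
    by (simp only: lborel_prod)
  finally have eq: "(kernel_measure \<Otimes>\<^sub>M kernel_measure :: ((real^'p) \<times> (real^'q)) measure) = density lborel (\<lambda>u. ennreal (?w u))" .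
  have "?w \<in> borel_measurable (lborel \<Otimes>\<^sub>M lborel)" by measurable
  then have m: "?w \<in> borel_measurable lborel" by (simp only: lborel_prod)
  have nn: "0 \<le> ?w u" for u using c_const_pos by (auto simp: less_imp_le split: prod.split)
  have "(LINT u|(kernel_measure \<Otimes>\<^sub>M kernel_measure). (cmod (\<gamma> u))\<^sup>2) = (LINT u|lborel. ?w u *\<^sub>R (cmod (\<gamma> u))\<^sup>2)"
    unfolding eq by (rule integral_density[OF _ m AE_I2[OF nn]]) measurable
  also have "\<dots> = weighted_norm_sq \<gamma>"
    unfolding weighted_norm_sq_def by (auto intro!: Bochner_Integration.integral_cong simp: mult_ac)
  finally show ?thesis ..
qed

definition sample_char :: "nat \<Rightarrow> (nat \<Rightarrow> 'a::euclidean_space) \<Rightarrow> 'a \<Rightarrow> complex" where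
  "sample_char n x t = (\<Sum>k=1..n. iexp (t \<bullet> x k)) / of_nat n"

definition sample_char_defect ::
    "nat \<Rightarrow> (nat \<Rightarrow> 'a::euclidean_space) \<Rightarrow> (nat \<Rightarrow> 'b::euclidean_space) \<Rightarrow> 'a \<times> 'b \<Rightarrow> complex" where
  "sample_char_defect n x y = (\<lambda>(t, s).
     (\<Sum>k=1..n. iexp (t \<bullet> x k) * iexp (s \<bullet> y k)) / of_nat n - sample_char n x t * sample_char n y s)"

lemma cnj_iexp: "cnj (iexp r) = iexp (- r)"
  by (simp add: exp_cnj)

lemma Re_iexp: "Re (iexp r) = cos r"
  by (simp flip: cis_conv_exp)

text \<open>Centering the vector \<open>(exp (i t \<bullet> x k))\<close> is double centering of its Gram matrix, whose entries have real
part \<open>cos (t \<bullet> (x k - x l))\<close>; double centering kills the constant \<open>1\<close>.\<close>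

lemma centered_product_eq_double_centered:
  fixes x :: "nat \<Rightarrow> 'a::euclidean_space"
  assumes n: "n > 0"
  shows "Re ((iexp (t \<bullet> x k) - sample_char n x t) * cnj (iexp (t \<bullet> x l) - sample_char n x t)) =
         - double_centered n (\<lambda>k l. 1 - cos (t \<bullet> (x k - x l))) k l"
proof -
  let ?e = "\<lambda>k. iexp (t \<bullet> x k)"
  have ee: "Re (?e i * cnj (?e j)) = cos (t \<bullet> (x i - x j))" for i j
    by (simp only: cnj_iexp exp_add[symmetric] distrib_left[symmetric] of_real_add[symmetric] Re_iexp) (simp add: inner_diff_right)
  have "(?e k - sample_char n x t) * cnj (?e l - sample_char n x t) =
     ?e k * cnj (?e l) - (\<Sum>j=1..n. ?e k * cnj (?e j)) / of_nat n - (\<Sum>i=1..n. ?e i * cnj (?e l)) / of_nat n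
     + (\<Sum>i=1..n. \<Sum>j=1..n. ?e i * cnj (?e j)) / (of_nat n)\<^sup>2"
    unfolding sample_char_def sum_product[symmetric] cnj_sum[symmetric] sum_distrib_left[symmetric] sum_distrib_right[symmetric]
    by (simp add: algebra_simps power2_eq_square)
  also have "\<dots> = ?e k * cnj (?e l) - (\<Sum>j=1..n. ?e k * cnj (?e j)) / of_real (real n) - (\<Sum>i=1..n. ?e i * cnj (?e l)) / of_real (real n)
     + (\<Sum>i=1..n. \<Sum>j=1..n. ?e i * cnj (?e j)) / of_real ((real n)\<^sup>2)" by simp
  finally have "Re ((?e k - sample_char n x t) * cnj (?e l - sample_char n x t)) =
     double_centered n (\<lambda>k l. cos (t \<bullet> (x k - x l))) k l"
    by (simp only: minus_complex.sel plus_complex.sel Re_divide_of_real Re_sum ee double_centered_def)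
  also have "\<dots> = - double_centered n (\<lambda>k l. 1 - cos (t \<bullet> (x k - x l))) k l"
    using n by (simp add: double_centered_def sum_subtractf diff_divide_distrib power2_eq_square)
  finally show ?thesis .
qed

lemma sample_char_defect_centered:
  fixes x :: "nat \<Rightarrow> 'a::euclidean_space" and y :: "nat \<Rightarrow> 'b::euclidean_space"
  assumes n: "n > 0"
  shows "sample_char_defect n x y (t, s) =
    (\<Sum>k=1..n. (iexp (t \<bullet> x k) - sample_char n x t) * (iexp (s \<bullet> y k) - sample_char n y s)) / of_nat n"
proof -
  let ?e = "\<lambda>k. iexp (t \<bullet> x k)" and ?f = "\<lambda>k. iexp (s \<bullet> y k)"
  have E: "(\<Sum>k=1..n. ?e k) = of_nat n * sample_char n x t" and F: "(\<Sum>k=1..n. ?f k) = of_nat n * sample_char n y s"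
    using n by (simp_all add: sample_char_def)
  have "(\<Sum>k=1..n. (?e k - sample_char n x t) * (?f k - sample_char n y s)) =
     (\<Sum>k=1..n. ?e k * ?f k) - (\<Sum>k=1..n. ?e k) * sample_char n y s - sample_char n x t * (\<Sum>k=1..n. ?f k)
       + of_nat n * (sample_char n x t * sample_char n y s)"
    by (simp add: algebra_simps sum.distrib sum_subtractf sum_distrib_left sum_distrib_right)
  then show ?thesis
    unfolding E F using n by (simp add: sample_char_defect_def field_simps)
qed

text \<open>The square expands into products of complex Gram entries. Adding the value at the reflected point
\<open>(- t, s)\<close> conjugates the first factors, so that only products of real parts survive.\<close>

lemma sample_char_defect_reflected_square:
  fixes x :: "nat \<Rightarrow> 'a::euclidean_space" and y :: "nat \<Rightarrow> 'b::euclidean_space"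
  assumes n: "n > 0"
  shows "(cmod (sample_char_defect n x y (t, s)))\<^sup>2 + (cmod (sample_char_defect n x y (- t, s)))\<^sup>2 =
    2 * ((\<Sum>k=1..n. \<Sum>l=1..n. double_centered n (\<lambda>k l. 1 - cos (t \<bullet> (x k - x l))) k l *
        double_centered n (\<lambda>k l. 1 - cos (s \<bullet> (y k - y l))) k l) / (real n)\<^sup>2)"
proof -
  define u where "u k = iexp (t \<bullet> x k) - sample_char n x t" for k
  define v where "v k = iexp (s \<bullet> y k) - sample_char n y s" for k
  have minus: "iexp (- t \<bullet> x k) - sample_char n x (- t) = cnj (u k)" for k
    by (simp add: u_def sample_char_def cnj_iexp)
  have sq: "(cmod ((\<Sum>k=1..n. w k * v k) / of_nat n))\<^sup>2 =
     (\<Sum>k=1..n. \<Sum>l=1..n. Re ((w k * cnj (w l)) * (v k * cnj (v l)))) / (real n)\<^sup>2" for w :: "nat \<Rightarrow> complex"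
  proof -
    have "complex_of_real ((cmod (\<Sum>k=1..n. w k * v k))\<^sup>2) = (\<Sum>k=1..n. \<Sum>l=1..n. (w k * v k) * cnj (w l * v l))"
      by (simp only: complex_norm_square cnj_sum sum_product)
    then have "(cmod (\<Sum>k=1..n. w k * v k))\<^sup>2 = (\<Sum>k=1..n. \<Sum>l=1..n. Re ((w k * v k) * cnj (w l * v l)))"
      by (metis (no_types, lifting) Re_complex_of_real Re_sum sum.cong)
    then show ?thesis by (simp add: norm_divide power_divide mult_ac)
  qed
  have "(cmod (sample_char_defect n x y (t, s)))\<^sup>2 + (cmod (sample_char_defect n x y (- t, s)))\<^sup>2 =
    (\<Sum>k=1..n. \<Sum>l=1..n. Re ((u k * cnj (u l)) * (v k * cnj (v l))) + Re (cnj (u k * cnj (u l)) * (v k * cnj (v l)))) / (real n)\<^sup>2"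
    unfolding sample_char_defect_centered[OF n] minus unfolding u_def[symmetric] v_def[symmetric] sq
    by (simp add: add_divide_distrib sum.distrib mult_ac)
  also have "\<dots> = (\<Sum>k=1..n. \<Sum>l=1..n. 2 * (Re (u k * cnj (u l)) * Re (v k * cnj (v l)))) / (real n)\<^sup>2"
  proof -
    have "Re (a * b) + Re (cnj a * b) = 2 * (Re a * Re b)" for a b :: complex by simp
    then show ?thesis by (simp only:)
  qed
  finally show ?thesis
    unfolding u_def v_def centered_product_eq_double_centered[OF n] by (simp add: sum_distrib_left)
qed

lemma has_bochner_integral_double_centered:
  assumes "\<And>k l. has_bochner_integral M (a k l) (I k l :: real)"
  shows "has_bochner_integral M (\<lambda>t. double_centered n (\<lambda>k l. a k l t) k l) (double_centered n I k l)"
  unfolding double_centered_def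
  by (intro has_bochner_integral_add has_bochner_integral_diff has_bochner_integral_divide_zero has_bochner_integral_sum assms)

lemma (in pair_sigma_finite) has_bochner_integral_product:
  fixes f :: "'a \<Rightarrow> 'c::{real_normed_field,banach,second_countable_topology}" and g :: "'b \<Rightarrow> 'c"
  assumes f: "has_bochner_integral M1 f a" and g: "has_bochner_integral M2 g b"
  shows "has_bochner_integral (M1 \<Otimes>\<^sub>M M2) (\<lambda>(x, y). f x * g y) (a * b)"
proof -
  have [measurable]: "f \<in> borel_measurable M1" "g \<in> borel_measurable M2"
    using f g by (auto simp: has_bochner_integral_iff)
  have "integrable (M1 \<Otimes>\<^sub>M M2) (\<lambda>(x, y). f x * g y)"
  proof (rule Fubini_integrable)
    have "integrable M1 (\<lambda>x. norm (f x) * (LINT y|M2. norm (g y)))"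
      using f by (auto simp: has_bochner_integral_iff)
    then show "integrable M1 (\<lambda>x. LINT y|M2. norm (case (x, y) of (x, y) \<Rightarrow> f x * g y))"
      by (simp add: norm_mult)
    show "AE x in M1. integrable M2 (\<lambda>y. case (x, y) of (x, y) \<Rightarrow> f x * g y)"
      using g by (auto simp: has_bochner_integral_iff)
  qed measurable
  moreover from integral_fst'[OF this] have "integral\<^sup>L (M1 \<Otimes>\<^sub>M M2) (\<lambda>(x, y). f x * g y) = a * b"
    using f g by (simp add: has_bochner_integral_iff)
  ultimately show ?thesis by (simp add: has_bochner_integral_iff)
qed

lemma sample_char_defect_measurable[measurable]:
  "sample_char_defect n x y \<in> borel_measurable borel"
  unfolding sample_char_defect_def sample_char_def by (simp add: borel_prod[symmetric]) measurable

text \<open>The sum of the square and its reflection is a finite combination of products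
\<open>(1 - cos (t \<bullet> (x k - x l))) (1 - cos (s \<bullet> (y i - y j)))\<close>, which integrate to products of distances; the
reflection does not change the integral.\<close>

lemma dcov_sq_eq_integral:
  fixes x :: "nat \<Rightarrow> 'a::euclidean_space" and y :: "nat \<Rightarrow> 'b::euclidean_space"
  assumes n: "n > 0"
  shows "has_bochner_integral (kernel_measure \<Otimes>\<^sub>M kernel_measure) (\<lambda>u. (cmod (sample_char_defect n x y u))\<^sup>2) (dcov_sq n x y)"
proof -
  interpret pair_sigma_finite "kernel_measure :: 'a measure" "kernel_measure :: 'b measure"
    by (rule pair_sigma_finite_kernel_measure)
  let ?K = "kernel_measure \<Otimes>\<^sub>M kernel_measure :: ('a \<times> 'b) measure"
  let ?D = "\<lambda>u. (cmod (sample_char_defect n x y u))\<^sup>2"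
  let ?a = "\<lambda>t. double_centered n (\<lambda>k l. 1 - cos (t \<bullet> (x k - x l)))"
  let ?b = "\<lambda>s. double_centered n (\<lambda>k l. 1 - cos (s \<bullet> (y k - y l)))"
  have D[measurable]: "?D \<in> borel_measurable borel" by measurable
  then have DK[measurable]: "?D \<in> borel_measurable ?K"
    by (simp add: measurable_cong_sets[OF sets_kernel_measure_pair refl])
  have DR[measurable]: "(\<lambda>(t, s). ?D (- t, s)) \<in> borel_measurable ?K"
  proof -
    have "(\<lambda>(t, s). (- t, s)) \<in> ?K \<rightarrow>\<^sub>M ?K" by measurable
    from measurable_compose[OF this DK] show ?thesis by (simp add: split_def)
  qed
  have "has_bochner_integral ?K (\<lambda>u. 2 * ((\<Sum>k=1..n. \<Sum>l=1..n. (case u of (t, s) \<Rightarrow> ?a t k l * ?b s k l)) / (real n)\<^sup>2)) (2 * dcov_sq n x y)"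
    unfolding dcov_sq_def dist_matrix_def
    by (intro has_bochner_integral_mult_right has_bochner_integral_divide_zero has_bochner_integral_sum
        has_bochner_integral_product has_bochner_integral_double_centered has_bochner_integral_kernel_measure)
  moreover have "2 * ((\<Sum>k=1..n. \<Sum>l=1..n. (case u of (t, s) \<Rightarrow> ?a t k l * ?b s k l)) / (real n)\<^sup>2) =
     ?D u + (case u of (t, s) \<Rightarrow> ?D (- t, s))" for u
    by (cases u) (simp add: sample_char_defect_reflected_square[OF n])
  ultimately have total: "has_bochner_integral ?K (\<lambda>u. ?D u + (case u of (t, s) \<Rightarrow> ?D (- t, s))) (2 * dcov_sq n x y)"
    by simp
  have intD: "integrable ?K ?D" and intR: "integrable ?K (\<lambda>(t, s). ?D (- t, s))"
    by (rule Bochner_Integration.integrable_bound[OF integrable.intros[OF total]]; auto)+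
  have "(\<integral>\<^sup>+u. ennreal (case u of (t, s) \<Rightarrow> ?D (- t, s)) \<partial>?K) = (\<integral>\<^sup>+s. \<integral>\<^sup>+t. ennreal (?D (- t, s)) \<partial>kernel_measure \<partial>kernel_measure)"
    by (subst nn_integral_snd[symmetric]) auto
  also have "\<dots> = (\<integral>\<^sup>+s. \<integral>\<^sup>+t. ennreal (?D (t, s)) \<partial>kernel_measure \<partial>kernel_measure)"
    by (intro nn_integral_cong nn_integral_kernel_measure_reflect) measurable
  also have "\<dots> = (\<integral>\<^sup>+u. ennreal (?D u) \<partial>?K)"
    by (subst nn_integral_snd) auto
  finally have "integral\<^sup>L ?K (\<lambda>(t, s). ?D (- t, s)) = integral\<^sup>L ?K ?D"
    using intD intR by (subst (1 2) integral_eq_nn_integral) auto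
  moreover have "integral\<^sup>L ?K ?D + integral\<^sup>L ?K (\<lambda>(t, s). ?D (- t, s)) = 2 * dcov_sq n x y"
    using total intD intR by (simp add: has_bochner_integral_iff)
  ultimately show ?thesis using intD by (simp add: has_bochner_integral_iff)
qed

section \<open>Discretization of the norm of a second-order process\<close>

text \<open>The two coefficients come from the inequality of arithmetic and geometric means. With \<open>e\<close> small this
bounds the expected difference of squares by an expected square of the difference, without taking roots.\<close>

lemma abs_square_diff_le:
  fixes a b :: complex and e :: real
  assumes e: "e > 0"
  shows "\<bar>(cmod a)\<^sup>2 - (cmod b)\<^sup>2\<bar> \<le> (1 + 1 / e) * (cmod (a - b))\<^sup>2 + e * (cmod b)\<^sup>2"
proof -
  define d where "d = cmod (a - b)"
  have d: "\<bar>cmod a - cmod b\<bar> \<le> d" unfolding d_def by (rule norm_triangle_ineq3)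
  have "\<bar>(cmod a)\<^sup>2 - (cmod b)\<^sup>2\<bar> = \<bar>cmod a - cmod b\<bar> * (cmod a + cmod b)"
    by (simp add: power2_eq_square square_diff_square_factored abs_mult mult.commute)
  also have "\<dots> \<le> d * (d + 2 * cmod b)"
    using d by (intro mult_mono) auto
  also have "\<dots> \<le> (1 + 1 / e) * d\<^sup>2 + e * (cmod b)\<^sup>2"
  proof -
    have "0 \<le> (d / sqrt e - sqrt e * cmod b)\<^sup>2" by simp
    also have "\<dots> = d\<^sup>2 / e + e * (cmod b)\<^sup>2 - 2 * d * cmod b"
      using e by (simp add: power2_diff power_divide power_mult_distrib)
    finally show ?thesis by (simp add: algebra_simps power2_eq_square)
  qed
  finally show ?thesis by (simp add: d_def)
qed

lemma Laplace_transform_diff_le: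
  fixes A B :: "'a \<Rightarrow> real"
  assumes "prob_space P" and [measurable]: "A \<in> borel_measurable P" "B \<in> borel_measurable P"
    and nn: "\<And>\<omega>. 0 \<le> A \<omega>" "\<And>\<omega>. 0 \<le> B \<omega>"
    and AB: "(\<integral>\<^sup>+\<omega>. ennreal \<bar>A \<omega> - B \<omega>\<bar> \<partial>P) \<le> ennreal e" and e: "e \<ge> 0" and l: "l \<ge> 0"
  shows "\<bar>(LINT \<omega>|P. exp (- (l * A \<omega>))) - (LINT \<omega>|P. exp (- (l * B \<omega>)))\<bar> \<le> l * e"
proof -
  interpret prob_space P by fact
  have int: "integrable P (\<lambda>\<omega>. \<bar>A \<omega> - B \<omega>\<bar>)"
    using AB by (intro integrableI_bounded) (auto intro: le_less_trans)
  have iE: "integrable P (\<lambda>\<omega>. exp (- (l * U \<omega>)))" if "U \<in> borel_measurable P" "\<And>\<omega>. 0 \<le> U \<omega>" for U :: "'a \<Rightarrow> real"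
    using that l by (intro integrable_const_bound[of _ 1]) auto
  have lip: "\<bar>exp (- x) - exp (- y)\<bar> \<le> \<bar>x - y\<bar>" if "0 \<le> x" "0 \<le> y" for x y :: real
  proof -
    have *: "exp (- v) - exp (- u) \<le> u - v" if "0 \<le> v" "v \<le> u" for u v :: real
    proof -
      define E where "E = exp (- (u - v))"
      have E: "1 + - (u - v) \<le> E" "E \<le> 1"
        unfolding E_def using that by (auto intro: exp_ge_add_one_self simp del: exp_ge_add_one_self)
      have "exp (- v) - exp (- u) = exp (- v) * (1 - E)"
        by (simp add: E_def right_diff_distrib exp_add[symmetric])
      also have "\<dots> \<le> 1 * (1 - E)"
        using that E(2) by (intro mult_right_mono) auto
      finally show ?thesis using E(1) by simp
    qed
    show ?thesis
      using *[of x y] *[of y x] that by (cases "x \<le> y") (auto simp: abs_if)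
  qed
  have "\<bar>(LINT \<omega>|P. exp (- (l * A \<omega>))) - (LINT \<omega>|P. exp (- (l * B \<omega>)))\<bar> = \<bar>LINT \<omega>|P. exp (- (l * A \<omega>)) - exp (- (l * B \<omega>))\<bar>"
    using iE nn by (subst Bochner_Integration.integral_diff) auto
  also have "\<dots> \<le> (LINT \<omega>|P. \<bar>exp (- (l * A \<omega>)) - exp (- (l * B \<omega>))\<bar>)"
    by (rule integral_abs_bound)
  also have "\<dots> \<le> (LINT \<omega>|P. l * \<bar>A \<omega> - B \<omega>\<bar>)"
  proof (rule integral_mono)
    show "\<bar>exp (- (l * A \<omega>)) - exp (- (l * B \<omega>))\<bar> \<le> l * \<bar>A \<omega> - B \<omega>\<bar>" for \<omega>
      using lip[of "l * A \<omega>" "l * B \<omega>"] nn l by (simp add: right_diff_distrib[symmetric] abs_mult)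
  qed (use iE nn int in auto)
  also have "\<dots> = l * (LINT \<omega>|P. \<bar>A \<omega> - B \<omega>\<bar>)" by simp
  also have "(LINT \<omega>|P. \<bar>A \<omega> - B \<omega>\<bar>) \<le> e"
    using AB e by (subst integral_eq_nn_integral) (auto intro: enn2real_leI)
  finally show ?thesis using l by (simp add: mult_left_mono)
qed

text \<open>Tonelli's theorem: the inequality moves the expectation inside the integral over the parameter, where
pointwise second moments suffice.\<close>

lemma (in pair_sigma_finite) nn_integral_square_norm_diff_le:
  fixes f g :: "'a \<times> 'b \<Rightarrow> complex"
  assumes f[measurable]: "f \<in> borel_measurable (M1 \<Otimes>\<^sub>M M2)" and g[measurable]: "g \<in> borel_measurable (M1 \<Otimes>\<^sub>M M2)"
    and ff: "(\<integral>\<^sup>+u. \<integral>\<^sup>+\<omega>. ennreal ((cmod (f (\<omega>, u)))\<^sup>2) \<partial>M1 \<partial>M2) < \<infinity>"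
    and gg: "(\<integral>\<^sup>+u. \<integral>\<^sup>+\<omega>. ennreal ((cmod (g (\<omega>, u)))\<^sup>2) \<partial>M1 \<partial>M2) < \<infinity>"
  shows "(\<integral>\<^sup>+\<omega>. ennreal \<bar>(LINT u|M2. (cmod (f (\<omega>, u)))\<^sup>2) - (LINT u|M2. (cmod (g (\<omega>, u)))\<^sup>2)\<bar> \<partial>M1) \<le>
         (\<integral>\<^sup>+u. \<integral>\<^sup>+\<omega>. ennreal \<bar>(cmod (f (\<omega>, u)))\<^sup>2 - (cmod (g (\<omega>, u)))\<^sup>2\<bar> \<partial>M1 \<partial>M2)"
proof -
  have int: "integrable (M1 \<Otimes>\<^sub>M M2) (\<lambda>z. (cmod (h z))\<^sup>2)"
    if "h \<in> borel_measurable (M1 \<Otimes>\<^sub>M M2)" "(\<integral>\<^sup>+u. \<integral>\<^sup>+\<omega>. ennreal ((cmod (h (\<omega>, u)))\<^sup>2) \<partial>M1 \<partial>M2) < \<infinity>" for h :: "'a \<times> 'b \<Rightarrow> complex"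
  proof (rule integrableI_bounded)
    note [measurable] = that(1)
    show "(\<lambda>z. (cmod (h z))\<^sup>2) \<in> borel_measurable (M1 \<Otimes>\<^sub>M M2)" by measurable
    show "(\<integral>\<^sup>+z. ennreal (norm ((cmod (h z))\<^sup>2)) \<partial>(M1 \<Otimes>\<^sub>M M2)) < \<infinity>"
      using that(2) by (subst nn_integral_snd[symmetric]) auto
  qed
  have "(\<integral>\<^sup>+\<omega>. ennreal \<bar>(LINT u|M2. (cmod (f (\<omega>, u)))\<^sup>2) - (LINT u|M2. (cmod (g (\<omega>, u)))\<^sup>2)\<bar> \<partial>M1) \<le>
        (\<integral>\<^sup>+\<omega>. \<integral>\<^sup>+u. ennreal \<bar>(cmod (f (\<omega>, u)))\<^sup>2 - (cmod (g (\<omega>, u)))\<^sup>2\<bar> \<partial>M2 \<partial>M1)"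
  proof (rule nn_integral_mono_AE)
    show "AE \<omega> in M1. ennreal \<bar>(LINT u|M2. (cmod (f (\<omega>, u)))\<^sup>2) - (LINT u|M2. (cmod (g (\<omega>, u)))\<^sup>2)\<bar> \<le>
        (\<integral>\<^sup>+u. ennreal \<bar>(cmod (f (\<omega>, u)))\<^sup>2 - (cmod (g (\<omega>, u)))\<^sup>2\<bar> \<partial>M2)"
      using AE_integrable_fst'[OF int[OF f ff]] AE_integrable_fst'[OF int[OF g gg]]
    proof eventually_elim
      case (elim \<omega>)
      then have "ennreal \<bar>(LINT u|M2. (cmod (f (\<omega>, u)))\<^sup>2) - (LINT u|M2. (cmod (g (\<omega>, u)))\<^sup>2)\<bar> =
         ennreal (norm (LINT u|M2. (cmod (f (\<omega>, u)))\<^sup>2 - (cmod (g (\<omega>, u)))\<^sup>2))"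
        by simp
      also have "\<dots> \<le> (\<integral>\<^sup>+u. ennreal (norm ((cmod (f (\<omega>, u)))\<^sup>2 - (cmod (g (\<omega>, u)))\<^sup>2)) \<partial>M2)"
        using elim by (intro integral_norm_bound_ennreal) auto
      finally show ?case by simp
    qed
  qed
  also have "\<dots> = (\<integral>\<^sup>+u. \<integral>\<^sup>+\<omega>. ennreal \<bar>(cmod (f (\<omega>, u)))\<^sup>2 - (cmod (g (\<omega>, u)))\<^sup>2\<bar> \<partial>M1 \<partial>M2)"
    by (rule Fubini'[symmetric]) measurable
  finally show ?thesis .
qed

lemma borel_measurable_cnj[measurable]: "cnj \<in> borel_measurable borel"
  by (intro borel_measurable_continuous_onI continuous_intros)

text \<open>The second moment of the increment of a process with covariance function \<open>R\<close>.\<close>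

definition cov_increment :: "('u \<Rightarrow> 'u \<Rightarrow> complex) \<Rightarrow> 'u \<Rightarrow> 'u \<Rightarrow> real" where
  "cov_increment R u v = Re (R u u) + Re (R v v) - Re (R u v) - Re (R v u)"

locale second_order_process = prob_space P for P :: "'a measure" +
  fixes \<gamma> :: "'u::euclidean_space \<Rightarrow> 'a \<Rightarrow> complex" and R :: "'u \<Rightarrow> 'u \<Rightarrow> complex"
  assumes jointly_measurable: "jointly_measurable_process P \<gamma>"
    and square_integrable: "\<And>u. integrable P (\<lambda>\<omega>. (cmod (\<gamma> u \<omega>))\<^sup>2)"
    and covariance: "has_covariance_function P \<gamma> R"
begin

lemma joint_measurable[measurable]: "(\<lambda>z. \<gamma> (snd z) (fst z)) \<in> borel_measurable (P \<Otimes>\<^sub>M borel)"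
  using jointly_measurable by (simp add: jointly_measurable_process_def split_def)

lemma measurable_process[measurable]: "\<gamma> u \<in> borel_measurable P"
  using measurable_compose[of "\<lambda>\<omega>. (\<omega>, u)" P "P \<Otimes>\<^sub>M borel", OF _ joint_measurable] by simp

lemma integrable_product: "integrable P (\<lambda>\<omega>. \<gamma> u \<omega> * cnj (\<gamma> v \<omega>))"
proof (rule Bochner_Integration.integrable_bound)
  show "integrable P (\<lambda>\<omega>. (cmod (\<gamma> u \<omega>))\<^sup>2 + (cmod (\<gamma> v \<omega>))\<^sup>2)"
    using square_integrable by auto
  have "a * b \<le> a\<^sup>2 + b\<^sup>2" for a b :: real
  proof -
    have "0 \<le> (a - b / 2)\<^sup>2 + 3 / 4 * b\<^sup>2" by simp
    also have "\<dots> = a\<^sup>2 + b\<^sup>2 - a * b" by (simp add: power2_eq_square algebra_simps)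
    finally show ?thesis by simp
  qed
  then show "AE \<omega> in P. norm (\<gamma> u \<omega> * cnj (\<gamma> v \<omega>)) \<le> norm ((cmod (\<gamma> u \<omega>))\<^sup>2 + (cmod (\<gamma> v \<omega>))\<^sup>2)"
    by (auto simp: norm_mult)
qed measurable

lemma expectation_product: "(CLINT \<omega>|P. \<gamma> u \<omega> * cnj (\<gamma> v \<omega>)) = R u v"
  using covariance by (simp add: has_covariance_function_def)

lemma expectation_norm_square: "(LINT \<omega>|P. (cmod (\<gamma> u \<omega>))\<^sup>2) = Re (R u u)"
proof -
  have "complex_of_real (LINT \<omega>|P. (cmod (\<gamma> u \<omega>))\<^sup>2) = R u u"
    unfolding expectation_product[symmetric] by (simp only: integral_complex_of_real[symmetric] complex_norm_square)
  then show ?thesis by (metis Re_complex_of_real)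
qed

lemma nn_integral_norm_square: "(\<integral>\<^sup>+\<omega>. ennreal ((cmod (\<gamma> u \<omega>))\<^sup>2) \<partial>P) = ennreal (Re (R u u))"
  using square_integrable by (simp add: nn_integral_eq_integral expectation_norm_square)

lemma integrable_increment: "integrable P (\<lambda>\<omega>. (cmod (\<gamma> u \<omega> - \<gamma> v \<omega>))\<^sup>2)"
  and expectation_increment: "(LINT \<omega>|P. (cmod (\<gamma> u \<omega> - \<gamma> v \<omega>))\<^sup>2) = cov_increment R u v"
proof -
  have eq: "(cmod (\<gamma> u \<omega> - \<gamma> v \<omega>))\<^sup>2 = (cmod (\<gamma> u \<omega>))\<^sup>2 + (cmod (\<gamma> v \<omega>))\<^sup>2 - Re (\<gamma> u \<omega> * cnj (\<gamma> v \<omega>)) - Re (\<gamma> v \<omega> * cnj (\<gamma> u \<omega>))" for \<omega>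
    by (simp add: cmod_power2 power2_diff algebra_simps)
  show "integrable P (\<lambda>\<omega>. (cmod (\<gamma> u \<omega> - \<gamma> v \<omega>))\<^sup>2)"
    unfolding eq by (intro Bochner_Integration.integrable_diff Bochner_Integration.integrable_add square_integrable integrable_Re integrable_product)
  show "(LINT \<omega>|P. (cmod (\<gamma> u \<omega> - \<gamma> v \<omega>))\<^sup>2) = cov_increment R u v"
    unfolding eq
    by (simp add: square_integrable integrable_Re[OF integrable_product] integral_Re[OF integrable_product] expectation_product expectation_norm_square cov_increment_def
        del: times_complex.sel)
qed

text \<open>The finite sum is the norm of the process \<open>u \<mapsto> \<gamma> (r u)\<close> cut off outside \<open>D\<close>, where \<open>r\<close> takes finitely
many values. The bound depends on the process only through \<open>R\<close>.\<close>

lemma discretization_error: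
  fixes \<mu> :: "'u measure"
  assumes \<mu>: "sigma_finite_measure \<mu>" and sets[measurable_cong]: "sets \<mu> = sets borel"
    and fin: "(\<integral>\<^sup>+u. ennreal (Re (R u u)) \<partial>\<mu>) < \<infinity>" and R1: "\<And>u v. cmod (R u v) \<le> 1"
    and D[measurable]: "D \<in> sets borel" and finD: "emeasure \<mu> D < \<infinity>" and r: "simple_function \<mu> r" and e: "e > 0"
  shows "(\<integral>\<^sup>+\<omega>. ennreal \<bar>(LINT u|\<mu>. (cmod (\<gamma> u \<omega>))\<^sup>2) - (\<Sum>v\<in>range r. measure \<mu> (D \<inter> r -` {v}) * (cmod (\<gamma> v \<omega>))\<^sup>2)\<bar> \<partial>P) \<le>
     (\<integral>\<^sup>+u. ennreal ((1 + 1 / e) * cov_increment R u (r u) + e) * indicator D u + ennreal (Re (R u u)) * indicator (- D) u \<partial>\<mu>)"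
proof -
  interpret \<mu>: sigma_finite_measure \<mu> by fact
  interpret pair_sigma_finite P \<mu> ..
  have space[simp]: "space \<mu> = UNIV" using sets_eq_imp_space_eq[OF sets] by simp
  have rm[measurable]: "r \<in> borel_measurable \<mu>" using r by (rule borel_measurable_simple_function)
  have rm'[measurable]: "r \<in> borel_measurable borel" using rm by (simp add: measurable_cong_sets[OF sets refl])
  have finr: "finite (range r)" using r by (simp add: simple_function_def)
  have R1': "Re (R u u) \<le> 1" for u using R1[of u u] complex_Re_le_cmod order_trans by blast
  define f where "f = (\<lambda>z. \<gamma> (snd z) (fst z))"
  define g where "g = (\<lambda>z. indicator D (snd z) * \<gamma> (r (snd z)) (fst z))"
  have [measurable]: "f \<in> borel_measurable (P \<Otimes>\<^sub>M \<mu>)" unfolding f_def by measurable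
  have "(\<lambda>z. (fst z, r (snd z))) \<in> P \<Otimes>\<^sub>M \<mu> \<rightarrow>\<^sub>M P \<Otimes>\<^sub>M borel" by measurable
  from measurable_compose[OF this joint_measurable]
  have [measurable]: "(\<lambda>z. \<gamma> (r (snd z)) (fst z)) \<in> borel_measurable (P \<Otimes>\<^sub>M \<mu>)" by simp
  have [measurable]: "g \<in> borel_measurable (P \<Otimes>\<^sub>M \<mu>)" unfolding g_def by measurable
  have ind2: "(cmod (indicator D u * z))\<^sup>2 = indicator D u * (cmod z)\<^sup>2" for u z
    by (auto simp: indicator_def)
  have gsum: "(LINT u|\<mu>. (cmod (g (\<omega>, u)))\<^sup>2) = (\<Sum>v\<in>range r. measure \<mu> (D \<inter> r -` {v}) * (cmod (\<gamma> v \<omega>))\<^sup>2)" for \<omega>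
  proof -
    have sv: "D \<inter> r -` {v} \<in> sets \<mu>" for v using rm' by (auto simp: sets intro!: sets.Int measurable_sets_borel)
    have fv: "emeasure \<mu> (D \<inter> r -` {v}) < \<infinity>" for v
      using emeasure_mono[of "D \<inter> r -` {v}" D \<mu>] finD by (auto simp: sets)
    have "(LINT u|\<mu>. (cmod (g (\<omega>, u)))\<^sup>2) = (LINT u|\<mu>. (\<Sum>v\<in>range r. indicator (D \<inter> r -` {v}) u * (cmod (\<gamma> v \<omega>))\<^sup>2))"
    proof (rule Bochner_Integration.integral_cong[OF refl])
      fix u
      have "(\<Sum>v\<in>range r. indicator (D \<inter> r -` {v}) u * (cmod (\<gamma> v \<omega>))\<^sup>2) = (\<Sum>v\<in>{r u}. indicator (D \<inter> r -` {v}) u * (cmod (\<gamma> v \<omega>))\<^sup>2)"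
        by (rule sum.mono_neutral_right) (auto simp: finr)
      then show "(cmod (g (\<omega>, u)))\<^sup>2 = (\<Sum>v\<in>range r. indicator (D \<inter> r -` {v}) u * (cmod (\<gamma> v \<omega>))\<^sup>2)"
        by (simp add: g_def ind2 indicator_def)
    qed
    also have "\<dots> = (\<Sum>v\<in>range r. measure \<mu> (D \<inter> r -` {v}) * (cmod (\<gamma> v \<omega>))\<^sup>2)"
      using sv fv by (subst Bochner_Integration.integral_sum) (auto simp: integrable_indicator_iff)
    finally show ?thesis .
  qed
  have ff: "(\<integral>\<^sup>+u. \<integral>\<^sup>+\<omega>. ennreal ((cmod (f (\<omega>, u)))\<^sup>2) \<partial>P \<partial>\<mu>) < \<infinity>"
    using fin by (simp add: f_def nn_integral_norm_square)
  have "(\<integral>\<^sup>+u. \<integral>\<^sup>+\<omega>. ennreal ((cmod (g (\<omega>, u)))\<^sup>2) \<partial>P \<partial>\<mu>) \<le> (\<integral>\<^sup>+u. indicator D u \<partial>\<mu>)"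
  proof (rule nn_integral_mono)
    fix u
    show "(\<integral>\<^sup>+\<omega>. ennreal ((cmod (g (\<omega>, u)))\<^sup>2) \<partial>P) \<le> indicator D u"
      using nn_integral_norm_square[of "r u"] R1'[of "r u"] by (cases "u \<in> D") (auto simp: g_def)
  qed
  also have "\<dots> < \<infinity>" using finD by (simp add: sets)
  finally have gg: "(\<integral>\<^sup>+u. \<integral>\<^sup>+\<omega>. ennreal ((cmod (g (\<omega>, u)))\<^sup>2) \<partial>P \<partial>\<mu>) < \<infinity>" .
  have "(\<integral>\<^sup>+\<omega>. ennreal \<bar>(LINT u|\<mu>. (cmod (f (\<omega>, u)))\<^sup>2) - (LINT u|\<mu>. (cmod (g (\<omega>, u)))\<^sup>2)\<bar> \<partial>P) \<le>
      (\<integral>\<^sup>+u. \<integral>\<^sup>+\<omega>. ennreal \<bar>(cmod (f (\<omega>, u)))\<^sup>2 - (cmod (g (\<omega>, u)))\<^sup>2\<bar> \<partial>P \<partial>\<mu>)"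
    by (rule nn_integral_square_norm_diff_le[OF _ _ ff gg]) measurable
  also have "\<dots> \<le> (\<integral>\<^sup>+u. ennreal ((1 + 1 / e) * cov_increment R u (r u) + e) * indicator D u + ennreal (Re (R u u)) * indicator (- D) u \<partial>\<mu>)"
  proof (rule nn_integral_mono)
    fix u
    show "(\<integral>\<^sup>+\<omega>. ennreal \<bar>(cmod (f (\<omega>, u)))\<^sup>2 - (cmod (g (\<omega>, u)))\<^sup>2\<bar> \<partial>P) \<le>
       ennreal ((1 + 1 / e) * cov_increment R u (r u) + e) * indicator D u + ennreal (Re (R u u)) * indicator (- D) u"
    proof (cases "u \<in> D")
      case True
      have "(\<integral>\<^sup>+\<omega>. ennreal \<bar>(cmod (f (\<omega>, u)))\<^sup>2 - (cmod (g (\<omega>, u)))\<^sup>2\<bar> \<partial>P) \<le>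
        (\<integral>\<^sup>+\<omega>. ennreal ((1 + 1 / e) * (cmod (\<gamma> u \<omega> - \<gamma> (r u) \<omega>))\<^sup>2 + e * (cmod (\<gamma> (r u) \<omega>))\<^sup>2) \<partial>P)"
        using True e by (intro nn_integral_mono ennreal_leI) (simp add: f_def g_def abs_square_diff_le)
      also have "\<dots> = ennreal ((1 + 1 / e) * cov_increment R u (r u) + e * Re (R (r u) (r u)))"
        using e by (subst nn_integral_eq_integral) (auto simp: integrable_increment square_integrable expectation_increment expectation_norm_square)
      also have "\<dots> \<le> ennreal ((1 + 1 / e) * cov_increment R u (r u) + e)"
        using e R1'[of "r u"] by (intro ennreal_leI add_left_mono) simp
      finally show ?thesis using True by simp
    next
      case False
      then show ?thesis by (simp add: f_def g_def nn_integral_norm_square)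
    qed
  qed
  finally show ?thesis unfolding gsum by (simp add: f_def)
qed

end

text \<open>The parameters are chosen in the order \<open>D\<close>, \<open>e\<close>, \<open>r\<close>: a set \<open>D\<close> of finite measure outside of which the
integral of \<open>R u u\<close> is small, then \<open>e\<close> small compared with the measure of \<open>D\<close>, and finally a simple function
\<open>r\<close> close to the identity. Measurability of the identity provides simple functions that converge to it
pointwise, and with continuity of \<open>R\<close> dominated convergence applies on \<open>D\<close>.\<close>

lemma discretization_exists:
  fixes \<mu> :: "'u::euclidean_space measure" and R :: "'u \<Rightarrow> 'u \<Rightarrow> complex"
  assumes \<mu>: "sigma_finite_measure \<mu>" and sets[measurable_cong]: "sets \<mu> = sets borel"
    and fin: "(\<integral>\<^sup>+u. ennreal (Re (R u u)) \<partial>\<mu>) < \<infinity>" and R1: "\<And>u v. cmod (R u v) \<le> 1"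
    and cont: "continuous_on UNIV (\<lambda>(u, v). R u v)" and d: "d > 0"
  obtains D r e where "D \<in> sets borel" "emeasure \<mu> D < \<infinity>" "simple_function \<mu> r" "e > 0"
    "(\<integral>\<^sup>+u. ennreal ((1 + 1 / e) * cov_increment R u (r u) + e) * indicator D u + ennreal (Re (R u u)) * indicator (- D) u \<partial>\<mu>) \<le> ennreal d"
proof -
  interpret \<mu>: sigma_finite_measure \<mu> by fact
  have space[simp]: "space \<mu> = UNIV" using sets_eq_imp_space_eq[OF sets] by simp
  have Rc: "continuous_on UNIV (\<lambda>u. R (f u) (g u))" if "continuous_on UNIV f" "continuous_on UNIV g" for f g :: "'u \<times> 'u \<Rightarrow> 'u"
    using continuous_on_compose2[OF cont, of UNIV "\<lambda>u. (f u, g u)"] that by (auto intro!: continuous_on_Pair)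
  have Rc': "continuous_on UNIV (\<lambda>u. R u u)"
    using continuous_on_compose2[OF cont, of UNIV "\<lambda>u. (u, u)"]
    by (simp add: continuous_on_Pair continuous_on_id)
  have diag[measurable]: "(\<lambda>u. R u u) \<in> borel_measurable borel"
    by (rule borel_measurable_continuous_onI[OF Rc'])
  have inc_cont: "continuous_on UNIV (\<lambda>(u, v). cov_increment R u v)"
    unfolding cov_increment_def split_def by (intro continuous_intros Rc)
  have inc_meas: "(\<lambda>u. cov_increment R u (r u)) \<in> borel_measurable borel" if "r \<in> borel_measurable borel" for r :: "'u \<Rightarrow> 'u"
  proof -
    have "(\<lambda>u. (u, r u)) \<in> borel_measurable borel"
      unfolding borel_prod[symmetric] using that by measurable
    from measurable_compose[OF this borel_measurable_continuous_onI[OF inc_cont]] show ?thesis by simp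
  qed
  have inc4: "cov_increment R u v \<le> 4" for u v
    using R1[of u u] R1[of v v] R1[of u v] R1[of v u] abs_Re_le_cmod[of "R u u"] abs_Re_le_cmod[of "R v v"]
      abs_Re_le_cmod[of "R u v"] abs_Re_le_cmod[of "R v u"]
    unfolding cov_increment_def by linarith
  obtain A :: "nat \<Rightarrow> 'u set" where A: "range A \<subseteq> sets \<mu>" "(\<Union>i. A i) = space \<mu>" "\<And>i. emeasure \<mu> (A i) \<noteq> \<infinity>" "incseq A"
    using \<mu>.sigma_finite_incseq by blast
  have [measurable]: "A i \<in> sets borel" for i using A(1) by (auto simp: sets)
  \<comment> \<open>the part of the norm outside \<open>A i\<close> is small for large \<open>i\<close>\<close>
  have "(\<lambda>i. \<integral>\<^sup>+u. ennreal (Re (R u u)) * indicator (- A i) u \<partial>\<mu>) \<longlonglongrightarrow> (\<integral>\<^sup>+u. 0 \<partial>\<mu>)"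
  proof (rule nn_integral_dominated_convergence[where w = "\<lambda>u. ennreal (Re (R u u))"])
    show "AE u in \<mu>. (\<lambda>i. ennreal (Re (R u u)) * indicator (- A i) u) \<longlonglongrightarrow> 0"
    proof (rule AE_I2)
      fix u
      obtain i where "u \<in> A i" using A(2) by auto
      then have "\<forall>j\<ge>i. ennreal (Re (R u u)) * indicator (- A j) u = 0"
        using A(4) by (auto simp: incseq_def indicator_def)
      then show "(\<lambda>i. ennreal (Re (R u u)) * indicator (- A i) u) \<longlonglongrightarrow> 0"
        by (intro tendsto_eventually) (auto simp: eventually_sequentially)
    qed
  qed (use fin in \<open>auto simp: indicator_def\<close>)
  then have "\<forall>\<^sub>F i in sequentially. (\<integral>\<^sup>+u. ennreal (Re (R u u)) * indicator (- A i) u \<partial>\<mu>) < ennreal (d / 3)"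
    using d by (intro order_tendstoD(2)[where y = 0]) auto
  then obtain i where i: "(\<integral>\<^sup>+u. ennreal (Re (R u u)) * indicator (- A i) u \<partial>\<mu>) < ennreal (d / 3)"
    by (auto simp: eventually_sequentially)
  define D where "D = A i"
  have D[measurable]: "D \<in> sets borel" and finD: "emeasure \<mu> D < \<infinity>"
    using A(3)[of i] by (auto simp: D_def less_top)
  define e where "e = d / (3 * (measure \<mu> D + 1))"
  have e: "e > 0" using d by (simp add: e_def add_nonneg_pos)
  have eD: "e * measure \<mu> D \<le> d / 3"
    using d by (simp add: e_def divide_simps add_nonneg_pos) 
  define c where "c = 1 + 1 / e"
  have c: "c > 0" using e by (simp add: c_def add_pos_pos)
  obtain F :: "nat \<Rightarrow> 'u \<Rightarrow> 'u" where F: "\<And>k. simple_function \<mu> (F k)" "\<And>u. (\<lambda>k. F k u) \<longlonglongrightarrow> u"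
    using borel_measurable_implies_sequence_metric[of "\<lambda>u. u" \<mu> 0] by (auto simp: measurable_cong_sets[OF sets refl])
  have Fm: "F k \<in> borel_measurable borel" for k
    using borel_measurable_simple_function[OF F(1)] by (simp add: measurable_cong_sets[OF sets refl])
  note [measurable] = inc_meas[OF Fm]
  have "(\<lambda>k. \<integral>\<^sup>+u. ennreal (c * cov_increment R u (F k u)) * indicator D u \<partial>\<mu>) \<longlonglongrightarrow> (\<integral>\<^sup>+u. 0 \<partial>\<mu>)"
  proof (rule nn_integral_dominated_convergence[where w = "\<lambda>u. ennreal (c * 4) * indicator D u"])
    show "(\<integral>\<^sup>+u. ennreal (c * 4) * indicator D u \<partial>\<mu>) < \<infinity>"
      using finD by (simp add: nn_integral_cmult_indicator ennreal_mult_less_top sets)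
    show "AE u in \<mu>. ennreal (c * cov_increment R u (F k u)) * indicator D u \<le> ennreal (c * 4) * indicator D u" for k
      using inc4 c by (auto intro!: AE_I2 mult_right_mono ennreal_leI)
    show "AE u in \<mu>. (\<lambda>k. ennreal (c * cov_increment R u (F k u)) * indicator D u) \<longlonglongrightarrow> 0"
    proof (rule AE_I2)
      fix u
      have "(\<lambda>k. (case (u, F k u) of (u, v) \<Rightarrow> cov_increment R u v)) \<longlonglongrightarrow> (case (u, u) of (u, v) \<Rightarrow> cov_increment R u v)"
        using F(2)[of u] by (intro continuous_on_tendsto_compose[OF inc_cont]) (auto intro!: tendsto_intros)
      then have "(\<lambda>k. cov_increment R u (F k u)) \<longlonglongrightarrow> 0" by (simp add: cov_increment_def)
      then have "(\<lambda>k. ennreal (c * cov_increment R u (F k u))) \<longlonglongrightarrow> ennreal (c * 0)"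
        by (intro tendsto_ennrealI tendsto_intros)
      then show "(\<lambda>k. ennreal (c * cov_increment R u (F k u)) * indicator D u) \<longlonglongrightarrow> 0"
        by (cases "u \<in> D") auto
    qed
  qed auto
  then have "\<forall>\<^sub>F k in sequentially. (\<integral>\<^sup>+u. ennreal (c * cov_increment R u (F k u)) * indicator D u \<partial>\<mu>) < ennreal (d / 3)"
    using d by (intro order_tendstoD(2)[where y = 0]) auto
  then obtain k where k: "(\<integral>\<^sup>+u. ennreal (c * cov_increment R u (F k u)) * indicator D u \<partial>\<mu>) < ennreal (d / 3)"
    by (auto simp: eventually_sequentially)
  have "(\<integral>\<^sup>+u. ennreal (c * cov_increment R u (F k u) + e) * indicator D u + ennreal (Re (R u u)) * indicator (- D) u \<partial>\<mu>) \<le>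
     (\<integral>\<^sup>+u. ennreal (c * cov_increment R u (F k u)) * indicator D u + (ennreal e * indicator D u + ennreal (Re (R u u)) * indicator (- D) u) \<partial>\<mu>)"
  proof (rule nn_integral_mono)
    fix u
    have "ennreal (c * cov_increment R u (F k u) + e) \<le> ennreal (c * cov_increment R u (F k u)) + ennreal e"
    proof (cases "c * cov_increment R u (F k u) \<ge> 0")
      case True
      then show ?thesis using e by (simp add: ennreal_plus)
    next
      case False
      then have "ennreal (c * cov_increment R u (F k u) + e) \<le> ennreal e" by (intro ennreal_leI) simp
      then show ?thesis by (simp add: add_increasing)
    qed
    then show "ennreal (c * cov_increment R u (F k u) + e) * indicator D u + ennreal (Re (R u u)) * indicator (- D) u \<le>
       ennreal (c * cov_increment R u (F k u)) * indicator D u + (ennreal e * indicator D u + ennreal (Re (R u u)) * indicator (- D) u)"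
      by (auto simp: indicator_def)
  qed
  also have "\<dots> = (\<integral>\<^sup>+u. ennreal (c * cov_increment R u (F k u)) * indicator D u \<partial>\<mu>) +
      ((\<integral>\<^sup>+u. ennreal e * indicator D u \<partial>\<mu>) + (\<integral>\<^sup>+u. ennreal (Re (R u u)) * indicator (- D) u \<partial>\<mu>))"
    by (subst nn_integral_add, measurable)+
  also have "(\<integral>\<^sup>+u. ennreal e * indicator D u \<partial>\<mu>) = ennreal (e * measure \<mu> D)"
    using e finD by (simp add: nn_integral_cmult_indicator sets emeasure_eq_ennreal_measure ennreal_mult less_top)
  also have "(\<integral>\<^sup>+u. ennreal (c * cov_increment R u (F k u)) * indicator D u \<partial>\<mu>) +
      (ennreal (e * measure \<mu> D) + (\<integral>\<^sup>+u. ennreal (Re (R u u)) * indicator (- D) u \<partial>\<mu>)) \<le> ennreal (d / 3) + (ennreal (d / 3) + ennreal (d / 3))"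
    by (intro add_mono less_imp_le[OF k] ennreal_leI[OF eD] less_imp_le[OF i[folded D_def]])
  also have "\<dots> = ennreal d"
    using d by (simp flip: ennreal_plus)
  finally show ?thesis
    using that[OF D finD F(1)[of k] e] by (simp add: c_def)
qed

section \<open>Linear functionals: Gaussian laws and the central limit theorem\<close>

text \<open>For a process with \<open>\<gamma> (- v) = cnj (\<gamma> v)\<close> the numbers \<open>R u v\<close> and \<open>R u (- v)\<close> are the expectations of
\<open>\<gamma> u * cnj (\<gamma> v)\<close> and \<open>\<gamma> u * \<gamma> v\<close>. Together they determine all second moments of real and imaginary parts,
hence the variance of a real linear functional with coefficients \<open>a\<close>, \<open>b\<close>.\<close>

definition linear_functional_variance ::
    "('u::uminus \<Rightarrow> 'u \<Rightarrow> complex) \<Rightarrow> 'u set \<Rightarrow> ('u \<Rightarrow> real) \<Rightarrow> ('u \<Rightarrow> real) \<Rightarrow> real" where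
  "linear_functional_variance R U a b = (\<Sum>u\<in>U. \<Sum>v\<in>U.
     (a u * a v * (Re (R u v) + Re (R u (- v))) + a u * b v * (Im (R u (- v)) - Im (R u v)) +
      b u * a v * (Im (R u (- v)) + Im (R u v)) + b u * b v * (Re (R u v) - Re (R u (- v)))) / 2)"

lemma (in second_order_process) expectation_linear_functional_square:
  assumes herm: "hermitian_process P \<gamma>" and U: "finite U"
  shows "(LINT \<omega>|P. (\<Sum>u\<in>U. a u * Re (\<gamma> u \<omega>) + b u * Im (\<gamma> u \<omega>))\<^sup>2) = linear_functional_variance R U a b"
proof -
  define p where "p u v \<omega> = \<gamma> u \<omega> * cnj (\<gamma> v \<omega>)" for u v \<omega>
  have p: "integrable P (p u v)" "(CLINT \<omega>|P. p u v \<omega>) = R u v" for u v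
    unfolding p_def by (rule integrable_product, rule expectation_product)
  define q where "q u v \<omega> = (a u * a v * (Re (p u v \<omega>) + Re (p u (- v) \<omega>)) + a u * b v * (Im (p u (- v) \<omega>) - Im (p u v \<omega>)) +
      b u * a v * (Im (p u (- v) \<omega>) + Im (p u v \<omega>)) + b u * b v * (Re (p u v \<omega>) - Re (p u (- v) \<omega>))) / 2" for u v \<omega>
  have q: "has_bochner_integral P (q u v) ((a u * a v * (Re (R u v) + Re (R u (- v))) + a u * b v * (Im (R u (- v)) - Im (R u v)) +
      b u * a v * (Im (R u (- v)) + Im (R u v)) + b u * b v * (Re (R u v) - Re (R u (- v)))) / 2)" for u v
  proof -
    have re: "has_bochner_integral P (\<lambda>\<omega>. Re (p u v \<omega>)) (Re (R u v))" and im: "has_bochner_integral P (\<lambda>\<omega>. Im (p u v \<omega>)) (Im (R u v))" for u v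
      using integrable_Re[OF p(1)] integral_Re[OF p(1)] integrable_Im[OF p(1)] integral_Im[OF p(1)]
      by (simp_all add: has_bochner_integral_iff p(2))
    show ?thesis
      unfolding q_def
      by (intro has_bochner_integral_divide_zero has_bochner_integral_add has_bochner_integral_diff has_bochner_integral_mult_right re im)
  qed
  have [measurable]: "q u v \<in> borel_measurable P" for u v
    using q by (auto simp: has_bochner_integral_iff)
  have "AE \<omega> in P. \<forall>v\<in>U. \<gamma> (- v) \<omega> = cnj (\<gamma> v \<omega>)"
    using herm U by (intro AE_finite_allI) (auto simp: hermitian_process_def)
  then have "AE \<omega> in P. (\<Sum>u\<in>U. a u * Re (\<gamma> u \<omega>) + b u * Im (\<gamma> u \<omega>))\<^sup>2 = (\<Sum>u\<in>U. \<Sum>v\<in>U. q u v \<omega>)"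
  proof eventually_elim
    case (elim \<omega>)
    have "(\<Sum>u\<in>U. a u * Re (\<gamma> u \<omega>) + b u * Im (\<gamma> u \<omega>))\<^sup>2 =
      (\<Sum>u\<in>U. \<Sum>v\<in>U. (a u * Re (\<gamma> u \<omega>) + b u * Im (\<gamma> u \<omega>)) * (a v * Re (\<gamma> v \<omega>) + b v * Im (\<gamma> v \<omega>)))"
      by (simp only: power2_eq_square sum_product)
    also have "\<dots> = (\<Sum>u\<in>U. \<Sum>v\<in>U. q u v \<omega>)"
      using elim by (intro sum.cong refl) (simp add: q_def p_def field_simps)
    finally show ?case .
  qed
  then have "(LINT \<omega>|P. (\<Sum>u\<in>U. a u * Re (\<gamma> u \<omega>) + b u * Im (\<gamma> u \<omega>))\<^sup>2) = (LINT \<omega>|P. (\<Sum>u\<in>U. \<Sum>v\<in>U. q u v \<omega>))"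
    by (intro integral_cong_AE) auto
  also have "\<dots> = linear_functional_variance R U a b"
    unfolding linear_functional_variance_def
    by (intro has_bochner_integral_integral_eq has_bochner_integral_sum q)
  finally show ?thesis .
qed

lemma gaussian_rv_moment_and_char:
  assumes P: "prob_space P" and Z: "gaussian_rv P Z"
  shows gaussian_rv_square_integrable: "integrable P (\<lambda>\<omega>. (Z \<omega>)\<^sup>2)"
    and gaussian_rv_char: "(LINT \<omega>|P. Z \<omega>) = 0 \<Longrightarrow> (CLINT \<omega>|P. iexp (Z \<omega>)) = exp (- ((LINT \<omega>|P. (Z \<omega>)\<^sup>2) / 2))"
proof -
  interpret prob_space P by fact
  have [measurable]: "Z \<in> borel_measurable P" using Z by (simp add: gaussian_rv_def)
  have "integrable P (\<lambda>\<omega>. (Z \<omega>)\<^sup>2) \<and>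
    ((LINT \<omega>|P. Z \<omega>) = 0 \<longrightarrow> (CLINT \<omega>|P. iexp (Z \<omega>)) = exp (- ((LINT \<omega>|P. (Z \<omega>)\<^sup>2) / 2)))"
    using Z unfolding gaussian_rv_def
  proof (elim conjE disjE exE)
    fix m assume d: "distr P borel Z = return borel m"
    have i: "integrable P (\<lambda>\<omega>. f (Z \<omega>))" and e: "(LINT \<omega>|P. f (Z \<omega>)) = f m" if [measurable]: "f \<in> borel_measurable borel" for f :: "real \<Rightarrow> real"
    proof -
      have "integrable (return borel m) f"
        by (rule integrableI_bounded) (auto simp: nn_integral_return)
      then show "integrable P (\<lambda>\<omega>. f (Z \<omega>))" unfolding d[symmetric] by (simp add: integrable_distr_eq)
      show "(LINT \<omega>|P. f (Z \<omega>)) = f m"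
        using integral_distr[of Z P borel f] by (simp add: d integral_return)
    qed
    have "(CLINT \<omega>|P. iexp (Z \<omega>)) = iexp m"
      using integral_distr[of Z P borel iexp] by (simp add: d integral_return)
    then show ?thesis using e[of "\<lambda>x. x"] i[of "\<lambda>x. x\<^sup>2"] e[of "\<lambda>x. x\<^sup>2"] by auto
  next
    fix m \<sigma> :: real assume \<sigma>: "\<sigma> > 0" and D: "distributed P lborel Z (\<lambda>x. ennreal (normal_density m \<sigma> x))"
    have D': "distributed P lborel (\<lambda>\<omega>. (Z \<omega> - m) / \<sigma>) std_normal_density"
      using normal_standard_normal_convert[OF \<sigma>] D by simp
    define S where "S \<omega> = (Z \<omega> - m) / \<sigma>" for \<omega>
    have [measurable]: "S \<in> borel_measurable P" unfolding S_def by measurable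
    have dS: "distr P borel S = std_normal_distribution"
      using distributed_distr_eq_density[OF D'] by (simp add: S_def[abs_def] cong: distr_cong)
    have ZS: "Z \<omega> = m + \<sigma> * S \<omega>" for \<omega> using \<sigma> by (simp add: S_def)
    have iS: "integrable P (\<lambda>\<omega>. S \<omega> ^ k)" for k
      using integrable_std_normal_distribution_moment[of k] unfolding dS[symmetric] by (simp add: integrable_distr_eq)
    have iZ2: "integrable P (\<lambda>\<omega>. (Z \<omega>)\<^sup>2)" unfolding ZS power2_sum using iS[of 1] iS[of 2] by (simp add: power_mult_distrib)
    have ch: "(CLINT \<omega>|P. iexp (Z \<omega>)) = exp (- ((LINT \<omega>|P. (Z \<omega>)\<^sup>2) / 2))" if "(LINT \<omega>|P. Z \<omega>) = 0"
    proof -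
      have m: "m = 0" using normal_distributed_expectation[OF \<sigma> D] that by simp
      have v: "(LINT \<omega>|P. (Z \<omega>)\<^sup>2) = \<sigma>\<^sup>2" using normal_distributed_variance[OF \<sigma> D] that by simp
      have "(CLINT \<omega>|P. iexp (Z \<omega>)) = char (distr P borel S) \<sigma>"
        unfolding char_def by (subst integral_distr) (auto simp: ZS m)
      then show ?thesis by (simp add: dS char_std_normal_distribution v)
    qed
    show ?thesis using iZ2 ch by simp
  qed
  then show "integrable P (\<lambda>\<omega>. (Z \<omega>)\<^sup>2)"
    "(LINT \<omega>|P. Z \<omega>) = 0 \<Longrightarrow> (CLINT \<omega>|P. iexp (Z \<omega>)) = exp (- ((LINT \<omega>|P. (Z \<omega>)\<^sup>2) / 2))" by auto
qed

text \<open>The sample may change with \<open>n\<close>, so the sums need not come from one sequence. Boundedness gives an error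
of order \<open>n\<^bsup>-3/2\<^esup>\<close> in the second-order expansion of the characteristic function of one summand.\<close>

lemma (in prob_space) CLT_triangular_array_char:
  fixes Z :: "nat \<Rightarrow> nat \<Rightarrow> 'a \<Rightarrow> real" and Y :: "'a \<Rightarrow> real"
  assumes indep: "\<And>n. indep_vars (\<lambda>_. borel) (Z n) {1..n}"
    and distr: "\<And>n k. k \<in> {1..n} \<Longrightarrow> distr M borel (Z n k) = distr M borel Y"
    and Y[measurable]: "Y \<in> borel_measurable M" and bound: "\<And>\<omega>. \<bar>Y \<omega>\<bar> \<le> C" and mean: "expectation Y = 0"
  shows "(\<lambda>n. CLINT \<omega>|M. iexp ((\<Sum>k=1..n. Z n k \<omega>) / sqrt (real n))) \<longlonglongrightarrow> exp (- (expectation (\<lambda>\<omega>. (Y \<omega>)\<^sup>2) / 2))"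
proof -
  define v where "v = expectation (\<lambda>\<omega>. (Y \<omega>)\<^sup>2)"
  define \<phi> where "\<phi> = char (distr M borel Y)"
  have v0: "v \<ge> 0" unfolding v_def by simp
  have C: "C \<ge> 0" using bound[of undefined] abs_ge_zero order_trans by blast
  have iY: "integrable M (\<lambda>\<omega>. Y \<omega> ^ k)" for k
    using bound by (intro integrable_const_bound[of _ "C ^ k"]) (auto simp: power_abs power_mono)
  have eq: "(CLINT \<omega>|M. iexp ((\<Sum>k=1..n. Z n k \<omega>) / sqrt (real n))) = \<phi> (1 / sqrt (real n)) ^ n" for n
  proof -
    have [measurable]: "Z n k \<in> borel_measurable M" if "k \<in> {1..n}" for k
      using indep[of n] that by (auto simp: indep_vars_def)
    have "(CLINT \<omega>|M. iexp ((\<Sum>k=1..n. Z n k \<omega>) / sqrt (real n))) = char (distr M borel (\<lambda>\<omega>. \<Sum>k\<in>{1..n}. Z n k \<omega>)) (1 / sqrt (real n))"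
      unfolding char_def by (subst integral_distr) auto
    also have "\<dots> = (\<Prod>k\<in>{1..n}. \<phi> (1 / sqrt (real n)))"
      unfolding char_distr_sum[OF indep] \<phi>_def using distr by (intro prod.cong) auto
    finally show ?thesis by simp
  qed
  interpret d: real_distribution "distr M borel Y" by (rule real_distribution_distr) simp
  have ev: "\<forall>\<^sub>F n in sequentially. cmod (\<phi> (1 / sqrt (real n)) ^ n - (1 + (- (v / 2)) / real n) ^ n) \<le> C ^ 3 / 6 * (1 / sqrt (real n))"
  proof (rule eventually_sequentiallyI)
    fix n assume n: "n \<ge> nat \<lceil>v\<rceil> + 1"
    then have n0: "real n > 0" and nv: "v \<le> real n" by linarith+
    let ?t = "1 / sqrt (real n)"
    have t2: "?t\<^sup>2 = 1 / real n" using n0 by (simp add: power_divide)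
    have "cmod (\<phi> ?t - (1 - ?t\<^sup>2 * v / 2)) \<le> ?t\<^sup>2 / 6 * expectation (\<lambda>x. min (6 * (Y x)\<^sup>2) (\<bar>?t\<bar> * \<bar>Y x\<bar> ^ 3))"
      using iY[of 1] iY[of 2] mean unfolding \<phi>_def by (intro char_approx3') (auto simp: v_def)
    also have "\<dots> \<le> ?t\<^sup>2 / 6 * (?t * C ^ 3)"
    proof (rule mult_left_mono)
      have "expectation (\<lambda>x. min (6 * (Y x)\<^sup>2) (\<bar>?t\<bar> * \<bar>Y x\<bar> ^ 3)) \<le> expectation (\<lambda>x. ?t * C ^ 3)"
      proof (rule integral_mono)
        have le: "min (6 * (Y x)\<^sup>2) (\<bar>?t\<bar> * \<bar>Y x\<bar> ^ 3) \<le> ?t * C ^ 3" for x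
          using bound[of x] by (intro min.coboundedI2 mult_mono power_mono) auto
        then show "min (6 * (Y x)\<^sup>2) (\<bar>?t\<bar> * \<bar>Y x\<bar> ^ 3) \<le> ?t * C ^ 3" for x .
        show "integrable M (\<lambda>x. min (6 * (Y x)\<^sup>2) (\<bar>?t\<bar> * \<bar>Y x\<bar> ^ 3))"
          using le by (intro integrable_const_bound[of _ "?t * C ^ 3"]) (auto simp: abs_of_nonneg)
      qed simp
      then show "expectation (\<lambda>x. min (6 * (Y x)\<^sup>2) (\<bar>?t\<bar> * \<bar>Y x\<bar> ^ 3)) \<le> ?t * C ^ 3" by (simp add: prob_space)
    qed simp
    finally have 1: "cmod (\<phi> ?t - (1 + (- (v / 2)) / real n)) \<le> 1 / real n * (C ^ 3 / 6 * ?t)"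
      by (simp add: t2 field_simps)
    have "cmod (\<phi> ?t ^ n - complex_of_real (1 + (- (v / 2)) / real n) ^ n) \<le> n * cmod (\<phi> ?t - complex_of_real (1 + (- (v / 2)) / real n))"
    proof (rule norm_power_diff)
      show "cmod (\<phi> ?t) \<le> 1" unfolding \<phi>_def by (rule d.cmod_char_le_1)
      have "\<bar>1 + (- (v / 2)) / real n\<bar> \<le> 1" using n0 nv v0 by (intro abs_leI) (auto simp: field_simps)
      then show "cmod (complex_of_real (1 + (- (v / 2)) / real n)) \<le> 1" by (simp only: norm_of_real)
    qed
    also have "\<dots> \<le> n * (1 / real n * (C ^ 3 / 6 * ?t))"
      using 1 by (intro mult_left_mono) auto
    also have "\<dots> = C ^ 3 / 6 * ?t" using n0 by simp
    finally show "cmod (\<phi> ?t ^ n - (1 + (- (v / 2)) / real n) ^ n) \<le> C ^ 3 / 6 * ?t" by simp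
  qed
  have "(\<lambda>n. C ^ 3 / 6 * (1 / sqrt (real n))) \<longlonglongrightarrow> 0" by real_asymp
  then have "(\<lambda>n. \<phi> (1 / sqrt (real n)) ^ n - (1 + (- (v / 2)) / real n) ^ n) \<longlonglongrightarrow> 0"
    by (rule Lim_null_comparison[OF ev])
  moreover have "(\<lambda>n. complex_of_real ((1 + (- (v / 2)) / real n) ^ n)) \<longlonglongrightarrow> complex_of_real (exp (- (v / 2)))"
    by (intro tendsto_of_real tendsto_exp_limit_sequentially)
  ultimately have "(\<lambda>n. \<phi> (1 / sqrt (real n)) ^ n) \<longlonglongrightarrow> complex_of_real (exp (- (v / 2)))"
    using Lim_transform by fastforce
  then show ?thesis by (simp only: eq v_def)
qed

section \<open>The empirical process of a sample from an independent pair\<close>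

definition centered_iexp :: "'w measure \<Rightarrow> ('w \<Rightarrow> 'a::euclidean_space) \<Rightarrow> 'a \<Rightarrow> 'a \<Rightarrow> complex" where
  "centered_iexp M X t x = iexp (t \<bullet> x) - charfun M X t"

context prob_space
begin

lemma integrable_iexp_inner:
  fixes X :: "'a \<Rightarrow> 'b::euclidean_space"
  assumes [measurable]: "X \<in> borel_measurable M"
  shows "integrable M (\<lambda>\<omega>. iexp (t \<bullet> X \<omega>))"
  by (rule integrable_const_bound[of _ 1]) auto

lemma cmod_charfun_le: "cmod (charfun M X t) \<le> 1" for X :: "'a \<Rightarrow> 'b::euclidean_space"
proof -
  have "cmod (charfun M X t) \<le> (LINT \<omega>|M. cmod (iexp (t \<bullet> X \<omega>)))"
    unfolding charfun_def by (rule integral_norm_bound)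
  also have "\<dots> = (LINT \<omega>|M. 1)" by (simp only: norm_exp_i_times)
  finally show ?thesis by (simp add: prob_space)
qed

lemma charfun_uminus: "charfun M X (- t) = cnj (charfun M X t)" for X :: "'a \<Rightarrow> 'b::euclidean_space"
proof -
  have "cnj (charfun M X t) = (CLINT \<omega>|M. cnj (iexp (t \<bullet> X \<omega>)))"
    unfolding charfun_def by (rule Bochner_Integration.integral_cnj[symmetric])
  also have "\<dots> = charfun M X (- t)"
    unfolding charfun_def by (simp only: cnj_iexp inner_minus_left)
  finally show ?thesis ..
qed

lemma continuous_charfun:
  fixes X :: "'a \<Rightarrow> 'b::euclidean_space"
  assumes [measurable]: "X \<in> borel_measurable M"
  shows "continuous_on UNIV (charfun M X)"
proof (rule continuous_at_imp_continuous_on, rule ballI)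
  fix t
  show "isCont (charfun M X) t"
    unfolding continuous_at_sequentially
  proof safe
    fix s assume s: "s \<longlonglongrightarrow> t"
    show "(charfun M X \<circ> s) \<longlonglongrightarrow> charfun M X t"
      unfolding comp_def charfun_def
      by (rule integral_dominated_convergence[where w = "\<lambda>_. 1"]) (auto intro!: tendsto_intros s)
  qed
qed

lemma charfun_measurable:
  assumes "X \<in> borel_measurable M"
  shows "charfun M X \<in> borel_measurable borel"
  by (rule borel_measurable_continuous_onI[OF continuous_charfun[OF assms]])

lemma cmod_centered_iexp_le: "cmod (centered_iexp M X t x) \<le> 2" for X :: "'a \<Rightarrow> 'b::euclidean_space"
  unfolding centered_iexp_def using cmod_charfun_le[of X t] norm_triangle_ineq4[of "iexp (t \<bullet> x)" "charfun M X t"]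
  by (simp add: norm_exp_i_times)

lemma centered_iexp_uminus: "centered_iexp M X (- t) x = cnj (centered_iexp M X t x)" for X :: "'a \<Rightarrow> 'b::euclidean_space"
  by (simp add: centered_iexp_def charfun_uminus cnj_iexp)

lemma centered_iexp_measurable[measurable]: "centered_iexp M X t \<in> borel_measurable borel" for X :: "'a \<Rightarrow> 'b::euclidean_space"
  unfolding centered_iexp_def by measurable

lemma expectation_centered_iexp:
  fixes X :: "'a \<Rightarrow> 'b::euclidean_space"
  assumes X[measurable]: "X \<in> borel_measurable M"
  shows "(CLINT \<omega>|M. centered_iexp M X t (X \<omega>)) = 0"
  unfolding centered_iexp_def by (simp add: integrable_iexp_inner prob_space charfun_def)

lemma expectation_centered_iexp_product:
  fixes X :: "'a \<Rightarrow> 'b::euclidean_space"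
  assumes X[measurable]: "X \<in> borel_measurable M"
  shows "(CLINT \<omega>|M. centered_iexp M X t (X \<omega>) * cnj (centered_iexp M X t' (X \<omega>))) =
         charfun M X (t - t') - charfun M X t * cnj (charfun M X t')"
proof -
  let ?f = "charfun M X"
  have "centered_iexp M X t x * cnj (centered_iexp M X t' x) =
    iexp ((t - t') \<bullet> x) - iexp (t \<bullet> x) * cnj (?f t') - ?f t * iexp ((- t') \<bullet> x) + ?f t * cnj (?f t')" for x
  proof -
    have "iexp ((t - t') \<bullet> x) = iexp (t \<bullet> x) * iexp ((- t') \<bullet> x)"
      by (simp add: exp_add[symmetric] inner_diff_left algebra_simps)
    then show ?thesis by (simp add: centered_iexp_def cnj_iexp algebra_simps)
  qed
  moreover have "has_bochner_integral M (\<lambda>\<omega>. iexp ((t - t') \<bullet> X \<omega>) - iexp (t \<bullet> X \<omega>) * cnj (?f t') - ?f t * iexp ((- t') \<bullet> X \<omega>) + ?f t * cnj (?f t'))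
     (?f (t - t') - ?f t * cnj (?f t') - ?f t * ?f (- t') + ?f t * cnj (?f t'))"
  proof -
    have e: "has_bochner_integral M (\<lambda>\<omega>. iexp (s \<bullet> X \<omega>)) (?f s)" for s
      unfolding has_bochner_integral_iff using integrable_iexp_inner[OF X] by (simp add: charfun_def)
    have c: "has_bochner_integral M (\<lambda>_. z) z" for z :: complex
      by (simp add: has_bochner_integral_iff prob_space)
    show ?thesis
      by (intro has_bochner_integral_add has_bochner_integral_diff has_bochner_integral_mult_left has_bochner_integral_mult_right e c)
  qed
  ultimately show ?thesis
    by (simp only: has_bochner_integral_integral_eq charfun_uminus) simp
qed

text \<open>The left side is the covariance of two centered variables whose variances
\<open>1 - \<bar>f(t)\<bar>\<^sup>2\<close> are at most one.\<close>

lemma cmod_charfun_cov_le: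
  fixes X :: "'a \<Rightarrow> 'b::euclidean_space"
  assumes X[measurable]: "X \<in> borel_measurable M"
  shows "cmod (charfun M X (t - t') - charfun M X t * cnj (charfun M X t')) \<le> 1"
proof -
  let ?a = "\<lambda>t \<omega>. centered_iexp M X t (X \<omega>)"
  have sq: "(LINT \<omega>|M. (cmod (?a t \<omega>))\<^sup>2) \<le> 1" for t
  proof -
    have "complex_of_real (LINT \<omega>|M. (cmod (?a t \<omega>))\<^sup>2) = charfun M X 0 - charfun M X t * cnj (charfun M X t)"
      using expectation_centered_iexp_product[OF X, of t t] by (simp only: integral_complex_of_real[symmetric] complex_norm_square) simp
    also have "\<dots> = complex_of_real (1 - (cmod (charfun M X t))\<^sup>2)"
      by (simp only: complex_norm_square[symmetric] of_real_diff) (simp add: charfun_def prob_space)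
    finally show ?thesis by (simp only: of_real_eq_iff) simp
  qed
  have isq: "integrable M (\<lambda>\<omega>. (cmod (?a t \<omega>))\<^sup>2)" for t
    using power_mono[OF cmod_centered_iexp_le, of X t _ 2] by (intro integrable_const_bound[of _ 4]) auto
  have "cmod (charfun M X (t - t') - charfun M X t * cnj (charfun M X t')) \<le> (LINT \<omega>|M. cmod (?a t \<omega> * cnj (?a t' \<omega>)))"
    unfolding expectation_centered_iexp_product[OF X, symmetric] by (rule integral_norm_bound)
  also have "\<dots> \<le> (LINT \<omega>|M. ((cmod (?a t \<omega>))\<^sup>2 + (cmod (?a t' \<omega>))\<^sup>2) / 2)"
  proof (rule integral_mono)
    have *: "x * y \<le> (x\<^sup>2 + y\<^sup>2) / 2" for x y :: real using sum_squares_bound[of x y] by simp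
    then show "cmod (?a t \<omega> * cnj (?a t' \<omega>)) \<le> ((cmod (?a t \<omega>))\<^sup>2 + (cmod (?a t' \<omega>))\<^sup>2) / 2" for \<omega>
      by (simp add: norm_mult)
    have "cmod (?a t \<omega> * cnj (?a t' \<omega>)) \<le> 2 * 2" for \<omega>
      unfolding norm_mult complex_mod_cnj using cmod_centered_iexp_le by (intro mult_mono) auto
    then show "integrable M (\<lambda>\<omega>. cmod (?a t \<omega> * cnj (?a t' \<omega>)))"
      by (intro integrable_const_bound[of _ 4]) auto
  qed (use isq in auto)
  also have "\<dots> = ((LINT \<omega>|M. (cmod (?a t \<omega>))\<^sup>2) + (LINT \<omega>|M. (cmod (?a t' \<omega>))\<^sup>2)) / 2"
    using isq by simp
  also have "\<dots> \<le> 1" using sq[of t] sq[of t'] by simp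
  finally show ?thesis .
qed

text \<open>The integrand \<open>1 - \<bar>f\<bar>\<^sup>2\<close> is at most \<open>2 (1 - Re f)\<close>, and \<open>1 - Re f(t)\<close> is the expectation of
\<open>1 - cos (t \<bullet> X)\<close>; hence the integral is at most twice the expectation of \<open>norm X\<close>.\<close>

lemma nn_integral_charfun_variance:
  fixes X :: "'a \<Rightarrow> 'b::euclidean_space"
  assumes X[measurable]: "X \<in> borel_measurable M" and int: "integrable M (\<lambda>\<omega>. norm (X \<omega>))"
  shows "(\<integral>\<^sup>+t. ennreal (1 - (cmod (charfun M X t))\<^sup>2) \<partial>kernel_measure) < \<infinity>"
proof -
  interpret K: sigma_finite_measure "kernel_measure :: 'b measure" by (rule sigma_finite_kernel_measure)
  interpret pair_sigma_finite "kernel_measure :: 'b measure" M ..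
  have Re_f: "ennreal (1 - Re (charfun M X t)) = (\<integral>\<^sup>+\<omega>. ennreal (1 - cos (t \<bullet> X \<omega>)) \<partial>M)" for t
  proof -
    have c: "integrable M (\<lambda>\<omega>. cos (t \<bullet> X \<omega>))" by (rule integrable_const_bound[of _ 1]) auto
    have "Re (charfun M X t) = (LINT \<omega>|M. cos (t \<bullet> X \<omega>))"
      unfolding charfun_def using integral_Re[OF integrable_iexp_inner[OF X, of t]] by (simp add: Re_iexp)
    then have "1 - Re (charfun M X t) = (LINT \<omega>|M. 1 - cos (t \<bullet> X \<omega>))"
      using c by (simp add: prob_space)
    then show ?thesis using c by (simp add: nn_integral_eq_integral)
  qed
  have "(\<integral>\<^sup>+t. ennreal (1 - (cmod (charfun M X t))\<^sup>2) \<partial>kernel_measure) \<le> (\<integral>\<^sup>+t. 2 * ennreal (1 - Re (charfun M X t)) \<partial>kernel_measure)"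
  proof (rule nn_integral_mono)
    fix t
    let ?r = "Re (charfun M X t)"
    have r: "\<bar>?r\<bar> \<le> 1" using abs_Re_le_cmod[of "charfun M X t"] cmod_charfun_le[of X t] by linarith
    have "1 - (cmod (charfun M X t))\<^sup>2 \<le> 1 - ?r\<^sup>2" by (simp add: cmod_power2)
    also have "\<dots> = (1 - ?r) * (1 + ?r)" by (simp add: power2_eq_square algebra_simps)
    also have "\<dots> \<le> (1 - ?r) * 2" using r by (intro mult_left_mono) auto
    finally have "ennreal (1 - (cmod (charfun M X t))\<^sup>2) \<le> ennreal (2 * (1 - ?r))" by (intro ennreal_leI) simp
    then show "ennreal (1 - (cmod (charfun M X t))\<^sup>2) \<le> 2 * ennreal (1 - ?r)"
      using r by (subst (asm) ennreal_mult) auto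
  qed
  also have "\<dots> = 2 * (\<integral>\<^sup>+t. \<integral>\<^sup>+\<omega>. ennreal (1 - cos (t \<bullet> X \<omega>)) \<partial>M \<partial>kernel_measure)"
    unfolding Re_f by (rule nn_integral_cmult) measurable
  also have "(\<integral>\<^sup>+t. \<integral>\<^sup>+\<omega>. ennreal (1 - cos (t \<bullet> X \<omega>)) \<partial>M \<partial>kernel_measure) =
       (\<integral>\<^sup>+\<omega>. \<integral>\<^sup>+t. ennreal (1 - cos (t \<bullet> X \<omega>)) \<partial>kernel_measure \<partial>M)"
    by (rule Fubini'[symmetric]) measurable
  also have "\<dots> = (\<integral>\<^sup>+\<omega>. ennreal (norm (X \<omega>)) \<partial>M)"
    by (simp only: nn_integral_kernel_measure_one_minus_cos)
  also have "2 * \<dots> < \<infinity>"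
    using int by (simp add: nn_integral_eq_integral ennreal_mult_less_top)
  finally show ?thesis .
qed

text \<open>Independence makes the joint law the product of the marginal laws: the two measures agree on rectangles.\<close>

lemma indep_random_vectors_expectation_mult:
  fixes X :: "'a \<Rightarrow> 'b::euclidean_space" and Y :: "'a \<Rightarrow> 'c::euclidean_space" and f :: "'b \<Rightarrow> complex" and g :: "'c \<Rightarrow> complex"
  assumes XY: "indep_random_vectors M X Y"
    and f[measurable]: "f \<in> borel_measurable borel" and g[measurable]: "g \<in> borel_measurable borel"
    and bf: "\<And>x. cmod (f x) \<le> B" and bg: "\<And>y. cmod (g y) \<le> B"
  shows "(CLINT \<omega>|M. f (X \<omega>) * g (Y \<omega>)) = (CLINT \<omega>|M. f (X \<omega>)) * (CLINT \<omega>|M. g (Y \<omega>))"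
proof -
  have X[measurable]: "X \<in> borel_measurable M" and Y[measurable]: "Y \<in> borel_measurable M"
    and ind: "indep_set {X -` A \<inter> space M | A. A \<in> sets borel} {Y -` B \<inter> space M | B. B \<in> sets borel}"
    using XY by (auto simp: indep_random_vectors_def)
  interpret X: prob_space "distr M borel X" by (rule prob_space_distr) simp
  interpret Y: prob_space "distr M borel Y" by (rule prob_space_distr) simp
  have eq: "distr M borel X \<Otimes>\<^sub>M distr M borel Y = distr M (borel \<Otimes>\<^sub>M borel) (\<lambda>\<omega>. (X \<omega>, Y \<omega>))"
  proof (rule pair_measure_eqI)
    show "sigma_finite_measure (distr M borel X)" "sigma_finite_measure (distr M borel Y)" by unfold_locales
    fix A B assume "A \<in> sets (distr M borel X)" "B \<in> sets (distr M borel Y)"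
    then have AB[measurable]: "A \<in> sets borel" "B \<in> sets borel" by auto
    have "prob ((X -` A \<inter> space M) \<inter> (Y -` B \<inter> space M)) = prob (X -` A \<inter> space M) * prob (Y -` B \<inter> space M)"
      using AB by (intro indep_setD[OF ind]) auto
    moreover have "(\<lambda>\<omega>. (X \<omega>, Y \<omega>)) -` (A \<times> B) \<inter> space M = (X -` A \<inter> space M) \<inter> (Y -` B \<inter> space M)" by auto
    ultimately show "emeasure (distr M borel X) A * emeasure (distr M borel Y) B =
        emeasure (distr M (borel \<Otimes>\<^sub>M borel) (\<lambda>\<omega>. (X \<omega>, Y \<omega>))) (A \<times> B)"
      by (simp add: emeasure_distr emeasure_eq_measure ennreal_mult)
  qed simp
  interpret pair_prob_space "distr M borel X" "distr M borel Y" ..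
  have "(CLINT \<omega>|M. f (X \<omega>) * g (Y \<omega>)) = integral\<^sup>L (distr M (borel \<Otimes>\<^sub>M borel) (\<lambda>\<omega>. (X \<omega>, Y \<omega>))) (\<lambda>(x, y). f x * g y)"
    by (subst integral_distr) auto
  also have "\<dots> = integral\<^sup>L (distr M borel X \<Otimes>\<^sub>M distr M borel Y) (\<lambda>(x, y). f x * g y)"
    by (simp only: eq)
  also have "\<dots> = (CLINT x|distr M borel X. f x) * (CLINT y|distr M borel Y. g y)"
  proof (rule has_bochner_integral_integral_eq, rule has_bochner_integral_product)
    show "has_bochner_integral (distr M borel X) f (CLINT x|distr M borel X. f x)"
      using bf by (intro has_bochner_integral_integrable X.integrable_const_bound[of _ B]) auto
    show "has_bochner_integral (distr M borel Y) g (CLINT x|distr M borel Y. g x)"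
      using bg by (intro has_bochner_integral_integrable Y.integrable_const_bound[of _ B]) auto
  qed
  finally show ?thesis by (simp add: integral_distr)
qed

end

locale independent_sample = prob_space M for M :: "'w measure" +
  fixes X :: "'w \<Rightarrow> 'a::euclidean_space" and Y :: "'w \<Rightarrow> 'b::euclidean_space"
    and n :: nat and Xs :: "nat \<Rightarrow> 'w \<Rightarrow> 'a" and Ys :: "nat \<Rightarrow> 'w \<Rightarrow> 'b"
  assumes independent: "indep_random_vectors M X Y"
    and sample: "random_sample M X Y n Xs Ys" and sample_nonempty: "n > 0"
begin

abbreviation "A t \<equiv> centered_iexp M X t"
abbreviation "B s \<equiv> centered_iexp M Y s"

lemma X_measurable[measurable]: "X \<in> borel_measurable M" and Y_measurable[measurable]: "Y \<in> borel_measurable M"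
  using independent by (auto simp: indep_random_vectors_def)

lemma sample_measurable:
  assumes "k \<in> {1..n}"
  shows "Xs k \<in> borel_measurable M" "Ys k \<in> borel_measurable M"
proof -
  have Z: "(\<lambda>\<omega>. (Xs k \<omega>, Ys k \<omega>)) \<in> M \<rightarrow>\<^sub>M (borel \<Otimes>\<^sub>M borel)"
    unfolding borel_prod using sample assms by (auto simp: random_sample_def indep_vars_def)
  show "Xs k \<in> borel_measurable M" using measurable_compose[OF Z measurable_fst] by simp
  show "Ys k \<in> borel_measurable M" using measurable_compose[OF Z measurable_snd] by simp
qed

lemma sample_expectation:
  fixes f :: "'a \<times> 'b \<Rightarrow> complex"
  assumes k: "k \<in> {1..n}" and [measurable]: "f \<in> borel_measurable borel"
  shows "(CLINT \<omega>|M. f (Xs k \<omega>, Ys k \<omega>)) = (CLINT \<omega>|M. f (X \<omega>, Y \<omega>))"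
proof -
  have d: "distr M borel (\<lambda>\<omega>. (Xs k \<omega>, Ys k \<omega>)) = distr M borel (\<lambda>\<omega>. (X \<omega>, Y \<omega>))"
    using sample k by (auto simp: random_sample_def)
  note [measurable] = sample_measurable[OF k]
  have [measurable]: "(\<lambda>\<omega>. (Xs k \<omega>, Ys k \<omega>)) \<in> borel_measurable M" "(\<lambda>\<omega>. (X \<omega>, Y \<omega>)) \<in> borel_measurable M"
    unfolding borel_prod[symmetric] by measurable
  show ?thesis
    using integral_distr[of "\<lambda>\<omega>. (Xs k \<omega>, Ys k \<omega>)" M borel f] integral_distr[of "\<lambda>\<omega>. (X \<omega>, Y \<omega>)" M borel f]
    by (simp add: d)
qed

text \<open>Independence is used twice here: between different observations, and between the two components of one
observation.\<close>

lemma expectation_prod_sample: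
  fixes f :: "nat \<Rightarrow> 'a \<Rightarrow> complex" and g :: "nat \<Rightarrow> 'b \<Rightarrow> complex"
  assumes f[measurable]: "\<And>j. f j \<in> borel_measurable borel" and g[measurable]: "\<And>j. g j \<in> borel_measurable borel"
    and bf: "\<And>j x. cmod (f j x) \<le> C" and bg: "\<And>j y. cmod (g j y) \<le> C"
  shows "integrable M (\<lambda>\<omega>. \<Prod>j\<in>{1..n}. f j (Xs j \<omega>) * g j (Ys j \<omega>))" (is ?I)
    and "(CLINT \<omega>|M. \<Prod>j\<in>{1..n}. f j (Xs j \<omega>) * g j (Ys j \<omega>)) =
      (\<Prod>j\<in>{1..n}. CLINT \<omega>|M. f j (X \<omega>)) * (\<Prod>j\<in>{1..n}. CLINT \<omega>|M. g j (Y \<omega>))" (is ?E)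
proof -
  define h where "h j z = f j (fst z) * g j (snd z)" for j and z :: "'a \<times> 'b"
  have h[measurable]: "h j \<in> borel_measurable borel" for j
    unfolding h_def borel_prod[symmetric] by measurable
  have C: "0 \<le> C" using bf[of undefined undefined] norm_ge_zero order_trans by blast
  have ind: "indep_vars (\<lambda>_. borel) (\<lambda>j \<omega>. h j (Xs j \<omega>, Ys j \<omega>)) {1..n}"
  proof (rule indep_vars_compose2[where M' = "\<lambda>_. borel" and X = "\<lambda>k \<omega>. (Xs k \<omega>, Ys k \<omega>)" and Y = h])
    show "indep_vars (\<lambda>_. borel) (\<lambda>k \<omega>. (Xs k \<omega>, Ys k \<omega>)) {1..n}"
      using sample unfolding random_sample_def by (rule conjunct1)
  qed (rule h)
  have int: "integrable M (\<lambda>\<omega>. h j (Xs j \<omega>, Ys j \<omega>))" if "j \<in> {1..n}" for j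
  proof (rule integrable_const_bound[of _ "C * C"])
    note [measurable] = sample_measurable[OF that]
    show "(\<lambda>\<omega>. h j (Xs j \<omega>, Ys j \<omega>)) \<in> borel_measurable M" unfolding h_def by measurable
    show "AE \<omega> in M. cmod (h j (Xs j \<omega>, Ys j \<omega>)) \<le> C * C"
      using bf bg C by (auto simp: h_def norm_mult intro!: mult_mono)
  qed
  show ?I using indep_vars_integrable[OF _ ind int] by (simp add: h_def)
  have "(CLINT \<omega>|M. \<Prod>j\<in>{1..n}. h j (Xs j \<omega>, Ys j \<omega>)) = (\<Prod>j\<in>{1..n}. CLINT \<omega>|M. h j (Xs j \<omega>, Ys j \<omega>))"
    by (rule indep_vars_lebesgue_integral[OF _ ind int]) auto
  also have "\<dots> = (\<Prod>j\<in>{1..n}. (CLINT \<omega>|M. f j (X \<omega>)) * (CLINT \<omega>|M. g j (Y \<omega>)))"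
  proof (rule prod.cong[OF refl])
    fix j assume "j \<in> {1..n}"
    then have "(CLINT \<omega>|M. h j (Xs j \<omega>, Ys j \<omega>)) = (CLINT \<omega>|M. h j (X \<omega>, Y \<omega>))" by (intro sample_expectation) auto
    also have "\<dots> = (CLINT \<omega>|M. f j (X \<omega>)) * (CLINT \<omega>|M. g j (Y \<omega>))"
      unfolding h_def fst_conv snd_conv by (rule indep_random_vectors_expectation_mult[OF independent f g bf bg])
    finally show "(CLINT \<omega>|M. h j (Xs j \<omega>, Ys j \<omega>)) = (CLINT \<omega>|M. f j (X \<omega>)) * (CLINT \<omega>|M. g j (Y \<omega>))" .
  qed
  finally show ?E by (simp add: h_def prod.distrib)
qed

text \<open>If \<open>k\<close> and \<open>k'\<close> differ, then \<open>f\<close> is the only function of the \<open>k\<close>-th first component and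
contributes the factor zero; the same holds for \<open>l\<close>, \<open>l'\<close> and \<open>g\<close>. This computes the covariance of the
leading term and of the remainder below.\<close>

lemma expectation_four_products:
  fixes f f' :: "'a \<Rightarrow> complex" and g g' :: "'b \<Rightarrow> complex"
  assumes [measurable]: "f \<in> borel_measurable borel" "f' \<in> borel_measurable borel" "g \<in> borel_measurable borel" "g' \<in> borel_measurable borel"
    and bd: "\<And>x. cmod (f x) \<le> 2" "\<And>x. cmod (f' x) \<le> 2" "\<And>y. cmod (g y) \<le> 2" "\<And>y. cmod (g' y) \<le> 2"
    and mean: "(CLINT \<omega>|M. f (X \<omega>)) = 0" "(CLINT \<omega>|M. g (Y \<omega>)) = 0"
    and k: "k \<in> {1..n}" "k' \<in> {1..n}" and l: "l \<in> {1..n}" "l' \<in> {1..n}"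
  shows "has_bochner_integral M (\<lambda>\<omega>. f (Xs k \<omega>) * f' (Xs k' \<omega>) * (g (Ys l \<omega>) * g' (Ys l' \<omega>)))
     ((if k = k' then (CLINT \<omega>|M. f (X \<omega>) * f' (X \<omega>)) else 0) * (if l = l' then (CLINT \<omega>|M. g (Y \<omega>) * g' (Y \<omega>)) else 0))"
proof -
  \<comment> \<open>the four factors, regrouped by observation\<close>
  define F where "F j x = (if j = k then f x else 1) * (if j = k' then f' x else 1)" for j x
  define G where "G j y = (if j = l then g y else 1) * (if j = l' then g' y else 1)" for j y
  have [measurable]: "F j \<in> borel_measurable borel" "G j \<in> borel_measurable borel" for j
    unfolding F_def G_def by measurable
  have bF: "cmod (F j x) \<le> 2 * 2" for j x
    unfolding F_def norm_mult using bd by (intro mult_mono) auto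
  have bG: "cmod (G j y) \<le> 2 * 2" for j y
    unfolding G_def norm_mult using bd by (intro mult_mono) auto
  have prodE: "(\<Prod>j\<in>{1..n}. F j (Xs j \<omega>) * G j (Ys j \<omega>)) = f (Xs k \<omega>) * f' (Xs k' \<omega>) * (g (Ys l \<omega>) * g' (Ys l' \<omega>))" for \<omega>
    using k l by (simp add: F_def G_def prod.distrib prod.delta)
  have EF: "(\<Prod>j\<in>{1..n}. CLINT \<omega>|M. F j (X \<omega>)) = (if k = k' then (CLINT \<omega>|M. f (X \<omega>) * f' (X \<omega>)) else 0)"
  proof (cases "k = k'")
    case True
    then have "(\<Prod>j\<in>{1..n}. CLINT \<omega>|M. F j (X \<omega>)) = (\<Prod>j\<in>{1..n}. if j = k then (CLINT \<omega>|M. f (X \<omega>) * f' (X \<omega>)) else 1)"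
      by (intro prod.cong refl) (simp add: F_def prob_space)
    then show ?thesis using True k by simp
  next
    case False
    then have "(CLINT \<omega>|M. F k (X \<omega>)) = 0" by (simp add: F_def mean)
    then have "(\<Prod>j\<in>{1..n}. CLINT \<omega>|M. F j (X \<omega>)) = 0"
      using k(1) by (intro prod_zero) auto
    then show ?thesis using False by simp
  qed
  have EG: "(\<Prod>j\<in>{1..n}. CLINT \<omega>|M. G j (Y \<omega>)) = (if l = l' then (CLINT \<omega>|M. g (Y \<omega>) * g' (Y \<omega>)) else 0)"
  proof (cases "l = l'")
    case True
    then have "(\<Prod>j\<in>{1..n}. CLINT \<omega>|M. G j (Y \<omega>)) = (\<Prod>j\<in>{1..n}. if j = l then (CLINT \<omega>|M. g (Y \<omega>) * g' (Y \<omega>)) else 1)"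
      by (intro prod.cong refl) (simp add: G_def prob_space)
    then show ?thesis using True l by simp
  next
    case False
    then have "(CLINT \<omega>|M. G l (Y \<omega>)) = 0" by (simp add: G_def mean)
    then have "(\<Prod>j\<in>{1..n}. CLINT \<omega>|M. G j (Y \<omega>)) = 0"
      using l(1) by (intro prod_zero) auto
    then show ?thesis using False by simp
  qed
  show ?thesis
    using expectation_prod_sample[of F G "2 * 2"] bF bG unfolding prodE EF EG by (simp add: has_bochner_integral_iff)
qed

text \<open>The leading term of the normalised empirical process.\<close>

definition product_process :: "'a \<times> 'b \<Rightarrow> 'w \<Rightarrow> complex" where
  "product_process = (\<lambda>(t, s) \<omega>. (\<Sum>k=1..n. A t (Xs k \<omega>) * B s (Ys k \<omega>)) / complex_of_real (sqrt (real n)))"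

text \<open>What is left when the unknown characteristic functions \<open>f\<^sub>X\<close>, \<open>f\<^sub>Y\<close> are replaced by the empirical ones:
\<open>\<surd>n\<close> times the product of the two estimation errors.\<close>

definition remainder_process :: "'a \<times> 'b \<Rightarrow> 'w \<Rightarrow> complex" where
  "remainder_process = (\<lambda>(t, s) \<omega>. (\<Sum>k=1..n. A t (Xs k \<omega>)) * (\<Sum>l=1..n. B s (Ys l \<omega>)) / complex_of_real (real n * sqrt (real n)))"

text \<open>In terms of the centered variables \<open>a = exp (i t \<bullet> X) - f\<^sub>X(t)\<close> and \<open>b = exp (i s \<bullet> Y) - f\<^sub>Y(s)\<close> all terms cancel
except the mean of \<open>a b\<close> and the product of the means of \<open>a\<close> and \<open>b\<close>.\<close>

lemma sample_char_defect_decomposition: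
  "sqrt n * sample_char_defect n (\<lambda>k. Xs k \<omega>) (\<lambda>k. Ys k \<omega>) u = product_process u \<omega> - remainder_process u \<omega>"
proof -
  obtain t s where u: "u = (t, s)" by (cases u)
  let ?f = "charfun M X t" and ?g = "charfun M Y s"
  define a where "a k = A t (Xs k \<omega>)" for k
  define b where "b k = B s (Ys k \<omega>)" for k
  have e: "iexp (t \<bullet> Xs k \<omega>) = a k + ?f" "iexp (s \<bullet> Ys k \<omega>) = b k + ?g" for k
    by (simp_all add: a_def b_def centered_iexp_def)
  have n0: "complex_of_nat n \<noteq> 0" using sample_nonempty by simp
  have "sample_char_defect n (\<lambda>k. Xs k \<omega>) (\<lambda>k. Ys k \<omega>) u =
     (\<Sum>k=1..n. a k * b k) / n - (\<Sum>k=1..n. a k) * (\<Sum>k=1..n. b k) / (of_nat n * of_nat n)"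
    unfolding u sample_char_defect_def sample_char_def prod.case e
    using n0 by (simp add: algebra_simps sum.distrib sum_distrib_left[symmetric] sum_distrib_right[symmetric] add_divide_distrib)
  moreover define r where "r = complex_of_real (sqrt (real n))"
  have r: "r \<noteq> 0" using sample_nonempty by (simp add: r_def)
  have N: "complex_of_nat n = r * r" by (simp add: r_def flip: of_real_mult)
  have "r * (S / (r * r) - S' / (r * r * (r * r))) = S / r - S' / (r * r * r)" for S S'
    using r by (simp add: field_simps)
  ultimately show ?thesis
    by (simp only: u product_process_def remainder_process_def prod.case a_def b_def of_real_mult of_real_of_nat_eq N r_def[symmetric])
qed

text \<open>In the double sum over pairs of observations only the diagonal survives, and its \<open>n\<close> equal terms are
compensated by the normalisation; so the covariance function is that of the limit, for every sample size.\<close>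

lemma second_order_product_process: "second_order_process M product_process (limit_cov M X Y)"
proof
  have [measurable]: "Xs k \<in> borel_measurable M" "Ys k \<in> borel_measurable M" if "k \<in> {1..n}" for k
    using sample_measurable that by auto
  note [measurable] = charfun_measurable[OF X_measurable] charfun_measurable[OF Y_measurable]
  have jm: "(\<lambda>z. product_process (snd z) (fst z)) \<in> borel_measurable (M \<Otimes>\<^sub>M borel)"
    unfolding product_process_def centered_iexp_def split_def borel_prod[symmetric] by measurable
  then show "jointly_measurable_process M product_process"
    by (simp add: jointly_measurable_process_def split_def)
  have m[measurable]: "product_process u \<in> borel_measurable M" for u
    using measurable_compose[of "\<lambda>\<omega>. (\<omega>, u)" M "M \<Otimes>\<^sub>M borel", OF _ jm] by simp
  have bd: "cmod (product_process u \<omega>) \<le> 4 * n / sqrt n" for u \<omega>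
  proof -
    obtain t s where u: "u = (t, s)" by (cases u)
    have "cmod (A t x * B s y) \<le> 2 * 2" for x y
      unfolding norm_mult by (intro mult_mono cmod_centered_iexp_le) auto
    then have "cmod (\<Sum>k=1..n. A t (Xs k \<omega>) * B s (Ys k \<omega>)) \<le> (\<Sum>k=1..n. 2 * 2)"
      by (rule sum_norm_le)
    then show ?thesis by (simp add: u product_process_def norm_divide divide_right_mono)
  qed
  show "integrable M (\<lambda>\<omega>. (cmod (product_process u \<omega>))\<^sup>2)" for u
    using power_mono[OF bd, of u _ 2] by (intro integrable_const_bound[of _ "(4 * n / sqrt n)\<^sup>2"]) auto
  show "has_covariance_function M product_process (limit_cov M X Y)"
    unfolding has_covariance_function_def
  proof (intro allI)
    fix u v :: "'a \<times> 'b"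
    obtain t s t' s' where u: "u = (t, s)" and v: "v = (t', s')" by (cases u, cases v)
    let ?c = "\<lambda>k l \<omega>. A t (Xs k \<omega>) * cnj (A t' (Xs l \<omega>)) * (B s (Ys k \<omega>) * cnj (B s' (Ys l \<omega>)))"
    have four: "has_bochner_integral M (?c k l) (if k = l then limit_cov M X Y u v else 0)" if "k \<in> {1..n}" "l \<in> {1..n}" for k l
    proof -
      have "has_bochner_integral M (?c k l)
         ((if k = l then (CLINT \<omega>|M. A t (X \<omega>) * cnj (A t' (X \<omega>))) else 0) * (if k = l then (CLINT \<omega>|M. B s (Y \<omega>) * cnj (B s' (Y \<omega>))) else 0))"
        using that by (intro expectation_four_products[where f' = "\<lambda>x. cnj (A t' x)" and g' = "\<lambda>y. cnj (B s' y)"])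
          (auto simp: cmod_centered_iexp_le expectation_centered_iexp)
      then show ?thesis
        by (simp add: expectation_centered_iexp_product limit_cov_def u v split: if_splits)
    qed
    have n0: "sqrt n * sqrt n = n" by simp
    have "product_process u \<omega> * cnj (product_process v \<omega>) = (\<Sum>k=1..n. \<Sum>l=1..n. ?c k l \<omega>) / n" for \<omega>
    proof -
      have "(\<Sum>k=1..n. \<Sum>l=1..n. ?c k l \<omega>) = (\<Sum>k=1..n. A t (Xs k \<omega>) * B s (Ys k \<omega>)) * cnj (\<Sum>k=1..n. A t' (Xs k \<omega>) * B s' (Ys k \<omega>))"
        by (simp only: cnj_sum sum_product complex_cnj_mult mult_ac)
      moreover have "complex_of_real (sqrt n) * cnj (complex_of_real (sqrt n)) = n"
        by (simp flip: of_real_mult)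
      ultimately show ?thesis by (simp add: u v product_process_def)
    qed
    then have "(CLINT \<omega>|M. product_process u \<omega> * cnj (product_process v \<omega>)) =
        (CLINT \<omega>|M. (\<Sum>k=1..n. \<Sum>l=1..n. ?c k l \<omega>) / n)" by simp
    also have "\<dots> = (\<Sum>k=1..n. \<Sum>l=1..n. if k = l then limit_cov M X Y u v else 0) / n"
      by (intro has_bochner_integral_integral_eq has_bochner_integral_divide_zero has_bochner_integral_sum four)
    also have "\<dots> = limit_cov M X Y u v"
      using sample_nonempty by simp
    finally show "(CLINT \<omega>|M. product_process u \<omega> * cnj (product_process v \<omega>)) = limit_cov M X Y u v" .
  qed
qed

lemma hermitian_product_process: "hermitian_process M product_process"
  by (auto simp: hermitian_process_def product_process_def centered_iexp_uminus split_def)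

lemma remainder_process_jointly_measurable: "(\<lambda>z. remainder_process (snd z) (fst z)) \<in> borel_measurable (M \<Otimes>\<^sub>M borel)"
proof -
  have [measurable]: "Xs k \<in> borel_measurable M" "Ys k \<in> borel_measurable M" if "k \<in> {1..n}" for k
    using sample_measurable that by auto
  note [measurable] = charfun_measurable[OF X_measurable] charfun_measurable[OF Y_measurable]
  show ?thesis
    unfolding remainder_process_def centered_iexp_def split_def borel_prod[symmetric] by measurable
qed

lemma remainder_process_second_moment:
  "has_bochner_integral M (\<lambda>\<omega>. (cmod (remainder_process u \<omega>))\<^sup>2) (Re (limit_cov M X Y u u) / n)"
proof -
  obtain t s where u: "u = (t, s)" by (cases u)
  let ?c = "\<lambda>k k' l l' \<omega>. A t (Xs k \<omega>) * cnj (A t (Xs k' \<omega>)) * (B s (Ys l \<omega>) * cnj (B s (Ys l' \<omega>)))"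
  let ?v = "CLINT \<omega>|M. A t (X \<omega>) * cnj (A t (X \<omega>))" and ?w = "CLINT \<omega>|M. B s (Y \<omega>) * cnj (B s (Y \<omega>))"
  have four: "has_bochner_integral M (?c k k' l l') ((if k = k' then ?v else 0) * (if l = l' then ?w else 0))"
    if "k \<in> {1..n}" "k' \<in> {1..n}" "l \<in> {1..n}" "l' \<in> {1..n}" for k k' l l'
    using that by (intro expectation_four_products[where f' = "\<lambda>x. cnj (A t x)" and g' = "\<lambda>y. cnj (B s y)"])
      (auto simp: cmod_centered_iexp_le expectation_centered_iexp)
  have eq: "complex_of_real ((cmod (remainder_process u \<omega>))\<^sup>2) =
      (\<Sum>k=1..n. \<Sum>k'=1..n. \<Sum>l=1..n. \<Sum>l'=1..n. ?c k k' l l' \<omega>) / (n * n * n)" for \<omega>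
  proof -
    let ?a = "\<Sum>k=1..n. A t (Xs k \<omega>)" and ?b = "\<Sum>l=1..n. B s (Ys l \<omega>)"
    have "(\<Sum>k=1..n. \<Sum>k'=1..n. \<Sum>l=1..n. \<Sum>l'=1..n. ?c k k' l l' \<omega>) =
        (\<Sum>k=1..n. \<Sum>k'=1..n. A t (Xs k \<omega>) * cnj (A t (Xs k' \<omega>))) * (\<Sum>l=1..n. \<Sum>l'=1..n. B s (Ys l \<omega>) * cnj (B s (Ys l' \<omega>)))"
      unfolding sum_distrib_right unfolding sum_distrib_left ..
    also have "\<dots> = (?a * cnj ?a) * (?b * cnj ?b)"
      by (simp only: cnj_sum sum_product)
    finally have "(\<Sum>k=1..n. \<Sum>k'=1..n. \<Sum>l=1..n. \<Sum>l'=1..n. ?c k k' l l' \<omega>) = (?a * cnj ?a) * (?b * cnj ?b)" .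
    moreover have "complex_of_real (real n * sqrt (real n)) * cnj (complex_of_real (real n * sqrt (real n))) = n * n * n"
      by (simp flip: of_real_mult) (simp add: algebra_simps)
    ultimately show ?thesis
      unfolding complex_norm_square by (simp add: u remainder_process_def mult_ac)
  qed
  have "has_bochner_integral M (\<lambda>\<omega>. complex_of_real ((cmod (remainder_process u \<omega>))\<^sup>2))
     ((\<Sum>k=1..n. \<Sum>k'=1..n. \<Sum>l=1..n. \<Sum>l'=1..n. (if k = k' then ?v else 0) * (if l = l' then ?w else 0)) / (n * n * n))"
    unfolding eq by (intro has_bochner_integral_divide_zero has_bochner_integral_sum four)
  also have "(\<Sum>k=1..n. \<Sum>k'=1..n. \<Sum>l=1..n. \<Sum>l'=1..n. (if k = k' then ?v else 0) * (if l = l' then ?w else 0)) =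
      (\<Sum>k=1..n. \<Sum>k'=1..n. if k = k' then ?v else 0) * (\<Sum>l=1..n. \<Sum>l'=1..n. if l = l' then ?w else 0)"
    unfolding sum_distrib_right unfolding sum_distrib_left ..
  also have "\<dots> = n * n * limit_cov M X Y u u"
    by (simp add: expectation_centered_iexp_product limit_cov_def u)
  also have "n * n * limit_cov M X Y u u / (n * n * n) = limit_cov M X Y u u / n"
    using sample_nonempty by simp
  finally have "has_bochner_integral M (\<lambda>\<omega>. complex_of_real ((cmod (remainder_process u \<omega>))\<^sup>2)) (limit_cov M X Y u u / n)" .
  from has_bochner_integral_Re[OF this] show ?thesis by simp
qed

end

context prob_space
begin

lemma limit_cov_bounded:
  fixes X :: "'a \<Rightarrow> 'b::euclidean_space" and Y :: "'a \<Rightarrow> 'c::euclidean_space"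
  assumes "X \<in> borel_measurable M" "Y \<in> borel_measurable M"
  shows "cmod (limit_cov M X Y u v) \<le> 1"
  using mult_le_one[OF cmod_charfun_cov_le[OF assms(1)] norm_ge_zero cmod_charfun_cov_le[OF assms(2)]]
  by (cases u; cases v) (simp add: limit_cov_def norm_mult)

lemma limit_cov_continuous:
  fixes X :: "'a \<Rightarrow> 'b::euclidean_space" and Y :: "'a \<Rightarrow> 'c::euclidean_space"
  assumes "X \<in> borel_measurable M" "Y \<in> borel_measurable M"
  shows "continuous_on UNIV (\<lambda>(u, v). limit_cov M X Y u v)"
proof -
  have c: "continuous_on UNIV (\<lambda>z. charfun M Z (h z))" if "continuous_on UNIV h" "Z \<in> borel_measurable M"
    for Z :: "'a \<Rightarrow> 'd::euclidean_space" and h :: "('b \<times> 'c) \<times> ('b \<times> 'c) \<Rightarrow> 'd"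
    using continuous_on_compose2[OF continuous_charfun[OF that(2)] that(1)] by simp
  show ?thesis
    unfolding limit_cov_def split_def by (intro continuous_intros c assms)
qed

lemma limit_cov_diag:
  fixes X :: "'a \<Rightarrow> 'b::euclidean_space" and Y :: "'a \<Rightarrow> 'c::euclidean_space"
  shows "Re (limit_cov M X Y (t, s) (t, s)) = (1 - (cmod (charfun M X t))\<^sup>2) * (1 - (cmod (charfun M Y s))\<^sup>2)"
proof -
  have "limit_cov M X Y (t, s) (t, s) = complex_of_real ((1 - (cmod (charfun M X t))\<^sup>2) * (1 - (cmod (charfun M Y s))\<^sup>2))"
    unfolding of_real_mult of_real_diff of_real_1 complex_norm_square by (simp add: limit_cov_def charfun_def prob_space)
  then show ?thesis by (simp only: Re_complex_of_real)
qed

lemma limit_cov_diag_finite: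
  fixes X :: "'a \<Rightarrow> 'b::euclidean_space" and Y :: "'a \<Rightarrow> 'c::euclidean_space"
  assumes X: "X \<in> borel_measurable M" "integrable M (\<lambda>\<omega>. norm (X \<omega>))"
    and Y: "Y \<in> borel_measurable M" "integrable M (\<lambda>\<omega>. norm (Y \<omega>))"
  shows "(\<integral>\<^sup>+u. ennreal (Re (limit_cov M X Y u u)) \<partial>(kernel_measure \<Otimes>\<^sub>M kernel_measure)) < \<infinity>"
proof -
  interpret KY: sigma_finite_measure "kernel_measure :: 'c measure" by (rule sigma_finite_kernel_measure)
  note [measurable] = charfun_measurable[OF X(1)] charfun_measurable[OF Y(1)]
  have le: "0 \<le> 1 - (cmod (charfun M Z t))\<^sup>2" for Z :: "'a \<Rightarrow> 'd::euclidean_space" and t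
    using cmod_charfun_le[of Z t] power_le_one[of "cmod (charfun M Z t)" 2] by simp
  have m: "(\<lambda>u. ennreal (Re (limit_cov M X Y u u))) \<in> borel_measurable (kernel_measure \<Otimes>\<^sub>M kernel_measure)"
  proof -
    have "(\<lambda>(t, s). ennreal ((1 - (cmod (charfun M X t))\<^sup>2) * (1 - (cmod (charfun M Y s))\<^sup>2))) \<in> borel_measurable (kernel_measure \<Otimes>\<^sub>M kernel_measure)"
      by measurable
    then show ?thesis by (simp add: split_def limit_cov_diag[symmetric])
  qed
  have "(\<integral>\<^sup>+u. ennreal (Re (limit_cov M X Y u u)) \<partial>(kernel_measure \<Otimes>\<^sub>M kernel_measure)) =
     (\<integral>\<^sup>+t. \<integral>\<^sup>+s. ennreal (1 - (cmod (charfun M X t))\<^sup>2) * ennreal (1 - (cmod (charfun M Y s))\<^sup>2) \<partial>kernel_measure \<partial>kernel_measure)"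
    by (subst KY.nn_integral_fst[OF m, symmetric]) (simp only: limit_cov_diag ennreal_mult[OF le le])
  also have "\<dots> = (\<integral>\<^sup>+t. ennreal (1 - (cmod (charfun M X t))\<^sup>2) \<partial>kernel_measure) * (\<integral>\<^sup>+s. ennreal (1 - (cmod (charfun M Y s))\<^sup>2) \<partial>kernel_measure)"
    by (simp add: nn_integral_cmult nn_integral_multc)
  also have "\<dots> < \<infinity>"
    using nn_integral_charfun_variance[OF X] nn_integral_charfun_variance[OF Y] by (simp add: ennreal_mult_less_top)
  finally show ?thesis .
qed

end

context independent_sample
begin

lemma expectation_product_process: "(CLINT \<omega>|M. product_process u \<omega>) = 0"
proof -
  obtain t s where u: "u = (t, s)" by (cases u)
  define h where "h z = A t (fst z) * B s (snd z)" for z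
  have [measurable]: "h \<in> borel_measurable borel"
    unfolding h_def borel_prod[symmetric] by measurable
  have "has_bochner_integral M (\<lambda>\<omega>. A t (Xs k \<omega>) * B s (Ys k \<omega>)) 0" if k: "k \<in> {1..n}" for k
    unfolding has_bochner_integral_iff
  proof
    note [measurable] = sample_measurable[OF k]
    have "cmod (A t x * B s y) \<le> 2 * 2" for x y
      unfolding norm_mult by (intro mult_mono cmod_centered_iexp_le) auto
    then show "integrable M (\<lambda>\<omega>. A t (Xs k \<omega>) * B s (Ys k \<omega>))"
      by (intro integrable_const_bound[of _ "2 * 2"]) auto
    have "(CLINT \<omega>|M. h (Xs k \<omega>, Ys k \<omega>)) = (CLINT \<omega>|M. h (X \<omega>, Y \<omega>))"
      by (rule sample_expectation[OF k]) measurable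
    also have "\<dots> = (CLINT \<omega>|M. A t (X \<omega>)) * (CLINT \<omega>|M. B s (Y \<omega>))"
      unfolding h_def fst_conv snd_conv
      by (rule indep_random_vectors_expectation_mult[OF independent _ _ cmod_centered_iexp_le cmod_centered_iexp_le]) measurable
    also have "\<dots> = 0" by (simp add: expectation_centered_iexp)
    finally show "(CLINT \<omega>|M. A t (Xs k \<omega>) * B s (Ys k \<omega>)) = 0" by (simp add: h_def)
  qed
  then have "has_bochner_integral M (\<lambda>\<omega>. (\<Sum>k=1..n. A t (Xs k \<omega>) * B s (Ys k \<omega>)) / complex_of_real (sqrt (real n))) ((\<Sum>k=1..n. 0) / complex_of_real (sqrt (real n)))"
    by (intro has_bochner_integral_divide_zero has_bochner_integral_sum)
  then show ?thesis
    unfolding u product_process_def prod.case by (simp add: has_bochner_integral_iff)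
qed

lemma dcov_sq_measurable: "(\<lambda>\<omega>. dcov_sq n (\<lambda>k. Xs k \<omega>) (\<lambda>k. Ys k \<omega>)) \<in> borel_measurable M"
proof -
  have [measurable]: "Xs k \<in> borel_measurable M" "Ys k \<in> borel_measurable M" if "k \<in> {1..n}" for k
    using sample_measurable that by auto
  show ?thesis unfolding dcov_sq_def double_centered_def dist_matrix_def by measurable
qed

lemma dcov_sq_nonneg: "0 \<le> dcov_sq n x y"
  using dcov_sq_eq_integral[OF sample_nonempty, of x y]
  by (metis (no_types, lifting) Bochner_Integration.integral_nonneg has_bochner_integral_integral_eq zero_le_power2)

text \<open>The remainder has second moment \<open>R(u,u) / n\<close>. Choosing \<open>e\<close> of order \<open>n\<^bsup>-1/2\<^esup>\<close> makes the bound tend to zero.\<close>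

lemma dcov_sq_approximation:
  fixes \<mu> :: "('a \<times> 'b) measure"
  defines "\<mu> \<equiv> kernel_measure \<Otimes>\<^sub>M kernel_measure"
  assumes fin: "(\<integral>\<^sup>+u. ennreal (Re (limit_cov M X Y u u)) \<partial>\<mu>) < \<infinity>" and e: "e > 0"
  shows "(\<integral>\<^sup>+\<omega>. ennreal \<bar>real n * dcov_sq n (\<lambda>k. Xs k \<omega>) (\<lambda>k. Ys k \<omega>) - (LINT u|\<mu>. (cmod (product_process u \<omega>))\<^sup>2)\<bar> \<partial>M) \<le>
     ennreal ((1 + 1 / e) / n + e) * (\<integral>\<^sup>+u. ennreal (Re (limit_cov M X Y u u)) \<partial>\<mu>)"
proof -
  interpret second_order_process M product_process "limit_cov M X Y" by (rule second_order_product_process)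
  interpret K: pair_sigma_finite "kernel_measure :: 'a measure" "kernel_measure :: 'b measure"
    by (rule pair_sigma_finite_kernel_measure)
  have sets[measurable_cong]: "sets \<mu> = sets borel" unfolding \<mu>_def by (rule sets_kernel_measure_pair)
  interpret sigma_finite_measure \<mu> unfolding \<mu>_def by unfold_locales
  interpret pair_sigma_finite M \<mu> ..
  note [measurable] = remainder_process_jointly_measurable
  let ?R = "\<lambda>u. Re (limit_cov M X Y u u)"
  have Rm[measurable]: "(\<lambda>u. limit_cov M X Y u u) \<in> borel_measurable borel"
    using continuous_on_compose2[OF limit_cov_continuous[OF X_measurable Y_measurable], of UNIV "\<lambda>u. (u, u)"]
    by (intro borel_measurable_continuous_onI) (simp add: continuous_on_Pair continuous_on_id)
  define g where "g = (\<lambda>z. product_process (snd z) (fst z))"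
  define q where "q = (\<lambda>z. remainder_process (snd z) (fst z))"
  define f where "f = (\<lambda>z. g z - q z)"
  have g[measurable]: "g \<in> borel_measurable (M \<Otimes>\<^sub>M \<mu>)" unfolding g_def by measurable
  have q[measurable]: "q \<in> borel_measurable (M \<Otimes>\<^sub>M \<mu>)" unfolding q_def by measurable
  have f[measurable]: "f \<in> borel_measurable (M \<Otimes>\<^sub>M \<mu>)" unfolding f_def by measurable
  have iq: "integrable M (\<lambda>\<omega>. (cmod (q (\<omega>, u)))\<^sup>2)" and eq: "(LINT \<omega>|M. (cmod (q (\<omega>, u)))\<^sup>2) = ?R u / n" for u
    using remainder_process_second_moment[of u] by (simp_all add: has_bochner_integral_iff q_def)
  have ig: "integrable M (\<lambda>\<omega>. (cmod (g (\<omega>, u)))\<^sup>2)" and eg: "(LINT \<omega>|M. (cmod (g (\<omega>, u)))\<^sup>2) = ?R u" for u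
    using square_integrable[of u] expectation_norm_square[of u] by (simp_all add: g_def)
  have fn: "(LINT u|\<mu>. (cmod (f (\<omega>, u)))\<^sup>2) = real n * dcov_sq n (\<lambda>k. Xs k \<omega>) (\<lambda>k. Ys k \<omega>)" for \<omega>
  proof -
    have "(cmod (f (\<omega>, u)))\<^sup>2 = real n * (cmod (sample_char_defect n (\<lambda>k. Xs k \<omega>) (\<lambda>k. Ys k \<omega>) u))\<^sup>2" for u
      unfolding f_def g_def q_def fst_conv snd_conv sample_char_defect_decomposition[symmetric]
      by (simp add: norm_mult power_mult_distrib)
    then show ?thesis
      using dcov_sq_eq_integral[OF sample_nonempty, of "\<lambda>k. Xs k \<omega>" "\<lambda>k. Ys k \<omega>"]
      by (simp add: has_bochner_integral_iff \<mu>_def)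
  qed
  have gg: "(\<integral>\<^sup>+u. \<integral>\<^sup>+\<omega>. ennreal ((cmod (g (\<omega>, u)))\<^sup>2) \<partial>M \<partial>\<mu>) < \<infinity>"
    using fin by (simp add: nn_integral_eq_integral ig eg)
  have le_int: "(\<integral>\<^sup>+u. \<integral>\<^sup>+\<omega>. ennreal (F \<omega> u) \<partial>M \<partial>\<mu>) \<le> ennreal (a / n + b) * (\<integral>\<^sup>+u. ennreal (?R u) \<partial>\<mu>)"
    if F: "\<And>\<omega> u. F \<omega> u \<le> a * (cmod (q (\<omega>, u)))\<^sup>2 + b * (cmod (g (\<omega>, u)))\<^sup>2" and ab: "a \<ge> 0" "b \<ge> 0" for F a b
  proof -
    have "(\<integral>\<^sup>+u. \<integral>\<^sup>+\<omega>. ennreal (F \<omega> u) \<partial>M \<partial>\<mu>) \<le> (\<integral>\<^sup>+u. \<integral>\<^sup>+\<omega>. ennreal (a * (cmod (q (\<omega>, u)))\<^sup>2 + b * (cmod (g (\<omega>, u)))\<^sup>2) \<partial>M \<partial>\<mu>)"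
      using F by (intro nn_integral_mono ennreal_leI)
    also have "\<dots> = (\<integral>\<^sup>+u. ennreal (a * (?R u / n) + b * ?R u) \<partial>\<mu>)"
    proof (rule nn_integral_cong)
      fix u
      have "(\<integral>\<^sup>+\<omega>. ennreal (a * (cmod (q (\<omega>, u)))\<^sup>2 + b * (cmod (g (\<omega>, u)))\<^sup>2) \<partial>M) =
          ennreal (LINT \<omega>|M. a * (cmod (q (\<omega>, u)))\<^sup>2 + b * (cmod (g (\<omega>, u)))\<^sup>2)"
        using ab iq ig by (intro nn_integral_eq_integral) auto
      then show "(\<integral>\<^sup>+\<omega>. ennreal (a * (cmod (q (\<omega>, u)))\<^sup>2 + b * (cmod (g (\<omega>, u)))\<^sup>2) \<partial>M) = ennreal (a * (?R u / n) + b * ?R u)"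
        by (simp add: iq ig eq eg)
    qed
    also have "\<dots> = (\<integral>\<^sup>+u. ennreal (a / n + b) * ennreal (?R u) \<partial>\<mu>)"
    proof (rule nn_integral_cong)
      fix u
      have "a * (?R u / n) + b * ?R u = (a / n + b) * ?R u" by (simp add: algebra_simps)
      then show "ennreal (a * (?R u / n) + b * ?R u) = ennreal (a / n + b) * ennreal (?R u)"
        using ab by (simp only: ennreal_mult' add_nonneg_nonneg divide_nonneg_nonneg of_nat_0_le_iff)
    qed
    also have "\<dots> = ennreal (a / n + b) * (\<integral>\<^sup>+u. ennreal (?R u) \<partial>\<mu>)"
      by (rule nn_integral_cmult) measurable
    finally show ?thesis .
  qed
  have "(cmod (f (\<omega>, u)))\<^sup>2 \<le> 2 * (cmod (q (\<omega>, u)))\<^sup>2 + 2 * (cmod (g (\<omega>, u)))\<^sup>2" for \<omega> u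
  proof -
    have "(cmod (f (\<omega>, u)))\<^sup>2 \<le> (cmod (g (\<omega>, u)) + cmod (q (\<omega>, u)))\<^sup>2"
      unfolding f_def by (intro power_mono norm_triangle_ineq4) auto
    also have "\<dots> \<le> 2 * (cmod (q (\<omega>, u)))\<^sup>2 + 2 * (cmod (g (\<omega>, u)))\<^sup>2"
      using sum_squares_bound[of "cmod (g (\<omega>, u))" "cmod (q (\<omega>, u))"] by (simp add: power2_sum)
    finally show ?thesis .
  qed
  then have "(\<integral>\<^sup>+u. \<integral>\<^sup>+\<omega>. ennreal ((cmod (f (\<omega>, u)))\<^sup>2) \<partial>M \<partial>\<mu>) \<le> ennreal (2 / n + 2) * (\<integral>\<^sup>+u. ennreal (?R u) \<partial>\<mu>)"
    by (intro le_int) auto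
  also have "\<dots> < \<infinity>" using fin by (simp add: ennreal_mult_less_top)
  finally have ff: "(\<integral>\<^sup>+u. \<integral>\<^sup>+\<omega>. ennreal ((cmod (f (\<omega>, u)))\<^sup>2) \<partial>M \<partial>\<mu>) < \<infinity>" .
  have "(\<integral>\<^sup>+\<omega>. ennreal \<bar>(LINT u|\<mu>. (cmod (f (\<omega>, u)))\<^sup>2) - (LINT u|\<mu>. (cmod (g (\<omega>, u)))\<^sup>2)\<bar> \<partial>M) \<le>
      (\<integral>\<^sup>+u. \<integral>\<^sup>+\<omega>. ennreal \<bar>(cmod (f (\<omega>, u)))\<^sup>2 - (cmod (g (\<omega>, u)))\<^sup>2\<bar> \<partial>M \<partial>\<mu>)"
    by (rule nn_integral_square_norm_diff_le[OF f g ff gg])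
  also have "\<dots> \<le> ennreal ((1 + 1 / e) / n + e) * (\<integral>\<^sup>+u. ennreal (?R u) \<partial>\<mu>)"
  proof (rule le_int)
    show "\<bar>(cmod (f (\<omega>, u)))\<^sup>2 - (cmod (g (\<omega>, u)))\<^sup>2\<bar> \<le> (1 + 1 / e) * (cmod (q (\<omega>, u)))\<^sup>2 + e * (cmod (g (\<omega>, u)))\<^sup>2" for \<omega> u
      using abs_square_diff_le[OF e, of "f (\<omega>, u)" "g (\<omega>, u)"] by (simp add: f_def norm_minus_commute)
  qed (use e in auto)
  finally show ?thesis unfolding fn by (simp add: g_def)
qed

end

section \<open>The limit theorem\<close>

lemma gaussian_process_second_order:
  fixes \<zeta> :: "'u::euclidean_space \<Rightarrow> 'v \<Rightarrow> complex"
  assumes gauss: "complex_gaussian_process N \<zeta>" and cov: "has_covariance_function N \<zeta> R" and jm: "jointly_measurable_process N \<zeta>"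
  shows "second_order_process N \<zeta> R"
proof -
  interpret prob_space N using gauss by (simp add: complex_gaussian_process_def)
  show ?thesis
  proof
    fix u
    have g: "gaussian_rv N (\<lambda>\<omega>. \<Sum>u\<in>U. a u * Re (\<zeta> u \<omega>) + b u * Im (\<zeta> u \<omega>))" if "finite U" for U a b
      using gauss that by (auto simp: complex_gaussian_process_def)
    have "integrable N (\<lambda>\<omega>. (Re (\<zeta> u \<omega>))\<^sup>2)" "integrable N (\<lambda>\<omega>. (Im (\<zeta> u \<omega>))\<^sup>2)"
      using gaussian_rv_square_integrable[OF prob_space_axioms g[of "{u}" "\<lambda>_. 1" "\<lambda>_. 0"]]
        gaussian_rv_square_integrable[OF prob_space_axioms g[of "{u}" "\<lambda>_. 0" "\<lambda>_. 1"]] by simp_all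
    then show "integrable N (\<lambda>\<omega>. (cmod (\<zeta> u \<omega>))\<^sup>2)" by (simp add: cmod_power2)
  qed (use cov jm in auto)
qed

lemma gaussian_process_char:
  fixes \<zeta> :: "'u::euclidean_space \<Rightarrow> 'v \<Rightarrow> complex"
  assumes gauss: "complex_gaussian_process N \<zeta>" and zero: "zero_mean_process N \<zeta>" and cov: "has_covariance_function N \<zeta> R"
    and herm: "hermitian_process N \<zeta>" and jm: "jointly_measurable_process N \<zeta>" and U: "finite U"
  shows "(CLINT \<omega>|N. iexp (\<Sum>u\<in>U. a u * Re (\<zeta> u \<omega>) + b u * Im (\<zeta> u \<omega>))) = exp (- (linear_functional_variance R U a b / 2))"
proof -
  interpret second_order_process N \<zeta> R by (rule gaussian_process_second_order[OF gauss cov jm])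
  have i: "integrable N (\<zeta> u)" for u
    using square_integrable_imp_integrable[OF _ square_integrable[of u]] by (auto intro: integrable_norm_cancel)
  have "(LINT \<omega>|N. Re (\<zeta> u \<omega>)) = 0" "(LINT \<omega>|N. Im (\<zeta> u \<omega>)) = 0" for u
    using zero integral_Re[OF i[of u]] integral_Im[OF i[of u]] by (auto simp: zero_mean_process_def)
  then have mean: "(LINT \<omega>|N. (\<Sum>u\<in>U. a u * Re (\<zeta> u \<omega>) + b u * Im (\<zeta> u \<omega>))) = 0"
    using integrable_Re[OF i] integrable_Im[OF i] by (subst Bochner_Integration.integral_sum) auto
  have "gaussian_rv N (\<lambda>\<omega>. \<Sum>u\<in>U. a u * Re (\<zeta> u \<omega>) + b u * Im (\<zeta> u \<omega>))"
    using gauss U by (auto simp: complex_gaussian_process_def)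
  from gaussian_rv_char[OF prob_space_axioms this mean] show ?thesis
    by (simp only: expectation_linear_functional_square[OF herm U])
qed

text \<open>A linear functional of the leading term is a normalised sum of values of one bounded function \<open>h\<close> at the
observations. The variance of \<open>h\<close> is read off from a sample of size one, which has the same covariance
function.\<close>

lemma product_process_char_tendsto:
  fixes X :: "'w \<Rightarrow> 'a::euclidean_space" and Y :: "'w \<Rightarrow> 'b::euclidean_space"
  assumes S: "\<And>n. independent_sample M X Y (Suc n) (Xs (Suc n)) (Ys (Suc n))" and U: "finite U"
  shows "(\<lambda>n. CLINT \<omega>|M. iexp (\<Sum>u\<in>U. a u * Re (independent_sample.product_process M X Y (Suc n) (Xs (Suc n)) (Ys (Suc n)) u \<omega>) +
      b u * Im (independent_sample.product_process M X Y (Suc n) (Xs (Suc n)) (Ys (Suc n)) u \<omega>)))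
    \<longlonglongrightarrow> exp (- (linear_functional_variance (limit_cov M X Y) U a b / 2))"
proof -
  let ?A = "centered_iexp M X" and ?B = "centered_iexp M Y"
  interpret S1: independent_sample M X Y "Suc 0" "Xs (Suc 0)" "Ys (Suc 0)" by (rule S)
  define h where "h z = (\<Sum>u\<in>U. a u * Re (?A (fst u) (fst z) * ?B (snd u) (snd z)) + b u * Im (?A (fst u) (fst z) * ?B (snd u) (snd z)))" for z
  have h[measurable]: "h \<in> borel_measurable borel"
    unfolding h_def borel_prod[symmetric] by measurable
  define Z where "Z n k \<omega> = h (Xs n k \<omega>, Ys n k \<omega>)" for n k \<omega>
  have linear: "(\<Sum>u\<in>U. a u * Re (independent_sample.product_process M X Y (Suc n) (Xs (Suc n)) (Ys (Suc n)) u \<omega>) +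
      b u * Im (independent_sample.product_process M X Y (Suc n) (Xs (Suc n)) (Ys (Suc n)) u \<omega>)) = (\<Sum>k=1..Suc n. Z (Suc n) k \<omega>) / sqrt (real (Suc n))" for n \<omega>
  proof -
    interpret S: independent_sample M X Y "Suc n" "Xs (Suc n)" "Ys (Suc n)" by (rule S)
    have "(\<Sum>k=1..Suc n. Z (Suc n) k \<omega>) =
       (\<Sum>u\<in>U. a u * (\<Sum>k=1..Suc n. Re (?A (fst u) (Xs (Suc n) k \<omega>) * ?B (snd u) (Ys (Suc n) k \<omega>))) +
          b u * (\<Sum>k=1..Suc n. Im (?A (fst u) (Xs (Suc n) k \<omega>) * ?B (snd u) (Ys (Suc n) k \<omega>))))"
      unfolding Z_def h_def fst_conv snd_conv
      by (subst sum.swap) (simp only: sum.distrib sum_distrib_left)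
    then show ?thesis
      unfolding S.product_process_def split_def Re_divide_of_real Im_divide_of_real Re_sum Im_sum
      by (simp only: sum_divide_distrib[symmetric] add_divide_distrib[symmetric] times_divide_eq_right)
  qed
  have sm: "random_sample M X Y (Suc n) (Xs (Suc n)) (Ys (Suc n))" for n
    using S[of n] by (simp add: independent_sample_def independent_sample_axioms_def)
  have hd: "distr M borel (Z (Suc n) k) = distr M borel (\<lambda>\<omega>. h (X \<omega>, Y \<omega>))" if "k \<in> {1..Suc n}" for n k
  proof -
    interpret S: independent_sample M X Y "Suc n" "Xs (Suc n)" "Ys (Suc n)" by (rule S)
    note [measurable] = S.sample_measurable[OF that]
    have [measurable]: "(\<lambda>\<omega>. (Xs (Suc n) k \<omega>, Ys (Suc n) k \<omega>)) \<in> borel_measurable M" "(\<lambda>\<omega>. (X \<omega>, Y \<omega>)) \<in> borel_measurable M"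
      unfolding borel_prod[symmetric] by measurable
    have "distr (distr M borel (\<lambda>\<omega>. (Xs (Suc n) k \<omega>, Ys (Suc n) k \<omega>))) borel h = distr (distr M borel (\<lambda>\<omega>. (X \<omega>, Y \<omega>))) borel h"
      using sm[of n] that by (auto simp: random_sample_def)
    then show ?thesis by (simp add: distr_distr comp_def Z_def[abs_def])
  qed
  \<comment> \<open>the sample is given from size one on; at \<open>n = 0\<close> the summands are set to zero\<close>
  define W where "W n = (if n = 0 then (\<lambda>k \<omega>. 0) else Z n)" for n
  have mean: "(LINT \<omega>|M. Z (Suc 0) (Suc 0) \<omega>) = 0"
    and var: "(LINT \<omega>|M. (Z (Suc 0) (Suc 0) \<omega>)\<^sup>2) = linear_functional_variance (limit_cov M X Y) U a b"
  proof -
    interpret P1: second_order_process M S1.product_process "limit_cov M X Y" by (rule S1.second_order_product_process)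
    have z: "Z (Suc 0) (Suc 0) \<omega> = (\<Sum>u\<in>U. a u * Re (S1.product_process u \<omega>) + b u * Im (S1.product_process u \<omega>))" for \<omega>
      using linear[of 0 \<omega>] by simp
    show "(LINT \<omega>|M. (Z (Suc 0) (Suc 0) \<omega>)\<^sup>2) = linear_functional_variance (limit_cov M X Y) U a b"
      unfolding z by (rule P1.expectation_linear_functional_square[OF S1.hermitian_product_process U])
    have i: "integrable M (S1.product_process u)" for u
      using S1.square_integrable_imp_integrable[OF _ P1.square_integrable[of u]] by (auto intro: integrable_norm_cancel)
    have "(LINT \<omega>|M. Re (S1.product_process u \<omega>)) = 0" "(LINT \<omega>|M. Im (S1.product_process u \<omega>)) = 0" for u
      using S1.expectation_product_process[of u] integral_Re[OF i[of u]] integral_Im[OF i[of u]] by auto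
    then show "(LINT \<omega>|M. Z (Suc 0) (Suc 0) \<omega>) = 0"
      unfolding z using integrable_Re[OF i] integrable_Im[OF i] by (subst Bochner_Integration.integral_sum) auto
  qed
  have "(\<lambda>n. CLINT \<omega>|M. iexp ((\<Sum>k=1..n. W n k \<omega>) / sqrt (real n))) \<longlonglongrightarrow> exp (- ((LINT \<omega>|M. (Z (Suc 0) (Suc 0) \<omega>)\<^sup>2) / 2))"
  proof (rule S1.CLT_triangular_array_char)
    show "S1.indep_vars (\<lambda>_. borel) (W n) {1..n}" for n
    proof (cases n)
      case 0
      then show ?thesis by (simp add: S1.indep_vars_def S1.indep_sets_def)
    next
      case (Suc m)
      have "S1.indep_vars (\<lambda>_. borel) (\<lambda>k \<omega>. (Xs (Suc m) k \<omega>, Ys (Suc m) k \<omega>)) {1..Suc m}"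
        using sm[of m] unfolding random_sample_def by (rule conjunct1)
      then have "S1.indep_vars (\<lambda>_. borel) (\<lambda>k \<omega>. h (Xs (Suc m) k \<omega>, Ys (Suc m) k \<omega>)) {1..Suc m}"
        by (rule S1.indep_vars_compose2[where Y = "\<lambda>_. h"]) (rule h)
      then show ?thesis by (simp add: W_def Z_def[abs_def] Suc)
    qed
    show "distr M borel (W n k) = distr M borel (Z (Suc 0) (Suc 0))" if "k \<in> {1..n}" for n k
      using that hd[of k "n - 1"] hd[of "Suc 0" 0] by (cases n) (auto simp: W_def)
    show "Z (Suc 0) (Suc 0) \<in> borel_measurable M"
    proof -
      note [measurable] = S1.sample_measurable[of "Suc 0"]
      have [measurable]: "(\<lambda>\<omega>. (Xs (Suc 0) (Suc 0) \<omega>, Ys (Suc 0) (Suc 0) \<omega>)) \<in> borel_measurable M"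
        unfolding borel_prod[symmetric] by measurable
      show ?thesis unfolding Z_def by measurable
    qed
    show "\<bar>Z (Suc 0) (Suc 0) \<omega>\<bar> \<le> (\<Sum>u\<in>U. \<bar>a u\<bar> * 4 + \<bar>b u\<bar> * 4)" for \<omega>
    proof -
      have ab: "cmod (?A t x * ?B s y) \<le> 2 * 2" for t x s y
        unfolding norm_mult by (intro mult_mono S1.cmod_centered_iexp_le) auto
      have "\<bar>a u * Re (?A t x * ?B s y) + b u * Im (?A t x * ?B s y)\<bar> \<le> \<bar>a u\<bar> * 4 + \<bar>b u\<bar> * 4" for u t x s y
      proof -
        have r: "\<bar>Re (?A t x * ?B s y)\<bar> \<le> 4" using abs_Re_le_cmod[of "?A t x * ?B s y"] ab[of t x s y] by linarith
        have i: "\<bar>Im (?A t x * ?B s y)\<bar> \<le> 4" using abs_Im_le_cmod[of "?A t x * ?B s y"] ab[of t x s y] by linarith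
        show ?thesis
          by (intro order_trans[OF abs_triangle_ineq] add_mono) (auto simp only: abs_mult abs_ge_zero intro!: mult_left_mono r i)
      qed
      then show ?thesis
        unfolding Z_def h_def by (intro order_trans[OF sum_abs] sum_mono)
    qed
  qed (rule mean)
  from LIMSEQ_Suc[OF this] show ?thesis
    by (simp add: var W_def linear del: sum.cl_ivl_Suc of_nat_Suc)
qed

theorem theorem5:
  fixes M :: "'w measure"
    and X :: "'w \<Rightarrow> real^'p" and Y :: "'w \<Rightarrow> real^'q"
    and Xs :: "nat \<Rightarrow> nat \<Rightarrow> 'w \<Rightarrow> real^'p" and Ys :: "nat \<Rightarrow> nat \<Rightarrow> 'w \<Rightarrow> real^'q"
    and N :: "'v measure" and \<zeta> :: "(real^'p) \<times> (real^'q) \<Rightarrow> 'v \<Rightarrow> complex"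
  assumes "prob_space M"
    and "X \<in> borel_measurable M" and "Y \<in> borel_measurable M"
    and "\<And>n. random_sample M X Y n (Xs n) (Ys n)"
    and "complex_gaussian_process N \<zeta>"
    and "zero_mean_process N \<zeta>"
    and "has_covariance_function N \<zeta> (limit_cov M X Y)"
    and "hermitian_process N \<zeta>"
    and "jointly_measurable_process N \<zeta>"
    and "indep_random_vectors M X Y"
    and "integrable M (\<lambda>\<omega>. norm (X \<omega>) + norm (Y \<omega>))"
  shows "weak_conv_m
           (\<lambda>n. distr M borel (\<lambda>\<omega>. real n * dcov_sq n (\<lambda>k. Xs n k \<omega>) (\<lambda>k. Ys n k \<omega>)))
           (distr N borel (\<lambda>\<omega>. weighted_norm_sq (\<lambda>u. \<zeta> u \<omega>)))"
proof -
  interpret M: prob_space M by fact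
  interpret N: second_order_process N \<zeta> "limit_cov M X Y"
    by (rule gaussian_process_second_order) fact+
  interpret K: pair_sigma_finite "kernel_measure :: (real^'p) measure" "kernel_measure :: (real^'q) measure"
    by (rule pair_sigma_finite_kernel_measure)
  let ?R = "limit_cov M X Y"
  define \<mu> where "\<mu> = (kernel_measure \<Otimes>\<^sub>M kernel_measure :: ((real^'p) \<times> (real^'q)) measure)"
  have sets[measurable_cong]: "sets \<mu> = sets borel" unfolding \<mu>_def by (rule sets_kernel_measure_pair)
  have sf: "sigma_finite_measure \<mu>" unfolding \<mu>_def by unfold_locales
  interpret \<mu>: sigma_finite_measure \<mu> by (rule sf)
  have S: "independent_sample M X Y (Suc n) (Xs (Suc n)) (Ys (Suc n))" for n
    by (intro independent_sample.intro independent_sample_axioms.intro assms) simp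
  have intX: "integrable M (\<lambda>\<omega>. norm (X \<omega>))" and intY: "integrable M (\<lambda>\<omega>. norm (Y \<omega>))"
    by (rule Bochner_Integration.integrable_bound[OF \<open>integrable M (\<lambda>\<omega>. norm (X \<omega>) + norm (Y \<omega>))\<close>];
        use \<open>X \<in> borel_measurable M\<close> \<open>Y \<in> borel_measurable M\<close> in simp)+
  have fin: "(\<integral>\<^sup>+u. ennreal (Re (?R u u)) \<partial>\<mu>) < \<infinity>"
    unfolding \<mu>_def by (intro M.limit_cov_diag_finite intX intY assms)
  define K where "K = enn2real (\<integral>\<^sup>+u. ennreal (Re (?R u u)) \<partial>\<mu>)"
  have K: "(\<integral>\<^sup>+u. ennreal (Re (?R u u)) \<partial>\<mu>) = ennreal K" "K \<ge> 0"
    using fin by (auto simp: K_def less_top)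
  have R1: "cmod (?R u v) \<le> 1" for u v by (intro M.limit_cov_bounded assms)
  have Rcont: "continuous_on UNIV (\<lambda>(u, v). ?R u v)" by (intro M.limit_cov_continuous assms)

  define T where "T n \<omega> = real n * dcov_sq n (\<lambda>k. Xs n k \<omega>) (\<lambda>k. Ys n k \<omega>)" for n \<omega>
  define T' where "T' \<omega> = (LINT u|\<mu>. (cmod (\<zeta> u \<omega>))\<^sup>2)" for \<omega>
  \<comment> \<open>shifted by one, since a sample of size zero carries no empirical process\<close>
  define \<xi> where "\<xi> n = independent_sample.product_process M X Y (Suc n) (Xs (Suc n)) (Ys (Suc n))" for n
  have SO: "second_order_process M (\<xi> n) ?R" for n
    unfolding \<xi>_def by (rule independent_sample.second_order_product_process[OF S])
  define Q where "Q n \<omega> = (LINT u|\<mu>. (cmod (\<xi> n u \<omega>))\<^sup>2)" for n \<omega>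

  have T_meas: "T n \<in> borel_measurable M" for n
  proof (cases n)
    case (Suc m)
    then show ?thesis using independent_sample.dcov_sq_measurable[OF S[of m]] unfolding T_def by simp
  qed (simp add: T_def[abs_def])
  have T_nonneg: "0 \<le> T n \<omega>" for n \<omega>
  proof (cases n)
    case (Suc m)
    then show ?thesis unfolding T_def by (intro mult_nonneg_nonneg) (simp_all only: Suc of_nat_0_le_iff independent_sample.dcov_sq_nonneg[OF S])
  qed (simp add: T_def)
  have L2_meas: "(\<lambda>\<omega>. LINT u|\<mu>. (cmod (\<gamma> u \<omega>))\<^sup>2) \<in> borel_measurable P"
    if "second_order_process P \<gamma> ?R" for P :: "'z measure" and \<gamma>
  proof -
    interpret P: second_order_process P \<gamma> ?R by fact
    show ?thesis by measurable
  qed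
  have T'_meas: "T' \<in> borel_measurable N"
    unfolding T'_def by (rule L2_meas) unfold_locales
  have Q_meas: "Q n \<in> borel_measurable M" for n
    unfolding Q_def by (rule L2_meas[OF SO])
  have nonneg: "0 \<le> Q n \<omega>" "0 \<le> T' \<omega>'" for n \<omega> \<omega>' unfolding Q_def T'_def by simp_all

  have Laplace: "(\<lambda>n. LINT \<omega>|M. exp (- (real k * T (Suc n) \<omega>))) \<longlonglongrightarrow> (LINT \<omega>|N. exp (- (real k * T' \<omega>)))" for k :: nat
  proof (rule tendsto_by_approximation)
    fix \<epsilon> :: real assume \<epsilon>: "\<epsilon> > 0"
    \<comment> \<open>two errors of size \<open>d\<close>, each multiplied by the Lipschitz constant \<open>k\<close> of \<open>exp (- (k * x))\<close>\<close>
    define d where "d = \<epsilon> / (2 * (real k + 1))"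
    have d: "d > 0" using \<epsilon> by (simp add: d_def)
    have "2 * (real k + 1) * d = \<epsilon>" by (simp add: d_def add_nonneg_eq_0_iff)
    then have kd: "real k * (d + d) \<le> \<epsilon>" "real k * d \<le> \<epsilon>"
      using d mult_nonneg_nonneg[of "real k" d] by (auto simp: algebra_simps)
    obtain D r e where D: "D \<in> sets borel" "emeasure \<mu> D < \<infinity>" "simple_function \<mu> r" "e > 0"
      and small: "(\<integral>\<^sup>+u. ennreal ((1 + 1 / e) * cov_increment ?R u (r u) + e) * indicator D u + ennreal (Re (?R u u)) * indicator (- D) u \<partial>\<mu>) \<le> ennreal d"
      using discretization_exists[OF sf sets fin R1 Rcont d] by blast
    define m where "m v = measure \<mu> (D \<inter> r -` {v})" for v
    define V where "V = range r"
    have V: "finite V" using D(3) sets_eq_imp_space_eq[OF sets] by (simp add: V_def simple_function_def)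
    have discr: "(\<integral>\<^sup>+\<omega>. ennreal \<bar>(LINT u|\<mu>. (cmod (\<gamma> u \<omega>))\<^sup>2) - (\<Sum>v\<in>V. m v * (cmod (\<gamma> v \<omega>))\<^sup>2)\<bar> \<partial>P) \<le> ennreal d"
      if "second_order_process P \<gamma> ?R" for P :: "'z measure" and \<gamma>
      using second_order_process.discretization_error[OF that sf sets fin R1 D] small unfolding m_def V_def by (rule order_trans)
    define y where "y n = (LINT \<omega>|M. exp (- (real k * (\<Sum>v\<in>V. m v * (cmod (\<xi> n v \<omega>))\<^sup>2))))" for n
    define l where "l = (LINT \<omega>|N. exp (- (real k * (\<Sum>v\<in>V. m v * (cmod (\<zeta> v \<omega>))\<^sup>2))))"
    have sum_nonneg: "0 \<le> (\<Sum>v\<in>V. m v * (cmod (f v))\<^sup>2)" for f :: "(real^'p) \<times> (real^'q) \<Rightarrow> complex"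
      by (intro sum_nonneg) (simp add: m_def)
    have fdd_meas: "(\<lambda>\<omega>. \<Sum>v\<in>V. m v * (cmod (\<gamma> v \<omega>))\<^sup>2) \<in> borel_measurable P"
      if "second_order_process P \<gamma> ?R" for P :: "'z measure" and \<gamma>
    proof -
      interpret P: second_order_process P \<gamma> ?R by fact
      show ?thesis by measurable
    qed

    have "y \<longlonglongrightarrow> l"
    proof -
      \<comment> \<open>the real and imaginary parts of the values at \<open>V\<close> as one family of real variables\<close>
      define part where "part j z = (if snd j then Re z else Im z)" for j :: "((real^'p) \<times> (real^'q)) \<times> bool" and z
      have split_sum: "(\<Sum>j\<in>V \<times> UNIV. h j) = (\<Sum>v\<in>V. h (v, True) + h (v, False))" for h :: "((real^'p) \<times> (real^'q)) \<times> bool \<Rightarrow> real"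
      proof -
        have "(\<Sum>j\<in>V \<times> UNIV. h j) = (\<Sum>v\<in>V. \<Sum>b\<in>UNIV. h (v, b))"
          by (simp only: sum.cartesian_product split_def prod.collapse)
        then show ?thesis by (simp add: UNIV_bool add.commute)
      qed
      have quad: "(\<Sum>j\<in>V \<times> UNIV. real k * m (fst j) * (part j (f (fst j)))\<^sup>2) = real k * (\<Sum>v\<in>V. m v * (cmod (f v))\<^sup>2)"
        for f :: "(real^'p) \<times> (real^'q) \<Rightarrow> complex"
        by (simp add: split_sum part_def cmod_power2 sum_distrib_left algebra_simps)
      have lin: "(\<Sum>j\<in>V \<times> UNIV. c j * part j (f (fst j))) = (\<Sum>v\<in>V. c (v, True) * Re (f v) + c (v, False) * Im (f v))"
        for c and f :: "(real^'p) \<times> (real^'q) \<Rightarrow> complex"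
        by (simp add: split_sum part_def)
      have "(\<lambda>n. LINT \<omega>|M. exp (- (\<Sum>j\<in>V \<times> UNIV. real k * m (fst j) * (part j (\<xi> n (fst j) \<omega>))\<^sup>2))) \<longlonglongrightarrow>
            (LINT \<omega>|N. exp (- (\<Sum>j\<in>V \<times> UNIV. real k * m (fst j) * (part j (\<zeta> (fst j) \<omega>))\<^sup>2)))"
      proof (rule exp_quadratic_form_converges[OF M.prob_space_axioms N.prob_space_axioms])
        show "(\<lambda>\<omega>. part j (\<xi> n (fst j) \<omega>)) \<in> borel_measurable M" for n j
          using second_order_process.measurable_process[OF SO[of n], of "fst j"] unfolding part_def by (cases "snd j") simp_all
        show "(\<lambda>\<omega>. part j (\<zeta> (fst j) \<omega>)) \<in> borel_measurable N" for j
          unfolding part_def by (cases "snd j") simp_all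
        show "(\<lambda>n. CLINT \<omega>|M. iexp (\<Sum>j\<in>V \<times> UNIV. c j * part j (\<xi> n (fst j) \<omega>))) \<longlonglongrightarrow>
              (CLINT \<omega>|N. iexp (\<Sum>j\<in>V \<times> UNIV. c j * part j (\<zeta> (fst j) \<omega>)))" for c
          unfolding lin[of c "\<lambda>v. \<xi> _ v _"] lin[of c "\<lambda>v. \<zeta> v _"] gaussian_process_char[OF assms(5,6,7,8,9) V]
          unfolding \<xi>_def by (rule product_process_char_tendsto[OF S V])
      qed (auto simp: V m_def)
      then show ?thesis unfolding quad[of "\<lambda>v. \<xi> _ v _"] quad[of "\<lambda>v. \<zeta> v _"]
        by (simp only: y_def[abs_def] l_def)
    qed
    moreover have "\<forall>\<^sub>F n in sequentially. norm ((LINT \<omega>|M. exp (- (real k * T (Suc n) \<omega>))) - y n) \<le> \<epsilon>"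
    proof -
      \<comment> \<open>the bound of \<open>dcov_sq_approximation\<close> for a sample of size \<open>Suc n\<close> with \<open>e = 1 / sqrt (Suc n)\<close>\<close>
      define c where "c n = ((1 + sqrt (Suc n)) / Suc n + 1 / sqrt (Suc n)) * K" for n
      have "c \<longlonglongrightarrow> 0 * K"
        unfolding c_def by (intro tendsto_mult tendsto_const) real_asymp
      then have "\<forall>\<^sub>F n in sequentially. c n < d"
        using d by (intro order_tendstoD(2)[where y = 0]) auto
      then show ?thesis
      proof eventually_elim
        case (elim n)
        have "(\<integral>\<^sup>+\<omega>. ennreal \<bar>T (Suc n) \<omega> - Q n \<omega>\<bar> \<partial>M) \<le> ennreal ((1 + 1 / (1 / sqrt (Suc n))) / Suc n + 1 / sqrt (Suc n)) * ennreal K"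
          unfolding T_def Q_def \<xi>_def K(1)[symmetric] unfolding \<mu>_def
          by (rule independent_sample.dcov_sq_approximation[OF S]) (use fin in \<open>simp_all add: \<mu>_def\<close>)
        also have "\<dots> = ennreal (c n)"
          using K(2) by (simp add: c_def ennreal_mult'' del: of_nat_Suc)
        also have "\<dots> \<le> ennreal d" using elim by (intro ennreal_leI) simp
        finally have TQ: "(\<integral>\<^sup>+\<omega>. ennreal \<bar>T (Suc n) \<omega> - Q n \<omega>\<bar> \<partial>M) \<le> ennreal d" .
        have "(\<integral>\<^sup>+\<omega>. ennreal \<bar>T (Suc n) \<omega> - (\<Sum>v\<in>V. m v * (cmod (\<xi> n v \<omega>))\<^sup>2)\<bar> \<partial>M) \<le>
          (\<integral>\<^sup>+\<omega>. ennreal \<bar>T (Suc n) \<omega> - Q n \<omega>\<bar> + ennreal \<bar>Q n \<omega> - (\<Sum>v\<in>V. m v * (cmod (\<xi> n v \<omega>))\<^sup>2)\<bar> \<partial>M)"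
          by (intro nn_integral_mono) (simp flip: ennreal_plus)
        also have "\<dots> = (\<integral>\<^sup>+\<omega>. ennreal \<bar>T (Suc n) \<omega> - Q n \<omega>\<bar> \<partial>M) + (\<integral>\<^sup>+\<omega>. ennreal \<bar>Q n \<omega> - (\<Sum>v\<in>V. m v * (cmod (\<xi> n v \<omega>))\<^sup>2)\<bar> \<partial>M)"
          using T_meas Q_meas fdd_meas[OF SO] by (intro nn_integral_add) auto
        also have "\<dots> \<le> ennreal d + ennreal d"
          using TQ discr[OF SO[of n]] unfolding Q_def by (rule add_mono)
        finally have "(\<integral>\<^sup>+\<omega>. ennreal \<bar>T (Suc n) \<omega> - (\<Sum>v\<in>V. m v * (cmod (\<xi> n v \<omega>))\<^sup>2)\<bar> \<partial>M) \<le> ennreal (d + d)"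
          by (simp only: ennreal_plus[OF less_imp_le[OF d] less_imp_le[OF d]])
        then have "\<bar>(LINT \<omega>|M. exp (- (real k * T (Suc n) \<omega>))) - y n\<bar> \<le> real k * (d + d)"
          unfolding y_def using d T_nonneg sum_nonneg
          by (intro Laplace_transform_diff_le M.prob_space_axioms T_meas fdd_meas[OF SO]) auto
        then show ?case using kd(1) by simp
      qed
    qed
    moreover have "norm ((LINT \<omega>|N. exp (- (real k * T' \<omega>))) - l) \<le> \<epsilon>"
    proof -
      have "\<bar>(LINT \<omega>|N. exp (- (real k * T' \<omega>))) - l\<bar> \<le> real k * d"
        unfolding l_def using d nonneg sum_nonneg discr[OF N.second_order_process_axioms] unfolding T'_def[symmetric]
        by (intro Laplace_transform_diff_le N.prob_space_axioms T'_meas fdd_meas N.second_order_process_axioms) auto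
      then show ?thesis using kd(2) by simp
    qed
    ultimately show "\<exists>y l. y \<longlonglongrightarrow> l \<and> (\<forall>\<^sub>F n in sequentially. norm ((LINT \<omega>|M. exp (- (real k * T (Suc n) \<omega>))) - y n) \<le> \<epsilon>) \<and>
        norm ((LINT \<omega>|N. exp (- (real k * T' \<omega>))) - l) \<le> \<epsilon>" by blast
  qed

  have "weak_conv_m (\<lambda>n. distr M borel (T n)) (distr N borel T')"
    by (rule weak_conv_of_Laplace_transforms[OF M.prob_space_axioms N.prob_space_axioms T_meas T'_meas T_nonneg nonneg(2) LIMSEQ_imp_Suc[OF Laplace]])
  moreover have "distr N borel T' = distr N borel (\<lambda>\<omega>. weighted_norm_sq (\<lambda>u. \<zeta> u \<omega>))"
  proof (rule distr_cong[OF refl refl])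
    fix \<omega> assume "\<omega> \<in> space N"
    then have "(\<lambda>u. (\<omega>, u)) \<in> borel \<rightarrow>\<^sub>M N \<Otimes>\<^sub>M borel" by measurable
    from measurable_compose[OF this N.joint_measurable]
    show "T' \<omega> = weighted_norm_sq (\<lambda>u. \<zeta> u \<omega>)"
      by (simp add: weighted_norm_sq_eq T'_def \<mu>_def)
  qed
  ultimately show ?thesis by (simp only: T_def[abs_def])
qed

end
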